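(* Let $\mu,\lambda$ be infinite cardinals and let $\langle\chi_i:i<\mathrm{cf}(\lambda)\rangle$ be an increasing sequence of regular cardinals such that \[\mathrm{cf}(\lambda)<\mu=\left(2^{\mathrm{cf}(\lambda)}\right)^+<\lambda=\sup_{i<\mathrm{cf}(\lambda)}\chi_i\quad\text{and}\quad \mu<\chi_0 .\] If $\mathbb{B}$ is a Boolean algebra satisfying $\mathrm{hd}(\mathbb{B})=\lambda$, then $\mathrm{hd}_{(8)}^+(\mathbb{B})=\lambda^+$ (and thus also $\mathrm{hd}_{(0)}^+(\mathbb{B})=\mathrm{hd}_{(7)}^+(\mathbb{B})=\mathrm{hd}_{(5)}^+(\mathbb{B})=\lambda^+$).
   Context: $\mathrm{Ult}(\mathbb{B})$ is the Stone space (space of ultrafilters) of $\mathbb{B}$. The density $d(X)$ of a topological space $X$ is the minimal size of a dense subset of $X$; the topological density of a Boolean algebra is $d(\mathbb{B})=d(\mathrm{Ult}(\mathbb{B}))$; the algebraic density is $\pi(\mathbb{B})=\min\{|A|:A\subseteq\mathbb{B}\setminus\{\mathbf{0}\}\text{ and }(\forall b\in\mathbb{B}\setminus\{\mathbf{0}\})(\exists a\in A)(a\leq b)\}$. A sequence $\langle a_\xi:\xi<\kappa\rangle$ of elements of $\mathbb{B}$ is left-separated if $a_\xi\nleq\bigvee_{\zeta\in w}a_\zeta$ for each $\xi<\kappa$ and each finite $w\subseteq\kappa\setminus(\xi+1)$. For an infinite Boolean algebra $\mathbb{B}$: - $\mathrm{hd}(\mathbb{B})=\sup\{\kappa:\text{there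 is a left-separated sequence of length }\kappa\text{ in }\mathbb{B}\}$ (the hereditary density; $\kappa$ ranges over cardinals); - $\mathrm{hd}_{(0)}^{+}(\mathbb{B})=\sup\{d(X)^{+}:X\text{ is a subspace of }\mathrm{Ult}(\mathbb{B})\}$; - $\mathrm{hd}_{(5)}^{+}(\mathbb{B})=\sup\{\kappa^{+}:\text{there is a left-separated sequence of length }\kappa\text{ in }\mathbb{B}\}$; - $\mathrm{hd}_{(7)}^{+}(\mathbb{B})=\sup\{\pi(\mathbb{B}^* )^{+}:\mathbb{B}^*\text{ is a homomorphic image of }\mathbb{B}\}$; - $\mathrm{hd}_{(8)}^{+}(\mathbb{B})=\sup\{d(\mathbb{B}^* )^{+}:\mathbb{B}^*\text{ is a homomorphic image of }\mathbb{B}\}$. Here $\kappa^+$ denotes the cardinal successor of $\kappa$. *)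

theory Defs
  imports "HOL-Analysis.Function_Topology" "HOL-Algebra.Lattice"
begin

unbundle cardinal_syntax

section \<open>Minima, suprema and cofinality of cardinals\<close>

text \<open>A cardinal is a relation \<open>r\<close> with \<^term>\<open>Card_order r\<close>. Cardinals are only meaningful up
  to \<open>=o\<close>, so \<open>card_Min\<close> and \<open>card_Sup\<close> pick one representative.\<close>

definition card_Min :: "'x rel set \<Rightarrow> 'x rel" where
  "card_Min C = (SOME r. r \<in> C \<and> (\<forall>s\<in>C. r \<le>o s))"

definition card_Sup :: "'x rel set \<Rightarrow> 'x rel" where
  "card_Sup C = card_Min {s. Card_order s \<and> (\<forall>r\<in>C. r \<le>o s)}"

lemma card_Min:
  assumes "C \<noteq> {}" and "\<And>r. r \<in> C \<Longrightarrow> Card_order r"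
  shows "card_Min C \<in> C" and "\<And>s. s \<in> C \<Longrightarrow> card_Min C \<le>o s"
proof -
  have "\<exists>r. r \<in> C \<and> (\<forall>s\<in>C. r \<le>o s)"
    using exists_minim_Card_order[of C] assms by blast
  from someI_ex[OF this]
  show "card_Min C \<in> C" and "\<And>s. s \<in> C \<Longrightarrow> card_Min C \<le>o s"
    unfolding card_Min_def by auto
qed

lemma card_Sup:
  fixes C :: "'x rel set"
  assumes C: "\<And>r. r \<in> C \<Longrightarrow> Card_order r"
  shows Card_order_card_Sup: "Card_order (card_Sup C)"
    and card_Sup_upper: "\<And>r. r \<in> C \<Longrightarrow> r \<le>o card_Sup C"
    and card_Sup_least: "\<And>s :: 'y rel. Card_order s \<Longrightarrow> (\<And>r. r \<in> C \<Longrightarrow> r \<le>o s) \<Longrightarrow> card_Sup C \<le>o s"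
proof -
  let ?U = "{s :: 'x rel. Card_order s \<and> (\<forall>r\<in>C. r \<le>o s)}"
  have "r \<le>o |UNIV :: 'x set|" if "r \<in> C" for r
    by (rule ordIso_ordLeq_trans[OF ordIso_symmetric[OF card_of_Field_ordIso[OF C[OF that]]]
          card_of_mono1[OF subset_UNIV]])
  then have ne: "?U \<noteq> {}"
    using card_of_Card_order[of "UNIV :: 'x set"] by blast
  have mem: "card_Sup C \<in> ?U"
    unfolding card_Sup_def by (rule card_Min(1)[OF ne]) auto
  then show co: "Card_order (card_Sup C)" and "\<And>r. r \<in> C \<Longrightarrow> r \<le>o card_Sup C"
    by auto
  fix s :: "'y rel"
  assume s: "Card_order s" and ub: "\<And>r. r \<in> C \<Longrightarrow> r \<le>o s"
  show "card_Sup C \<le>o s"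
  proof (rule ccontr)
    assume "\<not> card_Sup C \<le>o s"
    then have "s <o card_Sup C"
      using not_ordLeq_iff_ordLess[OF card_order_on_well_order_on[OF s] card_order_on_well_order_on[OF co]]
      by simp
    then obtain p :: "'x rel" where p: "s =o p" "p <o card_Sup C"
      using internalize_ordLess[of s "card_Sup C"] by blast
    have "Card_order p"
      using Card_order_ordIso2[OF s p(1)] .
    moreover have "r \<le>o p" if "r \<in> C" for r
      using ordLeq_ordIso_trans[OF ub[OF that] p(1)] .
    ultimately have "p \<in> ?U" by blast
    then have "card_Sup C \<le>o p"
      unfolding card_Sup_def by (intro card_Min(2)[OF ne]) auto
    then show False
      using not_ordLess_ordLeq[OF p(2)] by simp
  qed
qed

text \<open>\<^const>\<open>cofinal\<close> asks for strictly larger elements; for infinite cardinals, which have no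
  largest element, this is the usual unboundedness.\<close>

definition cofinality :: "'l rel \<Rightarrow> 'l rel" where
  "cofinality r = card_Min {|K| | K. K \<subseteq> Field r \<and> cofinal K r}"

section \<open>Boolean algebras, homomorphic images and Stone spaces\<close>

text \<open>Boolean algebras are taken as distributive complemented lattices with an explicit carrier,
  so that one can quantify over all homomorphic images of a given one.\<close>

locale boolean_lattice = Lattice.bounded_lattice L for L (structure) +
  assumes meet_join_distrib:
      "\<lbrakk>x \<in> carrier L; y \<in> carrier L; z \<in> carrier L\<rbrakk> \<Longrightarrow> x \<sqinter> (y \<squnion> z) = (x \<sqinter> y) \<squnion> (x \<sqinter> z)"
    and complement_exists:
      "x \<in> carrier L \<Longrightarrow> \<exists>y\<in>carrier L. x \<squnion> y = \<top> \<and> x \<sqinter> y = \<bottom>"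

definition boolean_hom :: "'a gorder \<Rightarrow> 'b gorder \<Rightarrow> ('a \<Rightarrow> 'b) set" where
  "boolean_hom B C = {h \<in> carrier B \<rightarrow> carrier C.
     join_pres B C h \<and> meet_pres B C h \<and> h \<bottom>\<^bsub>B\<^esub> = \<bottom>\<^bsub>C\<^esub> \<and> h \<top>\<^bsub>B\<^esub> = \<top>\<^bsub>C\<^esub>}"

definition homomorphic_image :: "'a gorder \<Rightarrow> 'b gorder \<Rightarrow> bool" where
  "homomorphic_image B C \<longleftrightarrow>
     boolean_lattice C \<and> (\<exists>h \<in> boolean_hom B C. h ` carrier B = carrier C)"

definition ultrafilters :: "'a gorder \<Rightarrow> 'a set set" where
  "ultrafilters B = {F. F \<subseteq> carrier B \<and> \<top>\<^bsub>B\<^esub> \<in> F \<and> \<bottom>\<^bsub>B\<^esub> \<notin> F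
     \<and> (\<forall>x\<in>F. \<forall>y\<in>F. x \<sqinter>\<^bsub>B\<^esub> y \<in> F)
     \<and> (\<forall>x\<in>F. \<forall>y\<in>carrier B. x \<sqsubseteq>\<^bsub>B\<^esub> y \<longrightarrow> y \<in> F)
     \<and> (\<forall>x\<in>carrier B. \<forall>y\<in>carrier B.
          x \<squnion>\<^bsub>B\<^esub> y = \<top>\<^bsub>B\<^esub> \<and> x \<sqinter>\<^bsub>B\<^esub> y = \<bottom>\<^bsub>B\<^esub> \<longrightarrow> x \<in> F \<or> y \<in> F)}"

definition Ult :: "'a gorder \<Rightarrow> 'a set topology" where
  "Ult B = topology_generated_by {{F \<in> ultrafilters B. b \<in> F} | b. b \<in> carrier B}"

section \<open>Cardinal invariants\<close>

definition density :: "'p topology \<Rightarrow> 'p rel" where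
  "density X = card_Min {|D| | D. D \<subseteq> topspace X \<and> X closure_of D = topspace X}"

definition topological_density :: "'a gorder \<Rightarrow> 'a set rel" where
  "topological_density B = density (Ult B)"

definition algebraic_density :: "'a gorder \<Rightarrow> 'a rel" where
  "algebraic_density B = card_Min {|A| | A. A \<subseteq> carrier B - {\<bottom>\<^bsub>B\<^esub>} \<and>
     (\<forall>b \<in> carrier B - {\<bottom>\<^bsub>B\<^esub>}. \<exists>a\<in>A. a \<sqsubseteq>\<^bsub>B\<^esub> b)}"

text \<open>A sequence of length \<open>\<kappa>\<close> is indexed by \<^term>\<open>Field \<kappa>\<close>, well-ordered by \<open>\<kappa>\<close>;
  \<^term>\<open>aboveS \<kappa> \<xi>\<close> plays the role of \<open>\<kappa> - (\<xi> + 1)\<close>.\<close>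

definition left_separated :: "'a gorder \<Rightarrow> 'i rel \<Rightarrow> ('i \<Rightarrow> 'a) \<Rightarrow> bool" where
  "left_separated B \<kappa> a \<longleftrightarrow> a \<in> Field \<kappa> \<rightarrow> carrier B \<and>
     (\<forall>\<xi> \<in> Field \<kappa>. \<forall>w. finite w \<and> w \<subseteq> aboveS \<kappa> \<xi> \<longrightarrow>
        \<not> a \<xi> \<sqsubseteq>\<^bsub>B\<^esub> \<Squnion>\<^bsub>B\<^esub> (a ` w))"

text \<open>In the following suprema it is no loss to let \<open>\<kappa>\<close> range over cardinals on the type of the
  elements of \<open>B\<close>, because the entries of a left-separated sequence are distinct. Likewise, every
  homomorphic image of \<open>B\<close> is isomorphic to one whose carrier is a set of representatives
  in \<open>B\<close>, so the homomorphic images may be taken on the same type.\<close>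

definition hereditary_density :: "'a gorder \<Rightarrow> 'a rel" where
  "hereditary_density B = card_Sup {\<kappa> :: 'a rel. Card_order \<kappa> \<and> (\<exists>a. left_separated B \<kappa> a)}"

definition hd0_plus :: "'a gorder \<Rightarrow> 'a set set rel" where
  "hd0_plus B = card_Sup {cardSuc (density (subtopology (Ult B) X)) | X. X \<subseteq> topspace (Ult B)}"

definition hd5_plus :: "'a gorder \<Rightarrow> 'a set rel" where
  "hd5_plus B = card_Sup {cardSuc \<kappa> | \<kappa> :: 'a rel. Card_order \<kappa> \<and> (\<exists>a. left_separated B \<kappa> a)}"

definition hd7_plus :: "'a gorder \<Rightarrow> 'a set rel" where
  "hd7_plus B = card_Sup {cardSuc (algebraic_density C) | C :: 'a gorder. homomorphic_image B C}"

definition hd8_plus :: "'a gorder \<Rightarrow> 'a set set rel" where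
  "hd8_plus B = card_Sup {cardSuc (topological_density C) | C :: 'a gorder. homomorphic_image B C}"

end

theory Submission
  imports Defs
begin

text \<open>
  Let \<open>X\<close> be the Stone space of \<open>B\<close> and \<open>\<kappa> = cf(\<lambda>)\<close>. Homomorphic images of \<open>B\<close> are the algebras of
  clopen subsets of closed subspaces of \<open>X\<close>, so the statement about \<open>hd\<^sub>8\<close> asks for a closed subspace of
  density \<open>\<lambda>\<close>, while the hypothesis \<open>hd(B) = \<lambda>\<close> gives, for every \<open>i < \<kappa>\<close>, some subspace of density at
  least \<open>\<chi>\<^sub>i\<close>. Call a set large at \<open>i\<close> if it has such a subspace. Because \<open>\<chi>\<^sub>i\<close> is regular, a union of
  fewer than \<open>\<chi>\<^sub>i\<close> sets that are not large at \<open>i\<close> is not large at \<open>i\<close> (\<open>large_UN\<close>); this applies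
  in particular to unions of \<open>\<mu>\<close> sets.

  For one regular cardinal \<open>\<chi>\<close> there is no difference between subspaces and closed subspaces
  (\<open>thick_imp_closed_thick\<close>): if \<open>T\<close> has density at least \<open>\<chi>\<close> and its closure does not, then some point
  of the closure has \<open>\<pi>\<close>-character at least \<open>\<chi>\<close>, hence there is a free sequence of length \<open>\<chi>\<close>, and the
  closure of a free sequence has \<open>\<chi>\<close> isolated points.

  To combine all \<open>i\<close>, consider in a closed set \<open>F\<close> the points that have a neighbourhood whose trace on
  \<open>F\<close> is not large at \<open>i\<close>. Suppose first that for some \<open>F\<close> and \<open>i\<close> the set of these points is large at
  every \<open>j\<close>. It then has discrete subsets of every size \<open>\<chi>\<^sub>j\<close>, and the chosen neighbourhood of a
  point meets each of them in fewer than \<open>\<chi>\<^sub>i\<close> points, a bound that depends neither on the point nor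
  on \<open>j\<close>. This is the situation of Hajnal's theorem on free sets for set mappings
  (\<open>free_transversal\<close>); it yields one discrete set of size \<open>\<lambda>\<close>, whose closure has density at least
  \<open>\<lambda>\<close> (\<open>thick_closed_if_locally_small\<close>).

  Otherwise every closed \<open>F\<close> that is large at all \<open>j\<close> contains, for every \<open>i\<close>, a left-separated
  sequence of length \<open>\<mu>\<close> with neighbourhoods \<open>a\<^sub>p\<close> such that all differences \<open>a\<^sub>p - a\<^sub>q\<close> with \<open>p < q\<close>
  are large at \<open>i\<close> inside \<open>F\<close>. By recursion on \<open>i < \<kappa>\<close> one picks such a difference \<open>c\<^sub>i\<close> for
  \<open>F\<^sub>i = X - \<Union>\<^sub>k\<^sub><\<^sub>i c\<^sub>k\<close>, and the block \<open>F\<^sub>i \<inter> c\<^sub>i\<close> is then reduced by all later \<open>c\<^sub>k\<close>. What has to be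
  excluded is that \<open>F\<^sub>i\<close> or the reduced block ceases to be large. A run of the construction is coded
  by a function from \<open>\<kappa>\<close> to \<open>\<mu> \<times> \<mu>\<close>, and there are only \<open>\<mu>\<^sup>\<kappa> = \<mu>\<close> of those, so one can fix beforehand
  points that lie in no set which occurs in any run and fails to be large. If the \<open>c\<^sub>i\<close> miss these points, then \<open>F\<^sub>i\<close> and
  the reduced blocks contain such points and are therefore large. The \<open>c\<^sub>i\<close> can miss them because there are at most
  \<open>\<kappa>\<close> points to miss, at most \<open>2\<^sup>\<kappa> < \<mu>\<close> traces on them, and so two of the \<open>a\<^sub>p\<close> with the same
  trace (\<open>thick_closed_if_not_locally_small\<close>). The reduced blocks are separated by the clopen sets
  \<open>c\<^sub>i\<close>; replacing each block by a closed subspace and taking the closure of the union finishes the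
  construction (\<open>thick_closed_if_separated_blocks\<close>).

  Conversely, none of the densities involved can exceed \<open>\<lambda>\<close>: a subspace of density \<open>\<delta>\<close> contains a left-separated
  sequence of length \<open>\<delta>\<close>, an algebra with infinite \<open>\<pi>\<close> has a left-separated sequence of length \<open>\<pi>\<close>, and
  left-separated sequences lift from homomorphic images to \<open>B\<close>.
\<close>

section \<open>Well-ordered choice and cardinal arithmetic\<close>

text \<open>Used for the transfinite choices below: what is required of the value at \<open>x\<close> may refer to the
  values chosen before \<open>x\<close>.\<close>

lemma well_order_choice:
  fixes P :: "('a \<Rightarrow> 'b) \<Rightarrow> 'a \<Rightarrow> 'b \<Rightarrow> bool"
  assumes r: "Well_order r"
    and adm: "\<And>f g x v. (\<And>z. z \<in> underS r x \<Longrightarrow> f z = g z) \<Longrightarrow> P f x v = P g x v"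
    and step: "\<And>f x. x \<in> Field r \<Longrightarrow> (\<And>y. y \<in> underS r x \<Longrightarrow> P f y (f y)) \<Longrightarrow> \<exists>v. P f x v"
  obtains f where "\<And>x. x \<in> Field r \<Longrightarrow> P f x (f x)"
proof -
  have wf: "wf (r - Id)"
    using r by (simp add: well_order_on_def)
  have eq: "(z, x) \<in> r - Id \<longleftrightarrow> z \<in> underS r x" for z x
    by (auto simp: underS_def)
  have "\<exists>f. \<forall>x. x \<in> Field r \<longrightarrow> P f x (f x)"
  proof (rule dependent_wf_choice[OF wf])
    fix f g :: "'a \<Rightarrow> 'b" and x v
    assume "\<And>z. (z, x) \<in> r - Id \<Longrightarrow> f z = g z"
    then show "(x \<in> Field r \<longrightarrow> P f x v) = (x \<in> Field r \<longrightarrow> P g x v)"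
      using adm[of x f g v] eq by auto
  next
    fix x f
    assume "\<And>y. (y, x) \<in> r - Id \<Longrightarrow> y \<in> Field r \<longrightarrow> P f y (f y)"
    then have "P f y (f y)" if "y \<in> underS r x" for y
      using that eq by (auto simp: underS_def Field_def)
    then show "\<exists>v. x \<in> Field r \<longrightarrow> P f x v"
      using step[of x f] by blast
  qed
  then show thesis using that by blast
qed

lemma finite_greatest:
  assumes r: "Well_order r" and w: "finite w" "w \<noteq> {}" "w \<subseteq> Field r"
  shows "\<exists>j\<in>w. \<forall>k\<in>w. (k, j) \<in> r"
proof -
  have ax: "trans r" "total_on (Field r) r" "refl_on (Field r) r"
    using r wo_rel.TRANS[of r] wo_rel.TOTAL[of r] wo_rel.REFL[of r] by (auto simp: wo_rel_def)
  show ?thesis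
    using w
  proof (induction w rule: finite_ne_induct)
    case (singleton x)
    then show ?case using ax(3) by (auto dest: refl_onD)
  next
    case (insert x w)
    then obtain j where j: "j \<in> w" "\<forall>k\<in>w. (k, j) \<in> r" by auto
    have "x \<in> Field r" "j \<in> Field r" using insert.prems j by auto
    then have "(x, j) \<in> r \<or> (j, x) \<in> r" "(x, x) \<in> r"
      using ax(2) refl_onD[OF ax(3)] unfolding total_on_def by metis+
    then show ?case
    proof (elim disjE)
      assume "(x, j) \<in> r"
      then show ?thesis using j by auto
    next
      assume "(j, x) \<in> r"
      then have "\<forall>k\<in>insert x w. (k, x) \<in> r"
        using j \<open>(x, x) \<in> r\<close> transD[OF ax(1)] by auto
      then show ?thesis by auto
    qed
  qed
qed

lemma underS_in_Field: "i \<in> underS r j \<Longrightarrow> i \<in> Field r \<and> j \<in> Field r"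
  by (auto simp: underS_def Field_def)

lemma underS_trans:
  assumes "Well_order r" "i \<in> underS r j" "(j, k) \<in> r"
  shows "i \<in> underS r k"
proof -
  have "trans r" "antisym r"
    using assms(1) wo_rel.TRANS[of r] wo_rel.ANTISYM[of r] by (auto simp: wo_rel_def)
  then show ?thesis using assms(2,3) unfolding underS_def by (blast dest: transD antisymD)
qed

lemma underS_total:
  assumes "Well_order r" "i \<in> Field r" "j \<in> Field r" "i \<noteq> j"
  shows "i \<in> underS r j \<or> j \<in> underS r i"
proof -
  have "total_on (Field r) r"
    using assms(1) wo_rel.TOTAL[of r] by (auto simp: wo_rel_def)
  then show ?thesis using assms(2-4) unfolding underS_def total_on_def by blast
qed

lemma underS_asym:
  assumes "Well_order r" "i \<in> underS r j" shows "j \<notin> underS r i"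
proof -
  have "antisym r" using assms(1) wo_rel.ANTISYM[of r] by (auto simp: wo_rel_def)
  then show ?thesis using assms(2) unfolding underS_def by (blast dest: antisymD)
qed

lemma not_ordLess_card_of:
  assumes "Card_order c"
  shows "\<not> |A| <o c \<longleftrightarrow> c \<le>o |A|"
  by (rule not_ordLess_iff_ordLeq[OF card_order_on_well_order_on[OF assms] card_of_Well_order])
lemma Field_ordLeq: "Card_order c \<Longrightarrow> |Field c| \<le>o c"
  using card_of_Field_ordIso ordIso_imp_ordLeq by blast

lemma regular_UN_ordLess:
  assumes "Cinfinite c" "regularCard c" "|I| <o c" "\<And>i. i \<in> I \<Longrightarrow> |A i| <o c"
  shows "|\<Union>i\<in>I. A i| <o c"
  using card_of_UNION_ordLess_infinite_Field_regularCard[OF assms(2,1,3)] assms(4) by blast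


lemma finite_ordLess_Cinfinite:
  assumes "Cinfinite c" "finite A"
  shows "|A| <o c"
  by (rule finite_ordLess_infinite[OF card_of_Well_order card_order_on_well_order_on])
    (use assms in \<open>auto simp: cinfinite_def Field_card_of\<close>)

lemma Un_ordLess_infinite:
  assumes "Cinfinite c" "|A| <o c" "|B| <o c"
  shows "|A \<union> B| <o c"
  using card_of_Un_ordLess_infinite_Field[of c A B] assms by (auto simp: cinfinite_def)

lemma Diff_not_ordLess:
  assumes "Cinfinite c" "c \<le>o |A|" "|B| <o c"
  shows "c \<le>o |A - B|"
proof (rule ccontr)
  assume "\<not> c \<le>o |A - B|"
  then have "|A - B| <o c" using not_ordLess_card_of assms(1) by blast
  then have "|(A - B) \<union> B| <o c" using Un_ordLess_infinite assms by blast
  moreover have "|A| \<le>o |(A - B) \<union> B|" by (rule card_of_mono1) auto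
  ultimately have "|A| <o c" by (rule ordLeq_ordLess_trans[rotated])
  then show False using assms(2) not_ordLess_ordLeq by blast
qed

text \<open>Enumerate all pairs \<open>(z, i)\<close> with \<open>i < c\<close> in order type at most \<open>c\<close> and choose for each of them a new
  element of \<open>A z\<close>: at every stage fewer than \<open>c\<close> elements have been used. Indices with a small \<open>A z\<close> get
  the empty set.\<close>

lemma disjoint_refinement:
  fixes c :: "'c rel" and Z :: "'z set" and A :: "'z \<Rightarrow> 'x set"
  assumes c: "Cinfinite c" and Z: "|Z| \<le>o c"
  obtains S where "\<And>z. z \<in> Z \<Longrightarrow> S z \<subseteq> A z"
    and "\<And>z z'. z \<in> Z \<Longrightarrow> z' \<in> Z \<Longrightarrow> z \<noteq> z' \<Longrightarrow> S z \<inter> S z' = {}"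
    and "\<And>z. z \<in> Z \<Longrightarrow> c \<le>o |A z| \<Longrightarrow> c \<le>o |S z|"
proof -
  define W where "W = {z \<in> Z. c \<le>o |A z|}"
  define p where "p = |W \<times> Field c|"
  have fp: "Field p = W \<times> Field c" unfolding p_def by (rule Field_card_of)
  have "W \<subseteq> Z" unfolding W_def by blast
  then have "|W| \<le>o c" by (rule ordLeq_transitive[OF card_of_mono1 Z])
  then have pc: "p \<le>o c"
    unfolding p_def using c
    by (intro card_of_Times_ordLeq_infinite_Field) (auto simp: cinfinite_def Field_ordLeq)
  obtain f where f: "\<And>q. q \<in> Field p \<Longrightarrow> f q \<in> A (fst q) - f ` underS p q"
  proof (rule well_order_choice[of p "\<lambda>f q v. v \<in> A (fst q) - f ` underS p q"])
    show "Well_order p" unfolding p_def by (rule card_of_Well_order)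
  next
    fix f g :: "'z \<times> 'c \<Rightarrow> 'x" and x v
    assume "\<And>z. z \<in> underS p x \<Longrightarrow> f z = g z"
    then have "f ` underS p x = g ` underS p x" by (rule image_cong[OF refl])
    then show "(v \<in> A (fst x) - f ` underS p x) = (v \<in> A (fst x) - g ` underS p x)" by simp
  next
    fix f :: "'z \<times> 'c \<Rightarrow> 'x" and x
    assume x: "x \<in> Field p"
    have "|underS p x| <o p"
      by (rule card_of_underS[OF _ x]) (unfold p_def, rule card_of_Card_order)
    then have "|f ` underS p x| <o c"
      by (rule ordLeq_ordLess_trans[OF card_of_image ordLess_ordLeq_trans[OF _ pc]])
    moreover have "c \<le>o |A (fst x)|" using x fp by (auto simp: W_def)
    ultimately have "c \<le>o |A (fst x) - f ` underS p x|"
      using Diff_not_ordLess[OF c] by blast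
    then have "A (fst x) - f ` underS p x \<noteq> {}"
      using not_ordLess_ordLeq[OF finite_ordLess_Cinfinite[OF c]] by fastforce
    then show "\<exists>v. v \<in> A (fst x) - f ` underS p x" by blast
  qed blast
  have inj: "inj_on f (W \<times> Field c)"
  proof (rule inj_onI, rule ccontr)
    fix q q' assume q: "q \<in> W \<times> Field c" "q' \<in> W \<times> Field c" "f q = f q'" "q \<noteq> q'"
    have "Well_order p" unfolding p_def by (rule card_of_Well_order)
    then have "total_on (Field p) p" by (simp add: well_order_on_def linear_order_on_def)
    then have "(q, q') \<in> p \<or> (q', q) \<in> p" using q fp by (auto simp: total_on_def)
    then have "q \<in> underS p q' \<or> q' \<in> underS p q" using q(4) by (auto simp: underS_def)
    moreover have "f q \<notin> f ` underS p q" "f q' \<notin> f ` underS p q'" using f q fp by blast+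
    ultimately show False using q(3) imageI[of q "underS p q'" f] imageI[of q' "underS p q" f] by metis
  qed
  define S where "S z = (if z \<in> W then f ` ({z} \<times> Field c) else {})" for z
  show thesis
  proof (rule that[of S])
    fix z assume z: "z \<in> Z"
    have "f (z, i) \<in> A z" if "z \<in> W" "i \<in> Field c" for i using f[of "(z, i)"] that fp by auto
    then show "S z \<subseteq> A z" by (auto simp: S_def)
    assume "c \<le>o |A z|"
    then have zW: "z \<in> W" using z by (simp add: W_def)
    have "|Field c| \<le>o |{z} \<times> Field c|" by (rule card_of_Times2) simp
    moreover have "|f ` ({z} \<times> Field c)| =o |{z} \<times> Field c|"
      by (rule card_of_ordIsoI[THEN ordIso_symmetric, of f]) (use inj zW in \<open>auto simp: bij_betw_def inj_on_def\<close>)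
    ultimately show "c \<le>o |S z|"
      using zW c card_of_Field_ordIso[of c] unfolding S_def
      by (simp only: if_True) (blast intro: ordIso_ordLeq_trans[OF ordIso_symmetric] ordLeq_ordIso_trans[OF _ ordIso_symmetric])
  next
    fix z z' assume "z \<in> Z" "z' \<in> Z" "z \<noteq> z'"
    then show "S z \<inter> S z' = {}" using inj by (auto simp: S_def inj_on_def)
  qed
qed

text \<open>Hausdorff's formula, in the case where \<open>l\<^sup>k = l\<close>: since \<open>l\<^sup>+\<close> is regular and exceeds \<open>k\<close>, every function is bounded by
  some \<open>d < l\<^sup>+\<close>, and below each of the \<open>l\<^sup>+\<close> bounds there are at most \<open>l\<^sup>k\<close> functions.\<close>

lemma card_Func_cardSuc_le:
  assumes k: "Card_order k" and l: "Cinfinite l" and kl: "k \<le>o l" and exp: "l ^c k \<le>o l"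
  shows "|Func (Field k) (Field (cardSuc l))| \<le>o cardSuc l"
proof -
  let ?m = "cardSuc l"
  have m: "Cinfinite ?m" using l by (rule Cinfinite_cardSuc)
  have cov: "Func (Field k) (Field ?m) \<subseteq> (\<Union>d\<in>Field ?m. Func (Field k) (under ?m d))"
  proof
    fix f assume f: "f \<in> Func (Field k) (Field ?m)"
    have "|f ` Field k| \<le>o l"
      by (rule ordLeq_transitive[OF card_of_image ordLeq_transitive[OF Field_ordLeq[OF k] kl]])
    moreover have "relChain ?m (under ?m)"
    proof -
      have "trans ?m" using wo_rel.TRANS[of ?m] m card_order_on_well_order_on[of _ ?m] by (auto simp: wo_rel_def)
      then show ?thesis unfolding relChain_def under_def by (blast dest: transD)
    qed
    moreover have "f ` Field k \<subseteq> (\<Union>d\<in>Field ?m. under ?m d)"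
    proof -
      have "refl_on (Field ?m) ?m" using wo_rel.REFL[of ?m] m card_order_on_well_order_on[of _ ?m] by (auto simp: wo_rel_def)
      then show ?thesis using f unfolding Func_def under_def by (blast dest: refl_onD)
    qed
    ultimately obtain d where "d \<in> Field ?m" "f ` Field k \<subseteq> under ?m d"
      using cardSuc_UNION[of l "under ?m" "f ` Field k"] l unfolding cinfinite_def by blast
    then show "f \<in> (\<Union>d\<in>Field ?m. Func (Field k) (under ?m d))"
      using f unfolding Func_def by blast
  qed
  have each: "|Func (Field k) (under ?m d)| \<le>o ?m" if d: "d \<in> Field ?m" for d
  proof -
    have "|underS ?m d| <o ?m" using card_of_underS[OF _ d] m by blast
    then have "|underS ?m d| \<le>o l"
      using cardSuc_ordLeq_ordLess[OF _ card_of_Card_order, of l] l by blast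
    moreover have "|{d}| \<le>o l"
    proof -
      have "Field l \<noteq> {}" using l by (auto simp: cinfinite_def)
      then have "|{d}| \<le>o |Field l|" by (rule card_of_singl_ordLeq)
      then show ?thesis by (rule ordLeq_transitive[OF _ Field_ordLeq]) (use l in blast)
    qed
    ultimately have "|underS ?m d \<union> {d}| \<le>o l"
      using l by (intro card_of_Un_ordLeq_infinite_Field) (auto simp: cinfinite_def)
    moreover have "under ?m d \<subseteq> underS ?m d \<union> {d}" by (auto simp: under_def underS_def)
    ultimately have "|under ?m d| \<le>o l"
      by (rule ordLeq_transitive[OF card_of_mono1, rotated])
    then have "|Func (Field k) (under ?m d)| \<le>o l ^c k"
      using cexp_mono1[of "|under ?m d|" l k] k unfolding cexp_def Field_card_of by simp
    then have "|Func (Field k) (under ?m d)| \<le>o l" using exp by (rule ordLeq_transitive)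
    moreover have "l \<le>o ?m" by (rule cardSuc_ordLeq) (use l in blast)
    ultimately show ?thesis by (rule ordLeq_transitive)
  qed
  have "|Field ?m| \<le>o ?m" using Field_ordLeq m by blast
  then have "|\<Union>d\<in>Field ?m. Func (Field k) (under ?m d)| \<le>o ?m"
    using m each by (intro card_of_UNION_ordLeq_infinite_Field) (auto simp: cinfinite_def)
  then show ?thesis by (rule ordLeq_transitive[OF card_of_mono1[OF cov]])
qed

lemma card_of_Fpow_ordLeq:
  assumes A: "infinite A"
  shows "|Fpow A| \<le>o |A|"
proof -
  let ?F = "\<lambda>n. {w \<in> Fpow A. card w = n}"
  have "|?F n| \<le>o |A|" for n
  proof (induction n)
    case 0
    have "?F 0 = {{}}" by (auto simp: Fpow_def)
    moreover have "A \<noteq> {}" using A by blast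
    ultimately show ?case using card_of_singl_ordLeq by metis
  next
    case (Suc n)
    have "?F (Suc n) \<subseteq> (\<lambda>(a, w). insert a w) ` (A \<times> ?F n)"
    proof
      fix w assume w: "w \<in> ?F (Suc n)"
      then obtain a v where "w = insert a v" "a \<notin> v" "card v = n" "finite v"
        by (auto simp: card_Suc_eq_finite Fpow_def)
      then show "w \<in> (\<lambda>(a, w). insert a w) ` (A \<times> ?F n)"
        using w by (intro image_eqI[of _ _ "(a, v)"]) (auto simp: Fpow_def)
    qed
    then have "|?F (Suc n)| \<le>o |A \<times> ?F n|" by (rule surj_imp_ordLeq)
    moreover have "|A \<times> ?F n| \<le>o |A|"
      by (rule card_of_Times_ordLeq_infinite_Field[OF _ card_of_mono1[OF subset_refl] Suc card_of_Card_order])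
        (use A in \<open>simp add: Field_card_of\<close>)
    ultimately show ?case by (rule ordLeq_transitive)
  qed
  then have "|\<Union>n\<in>UNIV. ?F n| \<le>o |A|"
    using infinite_iff_card_of_nat[THEN iffD1, OF A]
    by (intro card_of_UNION_ordLeq_infinite[OF A] ballI)
  moreover have "Fpow A \<subseteq> (\<Union>n\<in>UNIV. ?F n)" by blast
  ultimately show ?thesis by (rule ordLeq_transitive[OF card_of_mono1, rotated])
qed

section \<open>Density in a compact space with a given clopen base\<close>

text \<open>A compact space is presented by its field of clopen sets, the form in which a
  Boolean algebra provides it. The factor \<open>X\<close> in the compactness axiom gives the empty
  intersection its intended value.\<close>

locale compact_clopen_base =
  fixes X :: "'p set" and K :: "'p set set"
  assumes K_sub: "b \<in> K \<Longrightarrow> b \<subseteq> X"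
    and K_top: "X \<in> K"
    and K_Diff: "b \<in> K \<Longrightarrow> c \<in> K \<Longrightarrow> b - c \<in> K"
    and compact: "S \<subseteq> K \<Longrightarrow> (\<And>w. finite w \<Longrightarrow> w \<subseteq> S \<Longrightarrow> X \<inter> \<Inter>w \<noteq> {}) \<Longrightarrow> X \<inter> \<Inter>S \<noteq> {}"
begin

lemma K_Int: "b \<in> K \<Longrightarrow> c \<in> K \<Longrightarrow> b \<inter> c \<in> K"
  using K_Diff[of b "b - c"] K_Diff[of b c] by (simp add: Diff_Diff_Int)

lemma K_Inter_Diff_Union:
  assumes "finite v" "finite w" "v \<subseteq> K" "w \<subseteq> K"
  shows "X \<inter> \<Inter>v - \<Union>w \<in> K"
proof -
  have v: "X \<inter> \<Inter>v \<in> K"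
    using assms(1,3)
  proof (induction v)
    case empty
    then show ?case by (simp add: K_top)
  next
    case (insert b v)
    then have "b \<inter> (X \<inter> \<Inter>v) \<in> K" using K_Int by blast
    then show ?case by (simp add: Int_left_commute)
  qed
  show ?thesis using assms(2,4)
  proof (induction w)
    case empty
    then show ?case by (simp add: v)
  next
    case (insert b w)
    then have "(X \<inter> \<Inter>v - \<Union>w) - b \<in> K" using K_Diff by blast
    then show ?case by (simp add: Diff_eq Int_assoc Int_commute Int_left_commute)
  qed
qed

definition cl :: "'p set \<Rightarrow> 'p set" where
  "cl E = {x \<in> X. \<forall>b\<in>K. x \<in> b \<longrightarrow> b \<inter> E \<noteq> {}}"

text \<open>\<open>thick c T\<close> says that the density of the subspace \<open>T\<close> is at least \<open>c\<close>, and \<open>large c A\<close> that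
  \<open>A\<close> has a subspace of density at least \<open>c\<close>. Phrasing both without cardinal
  minima makes them usable for cardinals on arbitrary types.\<close>

definition thick :: "'c rel \<Rightarrow> 'p set \<Rightarrow> bool" where
  "thick c T \<longleftrightarrow> T \<subseteq> X \<and> (\<forall>E\<subseteq>T. |E| <o c \<longrightarrow> \<not> T \<subseteq> cl E)"

definition large :: "'c rel \<Rightarrow> 'p set \<Rightarrow> bool" where
  "large c A \<longleftrightarrow> (\<exists>T\<subseteq>A. thick c T)"

lemma cl_mono: "A \<subseteq> B \<Longrightarrow> cl A \<subseteq> cl B"
  unfolding cl_def by blast

lemma cl_subset: "cl A \<subseteq> X"
  unfolding cl_def by blast

lemma subset_cl: "A \<subseteq> X \<Longrightarrow> A \<subseteq> cl A"
  unfolding cl_def by blast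

lemma cl_cl: "cl (cl A) \<subseteq> cl A"
  unfolding cl_def by blast

lemma notin_cl: "x \<in> X \<Longrightarrow> x \<notin> cl E \<Longrightarrow> \<exists>b\<in>K. x \<in> b \<and> b \<inter> E = {}"
  unfolding cl_def by blast

lemma thick_mono: "d \<le>o c \<Longrightarrow> thick c T \<Longrightarrow> thick d T"
  unfolding thick_def using ordLess_ordLeq_trans by blast

lemma large_mono: "d \<le>o c \<Longrightarrow> large c A \<Longrightarrow> large d A"
  unfolding large_def using thick_mono by blast

lemma large_subset: "A \<subseteq> B \<Longrightarrow> large c A \<Longrightarrow> large c B"
  unfolding large_def by blast

text \<open>Dense subsets of the pieces add up to a dense subset of the union, and regularity bounds its
  size. So the sets that are not large form a \<open>c\<close>-complete ideal.\<close>

lemma large_UN: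
  assumes c: "Cinfinite c" "regularCard c" and M: "|M| <o c" and L: "large c (\<Union>m\<in>M. A m)"
  obtains m where "m \<in> M" "large c (A m)"
proof -
  obtain T where T: "T \<subseteq> (\<Union>m\<in>M. A m)" "thick c T" using L unfolding large_def by auto
  have "\<exists>m\<in>M. thick c (T \<inter> A m)"
  proof (rule ccontr)
    assume neg: "\<not> (\<exists>m\<in>M. thick c (T \<inter> A m))"
    have "\<forall>m\<in>M. \<exists>E. E \<subseteq> T \<inter> A m \<and> |E| <o c \<and> T \<inter> A m \<subseteq> cl E"
    proof
      fix m assume "m \<in> M"
      then have "\<not> thick c (T \<inter> A m)" using neg by blast
      moreover have "T \<inter> A m \<subseteq> X" using T(2) unfolding thick_def by blast
      ultimately show "\<exists>E. E \<subseteq> T \<inter> A m \<and> |E| <o c \<and> T \<inter> A m \<subseteq> cl E" unfolding thick_def by simp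
    qed
    then obtain E where E: "\<forall>m\<in>M. E m \<subseteq> T \<inter> A m \<and> |E m| <o c \<and> T \<inter> A m \<subseteq> cl (E m)"
      using bchoice by (elim exE[OF bchoice])
    have "|\<Union>m\<in>M. E m| <o c" by (rule regular_UN_ordLess[OF c M]) (use E in simp)
    moreover have "T \<subseteq> cl (\<Union>m\<in>M. E m)"
    proof
      fix x assume "x \<in> T"
      then obtain m where "m \<in> M" "x \<in> T \<inter> A m" using T(1) by blast
      then show "x \<in> cl (\<Union>m\<in>M. E m)" using E cl_mono[of "E m" "\<Union>m\<in>M. E m"] by blast
    qed
    moreover have "(\<Union>m\<in>M. E m) \<subseteq> T" using E by blast
    ultimately show False using T(2) unfolding thick_def by blast
  qed
  then show thesis using that unfolding large_def by blast
qed

lemma large_Un: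
  assumes c: "Cinfinite c" "regularCard c" and L: "large c (A \<union> B)"
  shows "large c A \<or> large c B"
proof -
  have two: "|{True, False}| <o c"
    by (rule finite_ordLess_Cinfinite[OF c(1)]) simp
  have "large c (\<Union>t\<in>{True, False}. if t then A else B)" using L by (simp add: Un_commute)
  then obtain t where "large c (if t then A else B)"
    by (rule large_UN[OF c two])
  then show ?thesis by (cases t) auto
qed

text \<open>Fewer than \<open>c\<close> points are never dense in \<open>T\<close>, so the next point and a neighbourhood of it that avoids
  all earlier points can always be found. This is a left-separated sequence of length \<open>c\<close>.\<close>

lemma thick_sequence:
  assumes c: "Card_order c" and T: "thick c T"
  obtains x b where "\<And>i. i \<in> Field c \<Longrightarrow> x i \<in> T" "\<And>i. i \<in> Field c \<Longrightarrow> b i \<in> K"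
    "\<And>i. i \<in> Field c \<Longrightarrow> x i \<in> b i" "\<And>i j. i \<in> Field c \<Longrightarrow> j \<in> underS c i \<Longrightarrow> x j \<notin> b i"
proof -
  define P where "P f i v \<longleftrightarrow> fst v \<in> T \<and> snd v \<in> K \<and> fst v \<in> snd v \<and> (\<forall>j \<in> underS c i. fst (f j) \<notin> snd v)"
    for f :: "'a \<Rightarrow> 'p \<times> 'p set" and i v
  obtain f where f: "\<And>i. i \<in> Field c \<Longrightarrow> P f i (f i)"
  proof (rule well_order_choice[of c P])
    show "Well_order c" using c by (rule card_order_on_well_order_on)
  next
    show "P f x v = P g x v" if "\<And>z. z \<in> underS c x \<Longrightarrow> f z = g z" for f g x v
      using that unfolding P_def by auto
  next
    fix f i assume i: "i \<in> Field c" and IH: "\<And>y. y \<in> underS c i \<Longrightarrow> P f y (f y)"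
    let ?E = "(\<lambda>j. fst (f j)) ` underS c i"
    have "|?E| <o c"
      by (rule ordLeq_ordLess_trans[OF card_of_image card_of_underS[OF c i]])
    moreover have "?E \<subseteq> T" using IH unfolding P_def by blast
    ultimately obtain x where "x \<in> T" "x \<notin> cl ?E" using T unfolding thick_def by blast
    moreover have "x \<in> X" using \<open>x \<in> T\<close> T unfolding thick_def by blast
    ultimately obtain b where "b \<in> K" "x \<in> b" "b \<inter> ?E = {}" using notin_cl by blast
    then have "P f i (x, b)" using \<open>x \<in> T\<close> unfolding P_def by auto
    then show "\<exists>v. P f i v" by blast
  qed blast
  show thesis
    by (rule that[of "\<lambda>i. fst (f i)" "\<lambda>i. snd (f i)"]) (use f in \<open>auto simp: P_def\<close>)
qed

text \<open>A dense subset of \<open>cl S\<close> meets every \<open>b s\<close>. For \<open>s \<noteq> t\<close> the clopen set \<open>b s \<inter> b t\<close> misses \<open>S\<close> and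
  hence \<open>cl S\<close>, so different \<open>s\<close> need different points.\<close>

lemma discrete_imp_thick_cl:
  assumes S: "S \<subseteq> X" and b: "\<And>s. s \<in> S \<Longrightarrow> b s \<in> K" "\<And>s. s \<in> S \<Longrightarrow> b s \<inter> S = {s}"
    and card: "c \<le>o |S|"
  shows "thick c (cl S)"
  unfolding thick_def
proof (intro conjI allI impI notI)
  show "cl S \<subseteq> X" by (rule cl_subset)
  fix E assume E: "E \<subseteq> cl S" "|E| <o c" "cl S \<subseteq> cl E"
  have "b s \<inter> E \<noteq> {}" if s: "s \<in> S" for s
  proof -
    have "s \<in> cl E" "s \<in> b s" using E(3) subset_cl[OF S] b(2)[OF s] s by auto
    then show ?thesis using b(1)[OF s] unfolding cl_def by blast
  qed
  then have "\<exists>e. \<forall>s\<in>S. e s \<in> b s \<inter> E" by (intro bchoice) blast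
  then obtain e where e: "\<forall>s\<in>S. e s \<in> b s \<inter> E" by (elim exE)
  have "inj_on e S"
  proof (rule inj_onI, rule ccontr)
    fix s t assume st: "s \<in> S" "t \<in> S" "e s = e t" "s \<noteq> t"
    have "b s \<inter> b t \<in> K" "e s \<in> b s \<inter> b t" using K_Int b(1) e st by auto
    moreover have "e s \<in> cl S" using e st(1) E(1) by blast
    ultimately have "b s \<inter> b t \<inter> S \<noteq> {}" unfolding cl_def by blast
    moreover have "b s \<inter> b t \<inter> S = (b s \<inter> S) \<inter> (b t \<inter> S)" by blast
    ultimately show False using st by (simp add: b(2))
  qed
  then have "|S| \<le>o |E|" by (rule card_of_ordLeqI) (use e in blast)
  then have "c \<le>o |E|" by (rule ordLeq_transitive[OF card])
  then show False using E(2) not_ordLess_ordLeq by blast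
qed

text \<open>With \<open>Q\<close> the clopen neighbourhoods of a point, this says that the \<open>\<pi>\<close>-character of the point in \<open>Z\<close>
  is at least \<open>c\<close>; with \<open>Q\<close> all nonempty clopen sets and \<open>Z = X\<close>, that the \<open>\<pi>\<close>-weight of \<open>X\<close> is at least \<open>c\<close>.\<close>

definition no_small_pi_base :: "'c rel \<Rightarrow> 'p set \<Rightarrow> 'p set set \<Rightarrow> bool" where
  "no_small_pi_base c Z Q \<longleftrightarrow>
     (\<forall>P\<subseteq>K. |P| <o c \<longrightarrow> (\<forall>u\<in>P. u \<inter> Z \<noteq> {}) \<longrightarrow> (\<exists>b\<in>Q. \<forall>u\<in>P. \<not> u \<inter> Z \<subseteq> b))"

text \<open>The \<open>b i\<close> are chosen so that, inside \<open>Z\<close>, no nonempty Boolean combination of finitely many earlier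
  ones is contained in \<open>b i\<close>; there are fewer than \<open>r\<close> such combinations. Removing \<open>b j\<close> from a nonempty combination
  of earlier members then always leaves something, and the conclusion follows by removing the members
  of \<open>w\<close> in increasing order.\<close>

lemma independent_sequence:
  assumes r: "Cinfinite r" and Q: "Q \<subseteq> K" and ext: "no_small_pi_base r Z Q"
  obtains b where "\<forall>i\<in>Field r. b i \<in> Q"
    and "\<forall>v w. finite v \<longrightarrow> finite w \<longrightarrow> v \<subseteq> Field r \<longrightarrow> w \<subseteq> Field r \<longrightarrow>
      (\<forall>i\<in>v. \<forall>j\<in>w. i \<in> underS r j) \<longrightarrow> Z \<inter> X \<inter> \<Inter>(b ` v) \<noteq> {} \<longrightarrow>
      Z \<inter> X \<inter> \<Inter>(b ` v) - \<Union>(b ` w) \<noteq> {}"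
proof -
  have wo: "Well_order r" using r card_order_on_well_order_on by blast
  define U where "U f v w = X \<inter> \<Inter>(f ` v) - \<Union>(f ` w)" for f :: "'a \<Rightarrow> 'p set" and v w
  define P where "P f i b \<longleftrightarrow> b \<in> Q \<and> (\<forall>v w. finite v \<longrightarrow> finite w \<longrightarrow> v \<subseteq> underS r i \<longrightarrow> w \<subseteq> underS r i \<longrightarrow>
      U f v w \<inter> Z \<noteq> {} \<longrightarrow> \<not> U f v w \<inter> Z \<subseteq> b)" for f i b
  obtain b where b: "\<And>i. i \<in> Field r \<Longrightarrow> P b i (b i)"
  proof (rule well_order_choice[of r P])
    show "Well_order r" by (rule wo)
  next
    fix f g :: "'a \<Rightarrow> 'p set" and x v
    assume fg: "\<And>z. z \<in> underS r x \<Longrightarrow> f z = g z"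
    have "U f v w = U g v w" if "v \<subseteq> underS r x" "w \<subseteq> underS r x" for v w
      using fg that unfolding U_def by (metis (no_types, lifting) image_cong subsetD)
    then show "P f x v = P g x v" unfolding P_def by metis
  next
    fix f i assume i: "i \<in> Field r" and IH: "\<And>y. y \<in> underS r i \<Longrightarrow> P f y (f y)"
    let ?u = "underS r i"
    let ?P = "{u. \<exists>v w. u = U f v w \<and> v \<in> Fpow ?u \<and> w \<in> Fpow ?u \<and> u \<inter> Z \<noteq> {}}"
    have fK: "f j \<in> K" if "j \<in> ?u" for j using IH[OF that] Q unfolding P_def by blast
    have "?P \<subseteq> (\<lambda>(v, w). U f v w) ` (Fpow ?u \<times> Fpow ?u)" by blast
    then have "|?P| \<le>o |Fpow ?u \<times> Fpow ?u|" by (rule surj_imp_ordLeq)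
    moreover have "|Fpow ?u \<times> Fpow ?u| <o r"
    proof (cases "finite ?u")
      case True
      then have "finite (Fpow ?u \<times> Fpow ?u)" by (simp add: Fpow_Pow_finite)
      then show ?thesis by (rule finite_ordLess_Cinfinite[OF r])
    next
      case False
      have "|?u| <o r" by (rule card_of_underS[OF _ i]) (use r in blast)

      have "|Fpow ?u \<times> Fpow ?u| \<le>o |?u|"
        by (rule card_of_Times_ordLeq_infinite_Field[OF _ card_of_Fpow_ordLeq card_of_Fpow_ordLeq card_of_Card_order])
          (use False in \<open>simp_all add: Field_card_of\<close>)
      then show ?thesis using \<open>|?u| <o r\<close> by (rule ordLeq_ordLess_trans)
    qed
    ultimately have "|?P| <o r" by (rule ordLeq_ordLess_trans)
    moreover have "?P \<subseteq> K"
    proof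
      fix u assume "u \<in> ?P"
      then obtain v w where u: "u = U f v w" and vw: "v \<in> Fpow ?u" "w \<in> Fpow ?u"
        by (elim CollectE exE conjE)
      show "u \<in> K" unfolding u U_def
        by (rule K_Inter_Diff_Union) (use fK vw in \<open>auto simp: Fpow_def\<close>)
    qed
    ultimately have "\<exists>b\<in>Q. \<forall>u\<in>?P. \<not> u \<inter> Z \<subseteq> b"
      by (intro ext[unfolded no_small_pi_base_def, rule_format]) auto
    then obtain b where b: "b \<in> Q" "\<forall>u\<in>?P. \<not> u \<inter> Z \<subseteq> b" by (elim bexE)
    have "P f i b" unfolding P_def
    proof (intro conjI allI impI)
      show "b \<in> Q" by (rule b(1))
      fix v w assume "finite v" "finite w" "v \<subseteq> ?u" "w \<subseteq> ?u" "U f v w \<inter> Z \<noteq> {}"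
      then have "U f v w \<in> ?P" unfolding mem_Collect_eq Fpow_def by (intro exI[of _ v] exI[of _ w]) simp
      then show "\<not> U f v w \<inter> Z \<subseteq> b" using b(2) by (rule bspec[rotated])
    qed
    then show "\<exists>v. P f i v" by blast
  qed blast
  show thesis
  proof (rule that[of b]; intro ballI allI impI)
    show "b i \<in> Q" if "i \<in> Field r" for i using b[OF that] by (auto simp: P_def)
    fix v w
    assume v: "finite v" "v \<subseteq> Field r" and Zv: "Z \<inter> X \<inter> \<Inter>(b ` v) \<noteq> {}"
    assume "finite w" "w \<subseteq> Field r" "\<forall>i\<in>v. \<forall>j\<in>w. i \<in> underS r j"
    then show "Z \<inter> X \<inter> \<Inter>(b ` v) - \<Union>(b ` w) \<noteq> {}"
    proof (induction "card w" arbitrary: w)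
      case 0
      then show ?case using Zv by simp
    next
      case (Suc n)
      have "w \<noteq> {}" using Suc(2) by auto
      then obtain j where j: "j \<in> w" "\<forall>k\<in>w. (k, j) \<in> r"
        using finite_greatest[OF wo] Suc.prems by metis
      let ?w = "w - {j}"
      have "Z \<inter> X \<inter> \<Inter>(b ` v) - \<Union>(b ` ?w) \<noteq> {}"
        using Suc by (intro Suc.hyps(1)) (auto simp: j)
      then have "U b v ?w \<inter> Z \<noteq> {}" unfolding U_def by blast
      moreover have "j \<in> Field r" "v \<subseteq> underS r j" "?w \<subseteq> underS r j" "finite ?w"
        using Suc.prems j by (auto simp: underS_def)
      ultimately have "\<not> U b v ?w \<inter> Z \<subseteq> b j" using b[of j] v unfolding P_def by blast
      then show ?case unfolding U_def using j(1) by blast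
    qed
  qed
qed

section \<open>Closed subspaces of large regular density\<close>


lemma cl_clopen: "b \<in> K \<Longrightarrow> cl b \<subseteq> b"
proof
  fix x assume b: "b \<in> K" and x: "x \<in> cl b"
  show "x \<in> b"
  proof (rule ccontr)
    assume "x \<notin> b"
    then have "x \<in> X - b" "X - b \<in> K" using x cl_subset K_Diff[OF K_top b] by auto
    then have "(X - b) \<inter> b \<noteq> {}" using x unfolding cl_def by blast
    then show False by blast
  qed
qed

lemma closed_compact:
  assumes Z: "cl Z \<subseteq> Z" "Z \<subseteq> X" and S: "S \<subseteq> K"
    and fip: "\<And>w. finite w \<Longrightarrow> w \<subseteq> S \<Longrightarrow> Z \<inter> \<Inter>w \<noteq> {}"
  shows "Z \<inter> \<Inter>S \<noteq> {}"
proof -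
  let ?C = "{c \<in> K. Z \<subseteq> c}"
  have "X \<inter> \<Inter>?C \<subseteq> Z"
  proof
    fix x assume x: "x \<in> X \<inter> \<Inter>?C"
    show "x \<in> Z"
    proof (rule ccontr)
      assume "x \<notin> Z"
      then obtain b where b: "b \<in> K" "x \<in> b" "b \<inter> Z = {}" using notin_cl[of x Z] x Z by auto
      have "X - b \<in> ?C" using b K_Diff[OF K_top b(1)] Z by auto
      then show False using x b(2) by blast
    qed
  qed
  moreover have "X \<inter> \<Inter>(S \<union> ?C) \<noteq> {}"
  proof (rule compact)
    show "S \<union> ?C \<subseteq> K" using S by blast
    fix w assume w: "finite w" "w \<subseteq> S \<union> ?C"
    have "Z \<inter> \<Inter>(w \<inter> S) \<noteq> {}" by (rule fip) (use w in auto)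
    moreover have "Z \<inter> \<Inter>(w \<inter> S) \<subseteq> X \<inter> \<Inter>w" using w Z by blast
    ultimately show "X \<inter> \<Inter>w \<noteq> {}" by blast
  qed
  ultimately show ?thesis by blast
qed

lemma discrete_imp_thick:
  assumes S: "S \<subseteq> X" and b: "\<And>s. s \<in> S \<Longrightarrow> b s \<in> K" "\<And>s. s \<in> S \<Longrightarrow> b s \<inter> S = {s}"
    and card: "c \<le>o |S|"
  shows "thick c S"
  unfolding thick_def
proof (intro conjI allI impI notI)
  show "S \<subseteq> X" by (rule S)
  fix E assume E: "E \<subseteq> S" "|E| <o c" "S \<subseteq> cl E"
  have "S \<subseteq> E"
  proof
    fix s assume s: "s \<in> S"
    then have "s \<in> b s" "s \<in> cl E" using b(2)[OF s] E(3) by auto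
    then have "b s \<inter> E \<noteq> {}" using b(1)[OF s] unfolding cl_def by blast
    then have "b s \<inter> S \<inter> E \<noteq> {}" using E(1) by blast
    then show "s \<in> E" using b(2)[OF s] by auto
  qed
  then have "c \<le>o |E|" by (rule ordLeq_transitive[OF card card_of_mono1])
  then show False using E(2) not_ordLess_ordLeq by blast
qed

text \<open>Let \<open>E\<close> be a dense subset of \<open>cl T\<close> of size less than \<open>c\<close>. If every point of \<open>E\<close> had a local \<open>\<pi>\<close>-base
  of size less than \<open>c\<close>, their union would be a \<open>\<pi>\<close>-base of \<open>cl T\<close> of size less than \<open>c\<close>; a choice of
  points of \<open>T\<close> from its members would be dense in \<open>T\<close>.\<close>

lemma thick_imp_pi_character:
  assumes c: "Cinfinite c" "regularCard c" and T: "thick c T" and Z: "\<not> thick c (cl T)"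
  obtains e where "e \<in> cl T" "no_small_pi_base c (cl T) {b \<in> K. e \<in> b}"
proof -
  let ?Z = "cl T"
  have TX: "T \<subseteq> X" using T unfolding thick_def by blast
  obtain E where E: "E \<subseteq> ?Z" "|E| <o c" "?Z \<subseteq> cl E"
    using Z cl_subset[of T] unfolding thick_def by auto
  define good where "good e P \<longleftrightarrow> P \<subseteq> K \<and> |P| <o c \<and> (\<forall>u\<in>P. u \<inter> ?Z \<noteq> {}) \<and>
    (\<forall>b\<in>K. e \<in> b \<longrightarrow> (\<exists>u\<in>P. u \<inter> ?Z \<subseteq> b))" for e P
  have "\<exists>e\<in>E. \<forall>P. \<not> good e P"
  proof (rule ccontr)
    assume "\<not> ?thesis"
    then have "\<forall>e\<in>E. \<exists>P. good e P" by simp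
    then obtain P where P: "\<forall>e\<in>E. good e (P e)" by (elim exE[OF bchoice])
    let ?P = "\<Union>e\<in>E. P e"
    have cP: "|?P| <o c"
      by (rule regular_UN_ordLess[OF c E(2)]) (use P in \<open>simp add: good_def\<close>)
    have "\<forall>u\<in>?P. \<exists>t. t \<in> u \<inter> T"
    proof
      fix u assume "u \<in> ?P"
      then obtain e where "e \<in> E" "u \<in> P e" by blast
      then have "u \<in> K" "u \<inter> ?Z \<noteq> {}" using P unfolding good_def by blast+
      then show "\<exists>t. t \<in> u \<inter> T" unfolding cl_def by blast
    qed
    then obtain t where t: "\<forall>u\<in>?P. t u \<in> u \<inter> T" by (elim exE[OF bchoice])
    have "|t ` ?P| <o c" by (rule ordLeq_ordLess_trans[OF card_of_image cP])
    moreover have "t ` ?P \<subseteq> T" using t by blast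
    ultimately have "\<not> T \<subseteq> cl (t ` ?P)" using T unfolding thick_def by blast
    then obtain x where x: "x \<in> T" "x \<notin> cl (t ` ?P)" by blast
    then obtain b where b: "b \<in> K" "x \<in> b" "b \<inter> t ` ?P = {}"
      using notin_cl[of x "t ` ?P"] TX by blast
    have "x \<in> cl E" using x(1) subset_cl[OF TX] E(3) by blast
    then obtain e where e: "e \<in> E" "e \<in> b" using b(1,2) unfolding cl_def by blast
    then obtain u where u: "u \<in> P e" "u \<inter> ?Z \<subseteq> b" using P b(1) unfolding good_def by blast
    have "t u \<in> u \<inter> T" "u \<in> ?P" using t u(1) e(1) by blast+
    then have "t u \<in> b \<inter> t ` ?P" using u(2) subset_cl[OF TX] by blast
    then show False using b(3) by blast
  qed
  then obtain e where e: "e \<in> E" "\<forall>P. \<not> good e P" by blast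
  show thesis
  proof (rule that[of e])
    show "e \<in> cl T" using e(1) E(1) by blast
    show "no_small_pi_base c (cl T) {b \<in> K. e \<in> b}"
      unfolding no_small_pi_base_def
    proof (intro allI impI)
      fix P assume "P \<subseteq> K" "|P| <o c" "\<forall>u\<in>P. u \<inter> cl T \<noteq> {}"
      moreover have "\<not> good e P" using e(2) by blast
      ultimately show "\<exists>b\<in>{b \<in> K. e \<in> b}. \<forall>u\<in>P. \<not> u \<inter> cl T \<subseteq> b" unfolding good_def by blast
    qed
  qed
qed

text \<open>Apply \<open>independent_sequence\<close> to the neighbourhoods of \<open>e\<close>: any finitely many of them meet, as all
  contain \<open>e\<close>, and by compactness there are points \<open>x i\<close> in \<open>Z\<close> with \<open>x i \<in> b j\<close> exactly for \<open>j \<le> i\<close>. The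
  points form a free sequence, and \<open>b i\<close> without the next \<open>b\<close> isolates \<open>x i\<close> among them.\<close>

lemma free_sequence_thick:
  assumes c: "Cinfinite c" and Z: "cl Z \<subseteq> Z" "Z \<subseteq> X" and e: "e \<in> Z"
    and char: "no_small_pi_base c Z {b \<in> K. e \<in> b}"
  obtains S where "S \<subseteq> Z" "thick c (cl S)"
proof -
  have wo: "Well_order c" using c card_order_on_well_order_on by blast
  have Q: "{b \<in> K. e \<in> b} \<subseteq> K" by blast
  obtain b where b': "\<forall>i\<in>Field c. b i \<in> {b \<in> K. e \<in> b}"
    and ind: "\<forall>v w. finite v \<longrightarrow> finite w \<longrightarrow> v \<subseteq> Field c \<longrightarrow> w \<subseteq> Field c \<longrightarrow>
      (\<forall>i\<in>v. \<forall>j\<in>w. i \<in> underS c j) \<longrightarrow> Z \<inter> X \<inter> \<Inter>(b ` v) \<noteq> {} \<longrightarrow>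
      Z \<inter> X \<inter> \<Inter>(b ` v) - \<Union>(b ` w) \<noteq> {}"
    by (rule independent_sequence[OF c Q char])
  note b = bspec[OF b']
  have "\<exists>x. x \<in> Z \<and> (\<forall>j. (j, i) \<in> c \<longrightarrow> x \<in> b j) \<and> (\<forall>j. i \<in> underS c j \<longrightarrow> x \<notin> b j)"
    if i: "i \<in> Field c" for i
  proof -
    let ?V = "{j. (j, i) \<in> c}" and ?W = "{j. i \<in> underS c j}"
    have VF: "?V \<subseteq> Field c" "?W \<subseteq> Field c" by (auto simp: Field_def underS_def)
    have "Z \<inter> \<Inter>(b ` ?V \<union> (\<lambda>j. X - b j) ` ?W) \<noteq> {}"
    proof (rule closed_compact[OF Z])
      show "b ` ?V \<union> (\<lambda>j. X - b j) ` ?W \<subseteq> K"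
        using b VF K_Diff[OF K_top] by blast
      fix u assume u: "finite u" "u \<subseteq> b ` ?V \<union> (\<lambda>j. X - b j) ` ?W"
      obtain v where v: "v \<subseteq> ?V" "finite v" "u \<inter> b ` ?V = b ` v"
        using finite_subset_image[of "u \<inter> b ` ?V" b ?V] u(1) by auto
      obtain w where w: "w \<subseteq> ?W" "finite w" "u \<inter> (\<lambda>j. X - b j) ` ?W = (\<lambda>j. X - b j) ` w"
        using finite_subset_image[of "u \<inter> (\<lambda>j. X - b j) ` ?W" "\<lambda>j. X - b j" ?W] u(1) by auto
      have "u = (u \<inter> b ` ?V) \<union> (u \<inter> (\<lambda>j. X - b j) ` ?W)" using u(2) by (simp only: Int_Un_distrib[symmetric] Int_absorb2)
      then have u': "u = b ` v \<union> (\<lambda>j. X - b j) ` w" unfolding v(3) w(3) .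
      have "Z \<inter> X \<inter> \<Inter>(b ` v) - \<Union>(b ` w) \<noteq> {}"
      proof (rule ind[THEN spec[of _ v], THEN spec[of _ w], THEN mp, THEN mp, THEN mp, THEN mp, THEN mp, THEN mp])
        show "v \<subseteq> Field c" using VF(1) v(1) by (rule subset_trans[rotated])
        show "w \<subseteq> Field c" using VF(2) w(1) by (rule subset_trans[rotated])
        have "i' \<in> underS c j" if "i' \<in> v" "j \<in> w" for i' j
        proof (cases "i' = i")
          case True
          then show ?thesis using that w(1) by blast
        next
          case False
          then have "i' \<in> underS c i" using that v(1) by (auto simp: underS_def)
          moreover have "(i, j) \<in> c" using that w(1) by (auto simp: underS_def)
          ultimately show ?thesis by (rule underS_trans[OF wo])
        qed
        then show "\<forall>i'\<in>v. \<forall>j\<in>w. i' \<in> underS c j" by simp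
        have "e \<in> Z \<inter> X \<inter> \<Inter>(b ` v)" using b e Z VF v(1) by blast
        then show "Z \<inter> X \<inter> \<Inter>(b ` v) \<noteq> {}" by blast
      qed (use v w in auto)
      then show "Z \<inter> \<Inter>u \<noteq> {}" unfolding u' using Z(2) by blast
    qed
    then obtain x where "x \<in> Z \<inter> \<Inter>(b ` ?V \<union> (\<lambda>j. X - b j) ` ?W)" by blast
    then have "x \<in> Z \<and> (\<forall>j. (j, i) \<in> c \<longrightarrow> x \<in> b j) \<and> (\<forall>j. i \<in> underS c j \<longrightarrow> x \<notin> b j)" by auto
    then show ?thesis by (rule exI)
  qed
  then have "\<forall>i\<in>Field c. \<exists>x. x \<in> Z \<and> (\<forall>j. (j, i) \<in> c \<longrightarrow> x \<in> b j) \<and> (\<forall>j. i \<in> underS c j \<longrightarrow> x \<notin> b j)"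
    by (rule ballI)
  then obtain x where x: "\<forall>i\<in>Field c. x i \<in> Z \<and> (\<forall>j. (j, i) \<in> c \<longrightarrow> x i \<in> b j) \<and> (\<forall>j. i \<in> underS c j \<longrightarrow> x i \<notin> b j)"
    by (elim exE[OF bchoice])
  let ?S = "x ` Field c"
  define s where "s i = wo_rel.suc c {i}" for i
  have s: "i \<in> underS c (s i)" "\<And>j. i \<in> underS c j \<Longrightarrow> (s i, j) \<in> c" if i: "i \<in> Field c" for i
  proof -
    have wr: "wo_rel c" using wo by (simp add: wo_rel_def)
    have "\<exists>j\<in>Field c. i \<noteq> j \<and> (i, j) \<in> c"
      by (rule infinite_Card_order_limit) (use c i in \<open>auto simp: cinfinite_def\<close>)
    then have ne: "AboveS c {i} \<noteq> {}" unfolding AboveS_def by auto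
    have "s i \<in> AboveS c {i}" unfolding s_def by (rule wo_rel.suc_AboveS[OF wr _ ne]) (use i in simp)
    then show "i \<in> underS c (s i)" unfolding AboveS_def underS_def by auto
    fix j assume "i \<in> underS c j"
    then have "j \<in> AboveS c {i}" unfolding AboveS_def underS_def Field_def by auto
    then show "(s i, j) \<in> c" unfolding s_def by (rule wo_rel.suc_least_AboveS[OF wr])
  qed
  have N: "x j \<in> b i - b (s i) \<longleftrightarrow> j = i" if ij: "i \<in> Field c" "j \<in> Field c" for i j
  proof
    assume *: "x j \<in> b i - b (s i)"
    show "j = i"
    proof (rule ccontr)
      assume "j \<noteq> i"
      then consider "i \<in> underS c j" | "j \<in> underS c i" using underS_total[OF wo ij(2,1)] by blast
      then show False
      proof cases
        case 1
        then have "x j \<in> b (s i)" using x s(2)[OF ij(1)] ij(2) by blast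
        then show False using * by blast
      next
        case 2
        then have "x j \<notin> b i" using x ij(2) by blast
        then show False using * by blast
      qed
    qed
  next
    have "(i, i) \<in> c" using wo ij(1) wo_rel.REFL[of c] by (auto simp: wo_rel_def dest: refl_onD)
    moreover assume "j = i"
    ultimately show "x j \<in> b i - b (s i)" using x ij(1) s(1)[OF ij(1)] by blast
  qed
  have inj: "inj_on x (Field c)"
  proof (rule inj_onI)
    fix i j assume ij: "i \<in> Field c" "j \<in> Field c" "x i = x j"
    show "i = j" using N[OF ij(2) ij(1)] N[OF ij(2) ij(2)] ij(3) by simp
  qed
  have sF: "s i \<in> Field c" if "i \<in> Field c" for i using s(1)[OF that] underS_in_Field by fast
  define d where "d y = b (inv_into (Field c) x y) - b (s (inv_into (Field c) x y))" for y
  have dx: "d (x i) = b i - b (s i)" if "i \<in> Field c" for i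
    unfolding d_def by (simp add: inv_into_f_f[OF inj that])
  have "thick c (cl ?S)"
  proof (rule discrete_imp_thick_cl)
    show "?S \<subseteq> X" using x Z by blast
    show "d y \<in> K" if "y \<in> ?S" for y
    proof -
      obtain i where i: "i \<in> Field c" "y = x i" using \<open>y \<in> ?S\<close> by (elim imageE)
      then show ?thesis using dx[OF i(1)] b[OF i(1)] b[OF sF[OF i(1)]] K_Diff by auto
    qed
    show "d y \<inter> ?S = {y}" if "y \<in> ?S" for y
    proof -
      obtain i where i: "i \<in> Field c" "y = x i" using \<open>y \<in> ?S\<close> by (elim imageE)
      then show ?thesis using dx[OF i(1)] N[OF i(1)] by auto
    qed
    have "|Field c| \<le>o |?S|" by (rule card_of_ordLeqI[OF inj]) blast
    then show "c \<le>o |?S|"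
      by (rule ordIso_ordLeq_trans[OF ordIso_symmetric[OF card_of_Field_ordIso], rotated]) (use c in blast)
  qed
  moreover have "?S \<subseteq> Z" using x by blast
  ultimately show thesis using that by blast
qed

lemma thick_imp_closed_thick:
  assumes c: "Cinfinite c" "regularCard c" and T: "thick c T"
  obtains Y where "cl Y \<subseteq> Y" "Y \<subseteq> cl T" "thick c Y"
proof (cases "thick c (cl T)")
  case True
  then show thesis using that[of "cl T"] cl_cl by blast
next
  case False
  obtain e where e: "e \<in> cl T" "no_small_pi_base c (cl T) {b \<in> K. e \<in> b}"
    by (rule thick_imp_pi_character[OF c T False])
  obtain S where S: "S \<subseteq> cl T" "thick c (cl S)"
    by (rule free_sequence_thick[OF c(1) cl_cl cl_subset e])
  have "cl S \<subseteq> cl T" using cl_mono[OF S(1)] cl_cl by blast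
  then show thesis using that[of "cl S"] cl_cl S(2) by blast
qed

end

section \<open>Attaining a singular hereditary density by a closed subspace\<close>

text \<open>Hajnal's theorem on free sets, for a set mapping \<open>N\<close> on the union of blocks \<open>D j\<close> whose values meet
  every block in fewer than \<open>\<theta>\<close> points; conflicts inside a block and with later blocks are already excluded.
  Instead of one candidate, \<open>\<theta>\<close> pairwise disjoint candidates \<open>S j z\<close> are kept in each block. A point \<open>x\<close>
  of \<open>D j\<close> conflicts with the earlier candidates of fewer than \<open>\<theta>\<close> indices \<open>z\<close>, because \<open>N j x\<close> has fewer
  than \<open>\<theta>\<close> points in earlier blocks and the candidates are disjoint. Hence all but fewer than \<open>\<theta>\<close> indices allow
  \<open>\<chi> j\<close> points without conflict. As there are fewer than \<open>\<theta>\<close> blocks and \<open>\<theta>\<close> is regular, some index is good for every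
  block.\<close>

lemma free_transversal:
  fixes r :: "'l rel" and \<theta> :: "'t rel" and \<chi> :: "'l \<Rightarrow> 'c rel" and D :: "'l \<Rightarrow> 'p set"
  assumes r: "Well_order r" and J: "J \<subseteq> Field r" "|J| <o \<theta>"
    and th: "Cinfinite \<theta>" "regularCard \<theta>"
    and chi: "\<And>j. j \<in> J \<Longrightarrow> Cinfinite (\<chi> j) \<and> regularCard (\<chi> j) \<and> \<theta> <o \<chi> j"
    and D: "\<And>j. j \<in> J \<Longrightarrow> \<chi> j \<le>o |D j|"
    and self: "\<And>j x. j \<in> J \<Longrightarrow> x \<in> D j \<Longrightarrow> x \<in> N j x"
    and small: "\<And>i j x. i \<in> J \<Longrightarrow> j \<in> J \<Longrightarrow> x \<in> D j \<Longrightarrow> |N j x \<inter> D i| <o \<theta>"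
    and up: "\<And>i j x. i \<in> J \<Longrightarrow> j \<in> J \<Longrightarrow> i \<in> underS r j \<Longrightarrow> x \<in> D i \<Longrightarrow> N i x \<inter> D j = {}"
    and diag: "\<And>j x. j \<in> J \<Longrightarrow> x \<in> D j \<Longrightarrow> N j x \<inter> D j \<subseteq> {x}"
  obtains S where "S \<subseteq> (\<Union>j\<in>J. D j)" "\<forall>j\<in>J. \<chi> j \<le>o |S \<inter> D j|"
    "\<forall>j\<in>J. \<forall>x\<in>S \<inter> D j. N j x \<inter> S = {x}"
proof -
  let ?Z = "Field \<theta>"
  define A where "A f j z = {x \<in> D j. N j x \<inter> (\<Union>i\<in>underS r j \<inter> J. f i z) = {}}"
    for f :: "'l \<Rightarrow> 't \<Rightarrow> 'p set" and j z
  define P where "P f j v \<longleftrightarrow> j \<in> J \<longrightarrow> (\<forall>z\<in>?Z. v z \<subseteq> A f j z) \<and>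
      (\<forall>z\<in>?Z. \<forall>z'\<in>?Z. z \<noteq> z' \<longrightarrow> v z \<inter> v z' = {}) \<and> (\<forall>z\<in>?Z. \<chi> j \<le>o |A f j z| \<longrightarrow> \<chi> j \<le>o |v z| )"
    for f j v
  have tle: "|?Z| \<le>o \<theta>" by (rule Field_ordLeq) (use th in blast)
  obtain S where S: "\<And>j. j \<in> Field r \<Longrightarrow> P S j (S j)"
  proof (rule well_order_choice[of r P])
    show "Well_order r" by (rule r)
  next
    fix f g :: "'l \<Rightarrow> 't \<Rightarrow> 'p set" and x v
    assume fg: "\<And>z. z \<in> underS r x \<Longrightarrow> f z = g z"
    have "A f x z = A g x z" for z
    proof -
      have "(\<Union>i\<in>underS r x \<inter> J. f i z) = (\<Union>i\<in>underS r x \<inter> J. g i z)"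
        by (rule SUP_cong) (use fg in auto)
      then show ?thesis unfolding A_def by simp
    qed
    then show "P f x v = P g x v" unfolding P_def by simp
  next
    fix f :: "'l \<Rightarrow> 't \<Rightarrow> 'p set" and j
    show "\<exists>v. P f j v"
    proof (cases "j \<in> J")
      case True
      have "|?Z| \<le>o \<chi> j" by (rule ordLeq_transitive[OF tle ordLess_imp_ordLeq]) (use chi[OF True] in blast)
      then obtain v where "\<And>z. z \<in> ?Z \<Longrightarrow> v z \<subseteq> A f j z"
        "\<And>z z'. z \<in> ?Z \<Longrightarrow> z' \<in> ?Z \<Longrightarrow> z \<noteq> z' \<Longrightarrow> v z \<inter> v z' = {}"
        "\<And>z. z \<in> ?Z \<Longrightarrow> \<chi> j \<le>o |A f j z| \<Longrightarrow> \<chi> j \<le>o |v z|"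
        using disjoint_refinement[of "\<chi> j" ?Z "A f j"] chi[OF True] by metis
      then have "P f j v" unfolding P_def by simp
      then show ?thesis by (rule exI[of "P f j" v])
    qed (simp add: P_def)
  qed blast
  have S_A: "S j z \<subseteq> A S j z" if "j \<in> J" "z \<in> ?Z" for j z
    using S[of j] that J unfolding P_def by blast
  have S_disj: "S j z \<inter> S j z' = {}" if "j \<in> J" "z \<in> ?Z" "z' \<in> ?Z" "z \<noteq> z'" for j z z'
    using S[of j] that J unfolding P_def by blast
  have S_big: "\<chi> j \<le>o |S j z|" if "j \<in> J" "z \<in> ?Z" "\<chi> j \<le>o |A S j z|" for j z
    using S[of j] that J unfolding P_def by blast
  have S_D: "S j z \<subseteq> D j" if "j \<in> J" "z \<in> ?Z" for j z
    using S_A[OF that] unfolding A_def by blast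
  have D_disj: "i = j" if ij: "i \<in> J" "j \<in> J" "x \<in> D i" "x \<in> D j" for i j x
  proof (rule ccontr)
    assume "i \<noteq> j"
    then consider "i \<in> underS r j" | "j \<in> underS r i" using underS_total[OF r] ij J by blast
    then show False
    proof cases
      case 1 then show ?thesis using up[OF ij(1,2) 1 ij(3)] self[OF ij(1,3)] ij(4) by blast
    next
      case 2 then show ?thesis using up[OF ij(2,1) 2 ij(4)] self[OF ij(2,4)] ij(3) by blast
    qed
  qed
  define bad where "bad j = {z \<in> ?Z. \<not> \<chi> j \<le>o |A S j z| }" for j
  have bad: "|bad j| <o \<theta>" if j: "j \<in> J" for j
  proof (rule ccontr)
    assume neg: "\<not> |bad j| <o \<theta>"
    have cj: "Cinfinite (\<chi> j)" "regularCard (\<chi> j)" "\<theta> <o \<chi> j" using chi[OF j] by blast+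
    have "bad j \<subseteq> ?Z" unfolding bad_def by blast
    then have "|bad j| \<le>o \<theta>" by (rule ordLeq_transitive[OF card_of_mono1 tle])
    then have "|bad j| <o \<chi> j" using cj(3) by (rule ordLeq_ordLess_trans)
    then have "|\<Union>z\<in>bad j. A S j z| <o \<chi> j"
    proof (rule regular_UN_ordLess[OF cj(1,2)])
      fix z assume "z \<in> bad j"
      then have "\<not> \<chi> j \<le>o |A S j z|" unfolding bad_def by blast
      then show "|A S j z| <o \<chi> j" using not_ordLess_card_of cj(1) by blast
    qed
    then have "\<chi> j \<le>o |D j - (\<Union>z\<in>bad j. A S j z)|" by (rule Diff_not_ordLess[OF cj(1) D[OF j]])
    then have "\<not> |D j - (\<Union>z\<in>bad j. A S j z)| <o \<chi> j" using not_ordLess_ordLeq by blast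
    then have "infinite (D j - (\<Union>z\<in>bad j. A S j z))" using finite_ordLess_Cinfinite[OF cj(1)] by blast
    then have "D j - (\<Union>z\<in>bad j. A S j z) \<noteq> {}" by (rule infinite_imp_nonempty)
    then obtain x where x: "x \<in> D j" "x \<notin> (\<Union>z\<in>bad j. A S j z)" by blast
    have "\<forall>z\<in>bad j. \<exists>y. \<exists>i\<in>underS r j \<inter> J. y \<in> N j x \<inter> S i z"
    proof
      fix z assume "z \<in> bad j"
      then have "x \<notin> A S j z" using x(2) by blast
      then show "\<exists>y. \<exists>i\<in>underS r j \<inter> J. y \<in> N j x \<inter> S i z" using x(1) unfolding A_def by blast
    qed
    then obtain y where y: "\<forall>z\<in>bad j. \<exists>i\<in>underS r j \<inter> J. y z \<in> N j x \<inter> S i z"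
      by (elim exE[OF bchoice])
    have "inj_on y (bad j)"
    proof (rule inj_onI, rule ccontr)
      fix z z' assume z: "z \<in> bad j" "z' \<in> bad j" "y z = y z'" "z \<noteq> z'"
      obtain i where i: "i \<in> J" "y z \<in> S i z" using y z(1) by blast
      obtain i' where i': "i' \<in> J" "y z' \<in> S i' z'" using y z(2) by blast
      have zZ: "z \<in> ?Z" "z' \<in> ?Z" using z(1,2) unfolding bad_def by blast+
      have "y z \<in> D i" "y z \<in> D i'" using S_D[OF i(1) zZ(1)] S_D[OF i'(1) zZ(2)] i(2) i'(2) z(3) by auto
      then have "i = i'" by (rule D_disj[OF i(1) i'(1)])
      then show False using S_disj[OF i(1) zZ z(4)] i(2) i'(2) z(3) by auto
    qed
    then have "|bad j| \<le>o |\<Union>i\<in>underS r j \<inter> J. N j x \<inter> D i|"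
    proof (rule card_of_ordLeqI)
      fix z assume z: "z \<in> bad j"
      then obtain i where i: "i \<in> underS r j \<inter> J" "y z \<in> N j x \<inter> S i z" using y by blast
      moreover have "S i z \<subseteq> D i" using S_D i(1) z unfolding bad_def by blast
      ultimately show "y z \<in> (\<Union>i\<in>underS r j \<inter> J. N j x \<inter> D i)" by blast
    qed
    moreover have "|\<Union>i\<in>underS r j \<inter> J. N j x \<inter> D i| <o \<theta>"
    proof (rule regular_UN_ordLess[OF th])
      show "|underS r j \<inter> J| <o \<theta>" by (rule ordLeq_ordLess_trans[OF card_of_mono1 J(2)]) blast
      show "|N j x \<inter> D i| <o \<theta>" if "i \<in> underS r j \<inter> J" for i
        by (rule small) (use that j x(1) in auto)
    qed
    ultimately show False using neg ordLeq_ordLess_trans by blast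
  qed
  have "|\<Union>j\<in>J. bad j| <o \<theta>" by (rule regular_UN_ordLess[OF th J(2) bad])
  moreover have "\<theta> \<le>o |?Z|"
    by (rule ordIso_imp_ordLeq[OF ordIso_symmetric[OF card_of_Field_ordIso]]) (use th in blast)
  ultimately have "\<theta> \<le>o |?Z - (\<Union>j\<in>J. bad j)|" using Diff_not_ordLess[OF th(1)] by blast
  then have "\<not> |?Z - (\<Union>j\<in>J. bad j)| <o \<theta>" using not_ordLess_ordLeq by blast
  then have "infinite (?Z - (\<Union>j\<in>J. bad j))" using finite_ordLess_Cinfinite[OF th(1)] by blast
  then have "?Z - (\<Union>j\<in>J. bad j) \<noteq> {}" by (rule infinite_imp_nonempty)
  then obtain z where z: "z \<in> ?Z" "\<forall>j\<in>J. z \<notin> bad j" by blast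
  show thesis
  proof (rule that[of "\<Union>j\<in>J. S j z"])
    show "(\<Union>j\<in>J. S j z) \<subseteq> (\<Union>j\<in>J. D j)" using S_D z(1) by blast
    show "\<forall>j\<in>J. \<chi> j \<le>o |(\<Union>j\<in>J. S j z) \<inter> D j|"
    proof
      fix j assume j: "j \<in> J"
      then have "\<chi> j \<le>o |S j z|" using S_big z unfolding bad_def by blast
      moreover have "S j z \<subseteq> (\<Union>j\<in>J. S j z) \<inter> D j" using S_D[OF j z(1)] j by blast
      ultimately show "\<chi> j \<le>o |(\<Union>j\<in>J. S j z) \<inter> D j|" by (rule ordLeq_transitive[OF _ card_of_mono1])
    qed
    show "\<forall>j\<in>J. \<forall>x\<in>(\<Union>j\<in>J. S j z) \<inter> D j. N j x \<inter> (\<Union>j\<in>J. S j z) = {x}"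
    proof (intro ballI)
      fix j x assume j: "j \<in> J" and x: "x \<in> (\<Union>j\<in>J. S j z) \<inter> D j"
      then obtain k where k: "k \<in> J" "x \<in> S k z" by blast
      have "x \<in> D k" using S_D[OF k(1) z(1)] k(2) by blast
      then have "k = j" using D_disj[OF k(1) j] x by blast
      then have xS: "x \<in> S j z" using k by simp
      have xD: "x \<in> D j" using x by blast
      show "N j x \<inter> (\<Union>j\<in>J. S j z) = {x}"
      proof
        show "{x} \<subseteq> N j x \<inter> (\<Union>j\<in>J. S j z)" using self[OF j xD] xS j by blast
        show "N j x \<inter> (\<Union>j\<in>J. S j z) \<subseteq> {x}"
        proof
          fix y assume y: "y \<in> N j x \<inter> (\<Union>j\<in>J. S j z)"
          then obtain i where i: "i \<in> J" "y \<in> S i z" by blast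
          have yD: "y \<in> D i" using S_D[OF i(1) z(1)] i(2) by blast
          consider "i = j" | "i \<in> underS r j" | "j \<in> underS r i" using underS_total[OF r] i(1) j J by blast
          then show "y \<in> {x}"
          proof cases
            case 1
            then show ?thesis using diag[OF j xD] y yD by blast
          next
            case 2
            have "x \<in> A S j z" using S_A[OF j z(1)] xS by blast
            then show ?thesis using 2 i y unfolding A_def by blast
          next
            case 3
            then show ?thesis using up[OF j i(1) 3 xD] y yD by blast
          qed
        qed
      qed
    qed
  qed
qed

text \<open>The bound \<open>kappa_chi\<close> makes the sets that are not large at \<open>\<chi> i\<close> closed under unions of \<open>\<kappa>\<close> sets.\<close>

locale compact_clopen_tower = compact_clopen_base X K
  for X :: "'p set" and K :: "'p set set" +
  fixes \<kappa> :: "'l rel" and \<chi> :: "'l \<Rightarrow> 'c rel"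
  assumes kappa: "Cinfinite \<kappa>"
    and chi: "\<And>i. i \<in> Field \<kappa> \<Longrightarrow> Cinfinite (\<chi> i)" "\<And>i. i \<in> Field \<kappa> \<Longrightarrow> regularCard (\<chi> i)"
    and chi_mono: "\<And>i j. i \<in> underS \<kappa> j \<Longrightarrow> \<chi> i <o \<chi> j"
    and kappa_chi: "\<And>i. i \<in> Field \<kappa> \<Longrightarrow> |Field \<kappa>| <o \<chi> i"
begin

lemma wo: "Well_order \<kappa>"
  using kappa card_order_on_well_order_on by blast

text \<open>Proceed as for a left-separated sequence, and in addition keep each new point out of the earlier
  neighbourhoods. This is possible: the union \<open>U\<close> of the earlier neighbourhoods is not large in \<open>F\<close>, so \<open>T \<inter> U\<close> has a
  small dense subset, and that subset together with the earlier points is not dense in \<open>T\<close>.\<close>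

lemma discrete_in_thick:
  assumes c: "Cinfinite c" "regularCard c" and T: "thick c T" "T \<subseteq> F" and d: "d \<le>o c"
    and nb: "\<forall>x\<in>T. \<exists>b\<in>K. x \<in> b \<and> \<not> large d (b \<inter> F)"
  shows "\<exists>D a. D \<subseteq> T \<and> |D| =o c \<and> (\<forall>x\<in>D. a x \<in> K \<and> a x \<inter> D = {x} \<and> \<not> large d (a x \<inter> F))"
proof -
  have wc: "Well_order c" using c card_order_on_well_order_on by blast
  define P where "P f i v \<longleftrightarrow> fst v \<in> T \<and> snd v \<in> K \<and> fst v \<in> snd v \<and> \<not> large d (snd v \<inter> F) \<and>
      (\<forall>j \<in> underS c i. fst (f j) \<notin> snd v \<and> fst v \<notin> snd (f j))"
    for f :: "'a \<Rightarrow> 'p \<times> 'p set" and i v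
  obtain f where f: "\<And>i. i \<in> Field c \<Longrightarrow> P f i (f i)"
  proof (rule well_order_choice[of c P])
    show "Well_order c" by (rule wc)
  next
    show "P f x v = P g x v" if "\<And>z. z \<in> underS c x \<Longrightarrow> f z = g z" for f g x v
      using that unfolding P_def by auto
  next
    fix f i assume i: "i \<in> Field c" and IH: "\<And>y. y \<in> underS c i \<Longrightarrow> P f y (f y)"
    let ?E = "(\<lambda>j. fst (f j)) ` underS c i" and ?U = "\<Union>j\<in>underS c i. snd (f j) \<inter> F"
    have u: "|underS c i| <o c" by (rule card_of_underS[OF _ i]) (use c in blast)
    have "\<not> large c ?U"
    proof
      assume "large c ?U"
      then obtain j where j: "j \<in> underS c i" "large c (snd (f j) \<inter> F)" by (rule large_UN[OF c u])
      then have "large d (snd (f j) \<inter> F)" using large_mono[OF d] by blast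
      then show False using IH[OF j(1)] unfolding P_def by blast
    qed
    then have "\<not> thick c (T \<inter> ?U)" unfolding large_def by blast
    moreover have TX: "T \<subseteq> X" using T unfolding thick_def by blast
    ultimately obtain E0 where E0: "E0 \<subseteq> T \<inter> ?U" "|E0| <o c" "T \<inter> ?U \<subseteq> cl E0"
      unfolding thick_def by auto
    have "|?E| <o c" by (rule ordLeq_ordLess_trans[OF card_of_image u])
    then have "|?E \<union> E0| <o c" by (rule Un_ordLess_infinite[OF c(1) _ E0(2)])
    moreover have "?E \<union> E0 \<subseteq> T" using IH E0(1) unfolding P_def by blast
    ultimately have "\<not> T \<subseteq> cl (?E \<union> E0)" using T(1) unfolding thick_def by blast
    then obtain x where x: "x \<in> T" "x \<notin> cl (?E \<union> E0)" by blast
    then obtain b where b: "b \<in> K" "x \<in> b" "b \<inter> (?E \<union> E0) = {}" using notin_cl TX by blast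
    obtain a where a: "a \<in> K" "x \<in> a" "\<not> large d (a \<inter> F)" using nb x(1) by blast
    have "x \<notin> ?U" using x E0(3) cl_mono[of E0 "?E \<union> E0"] by blast
    then have xU: "x \<notin> snd (f j)" if "j \<in> underS c i" for j using x(1) T(2) that by blast
    have "\<not> large d (b \<inter> a \<inter> F)" using a(3) large_subset[of "b \<inter> a \<inter> F" "a \<inter> F"] by blast
    then have "P f i (x, b \<inter> a)"
      using x(1) a b xU K_Int unfolding P_def by auto
    then show "\<exists>v. P f i v" by (rule exI)
  qed blast
  let ?x = "\<lambda>i. fst (f i)" and ?b = "\<lambda>i. snd (f i)"
  have xb: "?x j \<in> ?b i \<longleftrightarrow> j = i" if ij: "i \<in> Field c" "j \<in> Field c" for i j
  proof
    assume *: "?x j \<in> ?b i"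
    show "j = i"
    proof (rule ccontr)
      assume "j \<noteq> i"
      then consider "i \<in> underS c j" | "j \<in> underS c i" using underS_total[OF wc ij(2,1)] by blast
      then show False using f[OF ij(1)] f[OF ij(2)] * unfolding P_def by cases blast+
    qed
  next
    show "?x j \<in> ?b i" if "j = i" using f[OF ij(1)] that unfolding P_def by simp
  qed
  have inj: "inj_on ?x (Field c)"
  proof (rule inj_onI)
    fix i j assume ij: "i \<in> Field c" "j \<in> Field c" "?x i = ?x j"
    show "i = j" using xb[OF ij(2) ij(1)] xb[OF ij(2) ij(2)] ij(3) by simp
  qed
  define a where "a y = ?b (inv_into (Field c) ?x y)" for y
  have ax: "a (?x i) = ?b i" if "i \<in> Field c" for i unfolding a_def by (simp add: inv_into_f_f[OF inj that])
  let ?D = "?x ` Field c"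
  have "?D \<subseteq> T" using f unfolding P_def by blast
  moreover have "|?D| =o c"
  proof -
    have "|Field c| =o |?D|" by (rule card_of_ordIsoI[of ?x]) (use inj in \<open>simp add: bij_betw_def\<close>)
    moreover have "|Field c| =o c" by (rule card_of_Field_ordIso) (use c in blast)
    ultimately show ?thesis using ordIso_symmetric ordIso_transitive by blast
  qed
  moreover have "\<forall>x\<in>?D. a x \<in> K \<and> a x \<inter> ?D = {x} \<and> \<not> large d (a x \<inter> F)"
  proof
    fix x assume "x \<in> ?D"
    then obtain i where i: "i \<in> Field c" "x = ?x i" by (elim imageE)
    have "a x \<inter> ?D = {x}" using ax[OF i(1)] xb[OF i(1)] i by auto
    then show "a x \<in> K \<and> a x \<inter> ?D = {x} \<and> \<not> large d (a x \<inter> F)"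
      using f[OF i(1)] ax[OF i(1)] i(2) unfolding P_def by simp
  qed
  ultimately show ?thesis by (intro exI[of _ ?D] exI[of _ a] conjI)
qed

text \<open>The points at which the hereditary density of \<open>F\<close> is locally below \<open>\<chi> i\<close>.\<close>

definition small_points :: "'l \<Rightarrow> 'p set \<Rightarrow> 'p set" where
  "small_points i F = {x \<in> F. \<exists>b\<in>K. x \<in> b \<and> \<not> large (\<chi> i) (b \<inter> F)}"

text \<open>Take discrete sets of size \<open>\<chi> j\<close> consisting of small points, for \<open>j\<close> beyond \<open>i0\<close>. Discrete sets of size \<open>\<chi> i0\<close> are large,
  so the neighbourhoods of small points meet each block in fewer than \<open>\<chi> i0\<close> points, and \<open>free_transversal\<close> applies
  once the neighbourhoods of earlier blocks have been removed from later ones. It gives a discrete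
  set with at least \<open>\<chi> j\<close> points for all these \<open>j\<close>.\<close>

lemma thick_closed_if_locally_small:
  assumes i0: "i0 \<in> Field \<kappa>" and F: "F \<subseteq> X"
    and G': "\<And>j. j \<in> Field \<kappa> \<Longrightarrow> large (\<chi> j) (small_points i0 F)"
  obtains Y where "cl Y \<subseteq> Y" "\<forall>j\<in>Field \<kappa>. thick (\<chi> j) Y"
proof -
  let ?G = "{x \<in> F. \<exists>b\<in>K. x \<in> b \<and> \<not> large (\<chi> i0) (b \<inter> F)}"
  note G = G'[unfolded small_points_def]
  define J where "J = {j. i0 \<in> underS \<kappa> j}"
  have JF: "J \<subseteq> Field \<kappa>" unfolding J_def using underS_in_Field by fast
  have th: "\<chi> i0 <o \<chi> j" if "j \<in> J" for j using chi_mono that unfolding J_def by blast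
  have cj: "Cinfinite (\<chi> j)" "regularCard (\<chi> j)" if "j \<in> J" for j using chi that JF by blast+
  note c0 = chi[OF i0]
  have "\<forall>j\<in>J. \<exists>D. \<exists>a. D \<subseteq> ?G \<and> |D| =o \<chi> j \<and> (\<forall>x\<in>D. a x \<in> K \<and> a x \<inter> D = {x} \<and> \<not> large (\<chi> i0) (a x \<inter> F))"
  proof
    fix j assume j: "j \<in> J"
    obtain T where T: "T \<subseteq> ?G" "thick (\<chi> j) T" using G j JF unfolding large_def by blast
    have TF: "T \<subseteq> F" using T(1) by blast
    have nb: "\<forall>x\<in>T. \<exists>b\<in>K. x \<in> b \<and> \<not> large (\<chi> i0) (b \<inter> F)" using T(1) by blast
    obtain D a where D: "D \<subseteq> T" "|D| =o \<chi> j" "\<forall>x\<in>D. a x \<in> K \<and> a x \<inter> D = {x} \<and> \<not> large (\<chi> i0) (a x \<inter> F)"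
      using discrete_in_thick[OF cj[OF j] T(2) TF ordLess_imp_ordLeq[OF th[OF j]] nb] by (elim exE conjE)
    have "D \<subseteq> ?G" using D(1) T(1) by (rule subset_trans)
    then have "D \<subseteq> ?G \<and> |D| =o \<chi> j \<and> (\<forall>x\<in>D. a x \<in> K \<and> a x \<inter> D = {x} \<and> \<not> large (\<chi> i0) (a x \<inter> F))"
      using D(2,3) by (intro conjI)
    then show "\<exists>D. \<exists>a. D \<subseteq> ?G \<and> |D| =o \<chi> j \<and> (\<forall>x\<in>D. a x \<in> K \<and> a x \<inter> D = {x} \<and> \<not> large (\<chi> i0) (a x \<inter> F))"
      by (intro exI)
  qed
  from bchoice[OF this] obtain D0 where "\<forall>j\<in>J. \<exists>a. D0 j \<subseteq> ?G \<and> |D0 j| =o \<chi> j \<and> (\<forall>x\<in>D0 j. a x \<in> K \<and> a x \<inter> D0 j = {x} \<and> \<not> large (\<chi> i0) (a x \<inter> F))"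
    by (elim exE)
  from bchoice[OF this] obtain a where a: "\<forall>j\<in>J. D0 j \<subseteq> ?G \<and> |D0 j| =o \<chi> j \<and>
      (\<forall>x\<in>D0 j. a j x \<in> K \<and> a j x \<inter> D0 j = {x} \<and> \<not> large (\<chi> i0) (a j x \<inter> F))"
    by (elim exE)
  have D0X: "D0 j \<subseteq> F" if "j \<in> J" for j using a that by blast
  have small: "|a j x \<inter> D0 i| <o \<chi> i0" if "i \<in> J" "j \<in> J" "x \<in> D0 j" for i j x
  proof (rule ccontr)
    assume "\<not> |a j x \<inter> D0 i| <o \<chi> i0"
    then have le: "\<chi> i0 \<le>o |a j x \<inter> D0 i|" using not_ordLess_card_of c0(1) by blast
    have "thick (\<chi> i0) (a j x \<inter> D0 i)"
    proof (rule discrete_imp_thick[OF _ _ _ le])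
      show "a j x \<inter> D0 i \<subseteq> X" using D0X[OF that(1)] F by blast
      show "a i s \<in> K" if "s \<in> a j x \<inter> D0 i" for s using a \<open>i \<in> J\<close> that by blast
      show "a i s \<inter> (a j x \<inter> D0 i) = {s}" if "s \<in> a j x \<inter> D0 i" for s
      proof -
        have "a i s \<inter> D0 i = {s}" using a \<open>i \<in> J\<close> that by blast
        then show ?thesis using that by blast
      qed
    qed
    moreover have "a j x \<inter> D0 i \<subseteq> a j x \<inter> F" using D0X[OF that(1)] by blast
    ultimately have "large (\<chi> i0) (a j x \<inter> F)" unfolding large_def by blast
    then show False using a that by blast
  qed
  define R where "R j = (\<Union>i\<in>underS \<kappa> j \<inter> J. \<Union>x\<in>D0 i. a i x \<inter> D0 j)" for j
  define D where "D j = D0 j - R j" for j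
  have D: "\<chi> j \<le>o |D j|" if j: "j \<in> J" for j
  proof -
    have "|R j| <o \<chi> j"
      unfolding R_def
    proof (rule regular_UN_ordLess[OF cj[OF j]])
      have "|underS \<kappa> j \<inter> J| \<le>o |Field \<kappa>|" by (rule card_of_mono1) (use JF in blast)
      then show "|underS \<kappa> j \<inter> J| <o \<chi> j" by (rule ordLeq_ordLess_trans[OF _ kappa_chi]) (use j JF in blast)
      fix i assume i: "i \<in> underS \<kappa> j \<inter> J"
      show "|\<Union>x\<in>D0 i. a i x \<inter> D0 j| <o \<chi> j"
      proof (rule regular_UN_ordLess[OF cj[OF j]])
        have "|D0 i| =o \<chi> i" using a i by blast
        then show "|D0 i| <o \<chi> j" by (rule ordIso_ordLess_trans[OF _ chi_mono]) (use i in blast)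
        show "|a i x \<inter> D0 j| <o \<chi> j" if "x \<in> D0 i" for x
          by (rule ordLess_transitive[OF small th[OF j]]) (use i j that in auto)
      qed
    qed
    moreover have "\<chi> j \<le>o |D0 j|"
      by (rule ordIso_imp_ordLeq[OF ordIso_symmetric]) (use a j in blast)
    ultimately show ?thesis unfolding D_def by (intro Diff_not_ordLess[OF cj(1)[OF j]])
  qed
  obtain S where S: "S \<subseteq> (\<Union>j\<in>J. D j)" "\<forall>j\<in>J. \<chi> j \<le>o |S \<inter> D j|"
    "\<forall>j\<in>J. \<forall>x\<in>S \<inter> D j. a j x \<inter> S = {x}"
  proof (rule free_transversal[of \<kappa> J "\<chi> i0" \<chi> D a])
    show "Well_order \<kappa>" by (rule wo)
    show "J \<subseteq> Field \<kappa>" by (rule JF)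
    show "|J| <o \<chi> i0" by (rule ordLeq_ordLess_trans[OF card_of_mono1[OF JF] kappa_chi[OF i0]])
    show "Cinfinite (\<chi> i0)" "regularCard (\<chi> i0)" using c0 by blast+
    show "Cinfinite (\<chi> j) \<and> regularCard (\<chi> j) \<and> \<chi> i0 <o \<chi> j" if "j \<in> J" for j using cj th that by blast
    show "\<chi> j \<le>o |D j|" if "j \<in> J" for j by (rule D[OF that])
    have aD: "a j x \<inter> D0 j = {x}" if "j \<in> J" "x \<in> D j" for j x using a that unfolding D_def by blast
    show "x \<in> a j x" if "j \<in> J" "x \<in> D j" for j x using aD[OF that] by blast
    show "a j x \<inter> D j \<subseteq> {x}" if "j \<in> J" "x \<in> D j" for j x using aD[OF that] unfolding D_def by blast
    show "|a j x \<inter> D i| <o \<chi> i0" if "i \<in> J" "j \<in> J" "x \<in> D j" for i j x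
      by (rule ordLeq_ordLess_trans[OF card_of_mono1 small[OF that(1,2)]]) (use that(3) in \<open>auto simp: D_def\<close>)
    show "a i x \<inter> D j = {}" if "i \<in> J" "j \<in> J" "i \<in> underS \<kappa> j" "x \<in> D i" for i j x
      using that unfolding D_def R_def by blast
  qed blast
  have SX: "S \<subseteq> X" using S(1) D0X F unfolding D_def by blast
  have "\<forall>s\<in>S. \<exists>b. b \<in> K \<and> b \<inter> S = {s}"
  proof
    fix s assume s: "s \<in> S"
    then obtain j where j: "j \<in> J" "s \<in> D j" using S(1) by blast
    then have "a j s \<inter> S = {s}" using S(3) s by blast
    moreover have "a j s \<in> K" using a j unfolding D_def by blast
    ultimately show "\<exists>b. b \<in> K \<and> b \<inter> S = {s}" by blast
  qed
  then obtain b where b: "\<forall>s\<in>S. b s \<in> K \<and> b s \<inter> S = {s}" by (elim exE[OF bchoice])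
  have thJ: "thick (\<chi> j) (cl S)" if "j \<in> J" for j
  proof (rule discrete_imp_thick_cl[OF SX])
    show "b s \<in> K" if "s \<in> S" for s using b that by blast
    show "b s \<inter> S = {s}" if "s \<in> S" for s using b that by blast
    have "\<chi> j \<le>o |S \<inter> D j|" using S(2) that by blast
    then show "\<chi> j \<le>o |S|" by (rule ordLeq_transitive[OF _ card_of_mono1]) blast
  qed
  show thesis
  proof (rule that[of "cl S"])
    show "cl (cl S) \<subseteq> cl S" by (rule cl_cl)
    show "\<forall>j\<in>Field \<kappa>. thick (\<chi> j) (cl S)"
    proof
      fix j assume j: "j \<in> Field \<kappa>"
      obtain k where k: "k \<in> Field \<kappa>" "i0 \<noteq> k" "(i0, k) \<in> \<kappa>"
        using infinite_Card_order_limit[OF _ _ i0] kappa unfolding cinfinite_def by blast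
      then have kJ: "k \<in> J" unfolding J_def underS_def by blast
      show "thick (\<chi> j) (cl S)"
      proof (cases "j \<in> J")
        case False
        have "j = i0 \<or> j \<in> underS \<kappa> i0" using underS_total[OF wo j i0] False unfolding J_def by blast
        then have "\<chi> j \<le>o \<chi> i0"
        proof
          assume "j = i0"
          then show ?thesis using c0(1) ordLeq_reflexive card_order_on_well_order_on by blast
        next
          assume "j \<in> underS \<kappa> i0"
          then show ?thesis by (rule ordLess_imp_ordLeq[OF chi_mono])
        qed
        then have "\<chi> j \<le>o \<chi> k" by (rule ordLeq_transitive[OF _ ordLess_imp_ordLeq[OF th[OF kJ]]])
        then show ?thesis by (rule thick_mono[OF _ thJ[OF kJ]])
      qed (rule thJ)
    qed
  qed
qed

text \<open>The closed subspaces \<open>Y i\<close> obtained from the blocks stay separated by the clopen sets \<open>c i\<close>, so that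
  the closure of their union has trace \<open>Y i\<close> on \<open>c i\<close>. A dense subset of the closure therefore contains a dense subset of
  each \<open>Y i\<close>.\<close>

lemma thick_closed_if_separated_blocks:
  assumes c: "\<And>i. i \<in> Field \<kappa> \<Longrightarrow> c i \<in> K"
    and Z: "\<And>i. i \<in> Field \<kappa> \<Longrightarrow> large (\<chi> i) (Z i)" "\<And>i. i \<in> Field \<kappa> \<Longrightarrow> Z i \<subseteq> c i"
    and sep: "\<And>i j. i \<in> Field \<kappa> \<Longrightarrow> j \<in> Field \<kappa> \<Longrightarrow> i \<noteq> j \<Longrightarrow> Z i \<inter> c j = {}"
  obtains Y where "cl Y \<subseteq> Y" "\<forall>j\<in>Field \<kappa>. thick (\<chi> j) Y"
proof -
  have "\<forall>i\<in>Field \<kappa>. \<exists>Y. cl Y \<subseteq> Y \<and> thick (\<chi> i) Y \<and> Y \<subseteq> c i \<and> (\<forall>j\<in>Field \<kappa>. j \<noteq> i \<longrightarrow> Y \<inter> c j = {})"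
  proof
    fix i assume i: "i \<in> Field \<kappa>"
    obtain T where T: "T \<subseteq> Z i" "thick (\<chi> i) T" using Z(1)[OF i] unfolding large_def by blast
    obtain Y where Y: "cl Y \<subseteq> Y" "Y \<subseteq> cl T" "thick (\<chi> i) Y"
      by (rule thick_imp_closed_thick[OF chi(1)[OF i] chi(2)[OF i] T(2)])
    have Tc: "T \<subseteq> c i" using T(1) Z(2)[OF i] by (rule subset_trans)
    have "cl T \<subseteq> c i" by (rule subset_trans[OF cl_mono[OF Tc] cl_clopen[OF c[OF i]]])
    moreover have "Y \<inter> c j = {}" if j: "j \<in> Field \<kappa>" "j \<noteq> i" for j
    proof (rule ccontr)
      assume "Y \<inter> c j \<noteq> {}"
      then obtain y where y: "y \<in> Y" "y \<in> c j" by blast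
      have "y \<in> cl T" using y(1) Y(2) by blast
      then have "c j \<inter> T \<noteq> {}" using y(2) c[OF j(1)] unfolding cl_def by blast
      then show False using sep[OF i j(1)] j(2) T(1) by blast
    qed
    ultimately have "cl Y \<subseteq> Y \<and> thick (\<chi> i) Y \<and> Y \<subseteq> c i \<and> (\<forall>j\<in>Field \<kappa>. j \<noteq> i \<longrightarrow> Y \<inter> c j = {})"
      using Y by blast
    then show "\<exists>Y. cl Y \<subseteq> Y \<and> thick (\<chi> i) Y \<and> Y \<subseteq> c i \<and> (\<forall>j\<in>Field \<kappa>. j \<noteq> i \<longrightarrow> Y \<inter> c j = {})"
      by (rule exI)
  qed
  then obtain Y where Y: "\<forall>i\<in>Field \<kappa>. cl (Y i) \<subseteq> Y i \<and> thick (\<chi> i) (Y i) \<and> Y i \<subseteq> c i \<and> (\<forall>j\<in>Field \<kappa>. j \<noteq> i \<longrightarrow> Y i \<inter> c j = {})"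
    by (elim exE[OF bchoice])
  let ?U = "\<Union>i\<in>Field \<kappa>. Y i"
  have UX: "?U \<subseteq> X" using Y unfolding thick_def by blast
  have Uc: "cl ?U \<inter> c i \<subseteq> Y i" if i: "i \<in> Field \<kappa>" for i
  proof
    fix y assume y: "y \<in> cl ?U \<inter> c i"
    have "y \<in> cl (Y i)"
      unfolding cl_def
    proof (rule CollectI, intro conjI ballI impI)
      show "y \<in> X" using y cl_subset by blast
      fix b assume b: "b \<in> K" "y \<in> b"
      have "b \<inter> c i \<in> K" by (rule K_Int[OF b(1) c[OF i]])
      then have "(b \<inter> c i) \<inter> ?U \<noteq> {}" using y b(2) unfolding cl_def by blast
      then obtain k z where k: "k \<in> Field \<kappa>" "z \<in> b \<inter> c i" "z \<in> Y k" by blast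
      have "k = i"
      proof (rule ccontr)
        assume "k \<noteq> i"
        then have "Y k \<inter> c i = {}" using Y k(1) i by simp
        then show False using k by blast
      qed
      then show "b \<inter> Y i \<noteq> {}" using k by blast
    qed
    then show "y \<in> Y i" using Y i by blast
  qed
  show thesis
  proof (rule that[of "cl ?U"])
    show "cl (cl ?U) \<subseteq> cl ?U" by (rule cl_cl)
    show "\<forall>j\<in>Field \<kappa>. thick (\<chi> j) (cl ?U)"
    proof
      fix j assume j: "j \<in> Field \<kappa>"
      show "thick (\<chi> j) (cl ?U)"
        unfolding thick_def
      proof (intro conjI allI impI notI)
        show "cl ?U \<subseteq> X" by (rule cl_subset)
        fix E assume E: "E \<subseteq> cl ?U" "|E| <o \<chi> j" "cl ?U \<subseteq> cl E"
        have "|E \<inter> c j| <o \<chi> j" by (rule ordLeq_ordLess_trans[OF card_of_mono1 E(2)]) blast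
        moreover have "E \<inter> c j \<subseteq> Y j" using Uc[OF j] E(1) by blast
        ultimately have "\<not> Y j \<subseteq> cl (E \<inter> c j)" using Y j unfolding thick_def by blast
        then obtain y where y: "y \<in> Y j" "y \<notin> cl (E \<inter> c j)" by blast
        have yU: "y \<in> ?U" using y(1) j by blast
        then obtain b where b: "b \<in> K" "y \<in> b" "b \<inter> (E \<inter> c j) = {}" using notin_cl y(2) UX by blast
        have "y \<in> cl E" using yU subset_cl[OF UX] E(3) by blast
        moreover have "b \<inter> c j \<in> K" by (rule K_Int[OF b(1) c[OF j]])
        moreover have "Y j \<subseteq> c j" using Y j by simp
        then have "y \<in> b \<inter> c j" using b(2) y(1) by blast
        ultimately have "(b \<inter> c j) \<inter> E \<noteq> {}" unfolding cl_def by blast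
        then show False using b(3) by blast
      qed
    qed
  qed
qed

lemma avoid_non_large:
  assumes i: "i \<in> Field \<kappa>" and V: "large (\<chi> i) V" and M: "|M| <o \<chi> i"
    and A: "\<And>m. m \<in> M \<Longrightarrow> \<not> large (\<chi> i) (A m)"
  obtains x where "x \<in> V" "\<forall>m\<in>M. x \<notin> A m"
proof -
  have "\<not> V \<subseteq> (\<Union>m\<in>M. A m)"
  proof
    assume "V \<subseteq> (\<Union>m\<in>M. A m)"
    then have "large (\<chi> i) (\<Union>m\<in>M. A m)" using large_subset V by blast
    then obtain m where "m \<in> M" "large (\<chi> i) (A m)" by (rule large_UN[OF chi(1)[OF i] chi(2)[OF i] M])
    then show False using A by blast
  qed
  then show thesis using that by blast
qed

text \<open>The points of \<open>F\<close> that are not small form a large set; take a left-separated sequence of them. The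
  difference \<open>a p - a q\<close> is a neighbourhood of the \<open>p\<close>-th point.\<close>

lemma pool_exists:
  assumes m: "Card_order m" "m <o \<chi> j" and j: "j \<in> Field \<kappa>" and i: "i \<in> Field \<kappa>" and F: "large (\<chi> j) F"
    and neg: "\<not> large (\<chi> j) (small_points i F)"
  shows "\<exists>a. (\<forall>p\<in>Field m. a p \<in> K) \<and> (\<forall>q\<in>Field m. \<forall>p\<in>underS m q. large (\<chi> i) (F \<inter> (a p - a q)))"
proof -
  let ?G = "small_points i F"
  have "large (\<chi> j) (?G \<union> (F - ?G))" by (rule large_subset[OF _ F]) blast
  then have "large (\<chi> j) (F - ?G)" using large_Un[OF chi(1)[OF j] chi(2)[OF j]] neg by blast
  then obtain T where T: "T \<subseteq> F - ?G" "thick (\<chi> j) T" unfolding large_def by blast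
  have "thick m T" by (rule thick_mono[OF ordLess_imp_ordLeq[OF m(2)] T(2)])
  then obtain x a where x: "\<And>p. p \<in> Field m \<Longrightarrow> x p \<in> T" "\<And>p. p \<in> Field m \<Longrightarrow> a p \<in> K"
    "\<And>p. p \<in> Field m \<Longrightarrow> x p \<in> a p" "\<And>q p. q \<in> Field m \<Longrightarrow> p \<in> underS m q \<Longrightarrow> x p \<notin> a q"
    by (rule thick_sequence[OF m(1)]) blast
  have "large (\<chi> i) (F \<inter> (a p - a q))" if q: "q \<in> Field m" and p: "p \<in> underS m q" for p q
  proof -
    have pF: "p \<in> Field m" using underS_in_Field[OF p] by blast
    have "a p - a q \<in> K" "x p \<in> a p - a q" using K_Diff x(2,3)[OF pF] x(2)[OF q] x(4)[OF q p] by auto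
    moreover have "x p \<in> F" "x p \<notin> ?G" using x(1)[OF pF] T(1) by blast+
    ultimately have "large (\<chi> i) ((a p - a q) \<inter> F)" unfolding small_points_def by blast
    then show ?thesis by (simp only: Int_commute)
  qed
  then show ?thesis using x(2) by blast
qed

text \<open>The closed sets that can occur as remainder in the recursion.\<close>

definition good :: "'p set \<Rightarrow> bool" where
  "good F \<longleftrightarrow> (\<exists>S\<subseteq>K. F = X - \<Union>S) \<and> (\<forall>j\<in>Field \<kappa>. large (\<chi> j) F)"

text \<open>The cardinal \<open>m\<close> plays the role of \<open>(2\<^sup>\<kappa>)\<^sup>+\<close>: it satisfies \<open>m\<^sup>\<kappa> = m\<close>, exceeds \<open>2\<^sup>\<kappa>\<close>, and lies below all
  \<open>\<chi> i\<close>. The first property bounds the number of runs of the recursion, the second permits the pigeonhole argument on traces, and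
  the third lets the points \<open>\<rho> j\<close> and \<open>e\<close> avoid all sets of all runs that are not large.\<close>

lemma thick_closed_if_not_locally_small:
  fixes m :: "'m rel"
  assumes m: "Cinfinite m" "|Func (Field \<kappa>) (Field m \<times> Field m)| \<le>o m" "|Pow (Field \<kappa>)| <o m"
    and kap_m: "|Field \<kappa>| \<le>o m"
    and m_chi: "\<And>i. i \<in> Field \<kappa> \<Longrightarrow> m <o \<chi> i"
    and X: "\<And>j. j \<in> Field \<kappa> \<Longrightarrow> large (\<chi> j) X"
    and neg: "\<And>F i. good F \<Longrightarrow> i \<in> Field \<kappa> \<Longrightarrow>
      \<exists>j\<in>Field \<kappa>. \<not> large (\<chi> j) (small_points i F)"
  obtains Y where "cl Y \<subseteq> Y" "\<forall>j\<in>Field \<kappa>. thick (\<chi> j) Y"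
proof -
  have wm: "Well_order m" and com: "Card_order m" using m(1) card_order_on_well_order_on by blast+
  define pool where "pool q a \<longleftrightarrow> good (fst q) \<and> snd q \<in> Field \<kappa> \<longrightarrow> (\<forall>p\<in>Field m. a p \<in> K) \<and>
      (\<forall>p'\<in>Field m. \<forall>p\<in>underS m p'. large (\<chi> (snd q)) (fst q \<inter> (a p - a p')))"
    for q :: "'p set \<times> 'l" and a :: "'m \<Rightarrow> 'p set"
  have "\<forall>q. \<exists>a. pool q a"
  proof
    fix q :: "'p set \<times> 'l"
    show "\<exists>a. pool q a"
    proof (cases "good (fst q) \<and> snd q \<in> Field \<kappa>")
      case True
      then obtain j where j: "j \<in> Field \<kappa>"
        "\<not> large (\<chi> j) (small_points (snd q) (fst q))"
        using neg by blast
      have "large (\<chi> j) (fst q)" using True j(1) unfolding good_def by blast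
      from pool_exists[OF com m_chi[OF j(1)] j(1) conjunct2[OF True] this j(2)]
      obtain a where "(\<forall>p\<in>Field m. a p \<in> K) \<and>
        (\<forall>p'\<in>Field m. \<forall>p\<in>underS m p'. large (\<chi> (snd q)) (fst q \<inter> (a p - a p')))" by (elim exE)
      then have "pool q a" unfolding pool_def by (rule impI)
      then show ?thesis by (rule exI[of "pool q" a])
    next
      case False
      then have "pool q a" for a unfolding pool_def by blast
      then show ?thesis by (rule exI[of "pool q"])
    qed
  qed
  then obtain A where A: "\<forall>q. pool q (A q)" by (elim exE[OF choice])
  let ?R = "\<kappa> - Id"
  have wfR: "wf ?R" using wo by (simp add: well_order_on_def)
  have R: "(k, i) \<in> ?R \<longleftrightarrow> k \<in> underS \<kappa> i" for k i by (auto simp: underS_def)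
  \<comment> \<open>A code \<open>s\<close> selects at each stage a pair of indices; \<open>C s i\<close> is the corresponding difference of
    neighbourhoods in the remainder \<open>Fs s i\<close>. It depends on \<open>s\<close> up to \<open>i\<close> only.\<close>
  define step where "step s f i = A (X - \<Union>(f ` underS \<kappa> i), i) (fst (s i)) - A (X - \<Union>(f ` underS \<kappa> i), i) (snd (s i))"
    for s :: "'l \<Rightarrow> 'm \<times> 'm" and f and i
  define C where "C s = wfrec ?R (step s)" for s
  define Fs where "Fs s i = X - \<Union>(C s ` underS \<kappa> i)" for s i
  have C: "C s i = A (Fs s i, i) (fst (s i)) - A (Fs s i, i) (snd (s i))" for s i
  proof -
    have "cut (C s) ?R i ` underS \<kappa> i = C s ` underS \<kappa> i"
      by (rule image_cong[OF refl]) (simp add: cut_def underS_def)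
    moreover have "C s i = step s (cut (C s) ?R i) i" unfolding C_def by (rule wfrec[OF wfR])
    ultimately show ?thesis unfolding step_def Fs_def by simp
  qed
  have C_cong: "C s i = C s' i" if "\<forall>k. (k, i) \<in> \<kappa> \<or> k = i \<longrightarrow> s k = s' k" for s s' i
    using that
  proof (induction i rule: wf_induct_rule[OF wfR])
    case (1 i)
    have "C s k = C s' k" if k: "k \<in> underS \<kappa> i" for k
    proof (rule 1(1))
      show "(k, i) \<in> ?R" using k R by blast
      show "\<forall>l. (l, k) \<in> \<kappa> \<or> l = k \<longrightarrow> s l = s' l"
      proof (intro allI impI)
        fix l assume "(l, k) \<in> \<kappa> \<or> l = k"
        then have "(l, i) \<in> \<kappa>"
          using underS_trans[OF wo, of l k i] k unfolding underS_def by blast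
        then show "s l = s' l" using 1(2) by blast
      qed
    qed
    then have "Fs s i = Fs s' i" unfolding Fs_def by simp
    then show ?case using C[of s i] C[of s' i] 1(2) by simp
  qed
  have Fs_cong: "Fs s i = Fs s' i" if "\<forall>k\<in>underS \<kappa> i. s k = s' k" for s s' i
  proof -
    have "C s k = C s' k" if k: "k \<in> underS \<kappa> i" for k
    proof (rule C_cong, intro allI impI)
      fix l assume "(l, k) \<in> \<kappa> \<or> l = k"
      then have "l \<in> underS \<kappa> i" using underS_trans[OF wo, of l k i] k unfolding underS_def by blast
      then show "s l = s' l" using \<open>\<forall>k\<in>underS \<kappa> i. s k = s' k\<close> by blast
    qed
    then show ?thesis unfolding Fs_def by simp
  qed
  \<comment> \<open>\<open>V s i\<close> is the block produced at stage \<open>i\<close>, and \<open>Z s i\<close> is what the later stages leave of it.\<close>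
  define V where "V s i = Fs s i \<inter> C s i" for s i
  define Z where "Z s i = V s i - (\<Union>k\<in>{k. i \<in> underS \<kappa> k}. C s k)" for s i
  let ?Fam = "Func (Field \<kappa>) (Field m \<times> Field m)"
  have FamI: "(\<lambda>k. if k \<in> Field \<kappa> then s k else undefined) \<in> ?Fam" if "\<forall>k\<in>Field \<kappa>. s k \<in> Field m \<times> Field m" for s
    using that unfolding Func_def by auto
  \<comment> \<open>The point \<open>\<rho> j\<close> certifies largeness at \<open>j\<close> of every remainder that contains it, whatever the code.\<close>
  have "\<forall>j\<in>Field \<kappa>. \<exists>x. x \<in> X \<and> (\<forall>s\<in>?Fam. \<forall>i\<in>Field \<kappa>. \<not> large (\<chi> j) (Fs s i) \<longrightarrow> x \<notin> Fs s i)"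
  proof
    fix j assume j: "j \<in> Field \<kappa>"
    let ?M = "{(s, i). s \<in> ?Fam \<and> i \<in> Field \<kappa> \<and> \<not> large (\<chi> j) (Fs s i)}"
    have "|?Fam \<times> Field \<kappa>| \<le>o m"
      by (rule card_of_Times_ordLeq_infinite_Field[OF _ m(2) kap_m]) (use m(1) in \<open>auto simp: cinfinite_def\<close>)
    then have "|?M| \<le>o m" by (rule ordLeq_transitive[OF card_of_mono1, rotated]) blast
    then have M: "|?M| <o \<chi> j" by (rule ordLeq_ordLess_trans[OF _ m_chi[OF j]])
    obtain x where "x \<in> X" "\<forall>q\<in>?M. x \<notin> (case q of (s, i) \<Rightarrow> Fs s i)"
      by (rule avoid_non_large[OF j X[OF j] M, of "\<lambda>(s, i). Fs s i"]) auto
    then have "x \<in> X \<and> (\<forall>s\<in>?Fam. \<forall>i\<in>Field \<kappa>. \<not> large (\<chi> j) (Fs s i) \<longrightarrow> x \<notin> Fs s i)" by blast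
    then show "\<exists>x. x \<in> X \<and> (\<forall>s\<in>?Fam. \<forall>i\<in>Field \<kappa>. \<not> large (\<chi> j) (Fs s i) \<longrightarrow> x \<notin> Fs s i)" by (rule exI)
  qed
  then obtain \<rho> where rho: "\<forall>j\<in>Field \<kappa>. \<rho> j \<in> X \<and> (\<forall>s\<in>?Fam. \<forall>i\<in>Field \<kappa>. \<not> large (\<chi> j) (Fs s i) \<longrightarrow> \<rho> j \<notin> Fs s i)"
    by (elim exE[OF bchoice])
  \<comment> \<open>Likewise \<open>e (V, i)\<close> is a point of the block \<open>V\<close> whose presence in what is left of the block
    certifies that the rest is large.\<close>
  define gen where "gen q x \<longleftrightarrow> snd q \<in> Field \<kappa> \<longrightarrow> large (\<chi> (snd q)) (fst q) \<longrightarrow>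
      x \<in> fst q \<and> (\<forall>s\<in>?Fam. \<not> large (\<chi> (snd q)) (Z s (snd q)) \<longrightarrow> x \<notin> Z s (snd q))"
    for q :: "'p set \<times> 'l" and x
  have "\<forall>q. \<exists>x. gen q x"
  proof
    fix q :: "'p set \<times> 'l"
    show "\<exists>x. gen q x"
    proof (cases "snd q \<in> Field \<kappa> \<and> large (\<chi> (snd q)) (fst q)")
      case True
      let ?M = "{s \<in> ?Fam. \<not> large (\<chi> (snd q)) (Z s (snd q))}"
      have "|?M| \<le>o m" by (rule ordLeq_transitive[OF card_of_mono1 m(2)]) blast
      then have M: "|?M| <o \<chi> (snd q)" by (rule ordLeq_ordLess_trans[OF _ m_chi]) (use True in blast)
      obtain x where "x \<in> fst q" "\<forall>s\<in>?M. x \<notin> Z s (snd q)"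
        by (rule avoid_non_large[OF conjunct1[OF True] conjunct2[OF True] M, of "\<lambda>s. Z s (snd q)"]) auto
      then have "gen q x" unfolding gen_def by blast
      then show ?thesis by (rule exI)
    qed (simp add: gen_def)
  qed
  then obtain e where e: "\<forall>q. gen q (e q)" by (elim exE[OF choice])
  \<comment> \<open>The requirement on the code: the new clopen set misses all \<open>\<rho> j\<close> and the certifying points of all
    earlier blocks.\<close>
  define P where "P s i v \<longleftrightarrow> snd v \<in> Field m \<and> fst v \<in> underS m (snd v) \<and>
      (let c = A (Fs s i, i) (fst v) - A (Fs s i, i) (snd v) in
        (\<forall>j\<in>Field \<kappa>. \<rho> j \<notin> c) \<and> (\<forall>k\<in>underS \<kappa> i. e (V s k, k) \<notin> c))" for s i v
  have P_C: "(\<forall>j\<in>Field \<kappa>. \<rho> j \<notin> C s i) \<and> (\<forall>k\<in>underS \<kappa> i. e (V s k, k) \<notin> C s i)" if "P s i (s i)" for s i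
    using that unfolding P_def C[of s i] Let_def by blast
  have P_m: "s i \<in> Field m \<times> Field m" if "P s i (s i)" for s i
    using that underS_in_Field unfolding P_def by (cases "s i") fastforce
  have good_Fs: "good (Fs s i)" if "i \<in> Field \<kappa>" "\<forall>k\<in>underS \<kappa> i. P s k (s k)" for s i
    using that
  proof (induction i rule: wf_induct_rule[OF wfR])
    case (1 i)
    have CK: "C s k \<in> K" if k: "k \<in> underS \<kappa> i" for k
    proof -
      have kF: "k \<in> Field \<kappa>" using underS_in_Field[OF k] by blast
      have "\<forall>l\<in>underS \<kappa> k. P s l (s l)"
      proof
        fix l assume "l \<in> underS \<kappa> k"
        then have "l \<in> underS \<kappa> i" using underS_trans[OF wo, of l k i] k unfolding underS_def by blast
        then show "P s l (s l)" using 1(3) by blast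
      qed
      then have "good (Fs s k)" using 1(1)[of k] k R kF by blast
      then have "\<forall>p\<in>Field m. A (Fs s k, k) p \<in> K" using A kF unfolding pool_def by (metis fst_conv snd_conv)
      moreover have "fst (s k) \<in> Field m" "snd (s k) \<in> Field m" using P_m[of s k] 1(3) k by auto
      ultimately show ?thesis unfolding C[of s k] by (intro K_Diff) blast+
    qed
    have "large (\<chi> j) (Fs s i)" if j: "j \<in> Field \<kappa>" for j
    proof (rule ccontr)
      assume nl: "\<not> large (\<chi> j) (Fs s i)"
      \<comment> \<open>The certificates refer to total codes, so the initial segment of \<open>s\<close> is continued arbitrarily.\<close>
      obtain p0 where p0: "p0 \<in> Field m" using m(1) unfolding cinfinite_def by fastforce
      define s' where "s' k = (if k \<in> Field \<kappa> then (if k \<in> underS \<kappa> i then s k else (p0, p0)) else undefined)" for k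
      have "s' \<in> ?Fam"
        unfolding s'_def
      proof (rule FamI, rule ballI)
        fix k
        show "(if k \<in> underS \<kappa> i then s k else (p0, p0)) \<in> Field m \<times> Field m"
          using P_m[of s k] 1(3) p0 by auto
      qed
      moreover have "Fs s' i = Fs s i"
        by (rule Fs_cong) (auto simp: s'_def dest: underS_in_Field)
      ultimately have "\<rho> j \<notin> Fs s i" using rho j 1(2) nl by metis
      moreover have "\<rho> j \<in> X" using rho j by blast
      ultimately obtain k where "k \<in> underS \<kappa> i" "\<rho> j \<in> C s k" unfolding Fs_def by blast
      then show False using P_C[of s k] 1(3) j by blast
    qed
    then show ?case unfolding good_def Fs_def using CK by blast
  qed
  obtain s where s: "\<And>i. i \<in> Field \<kappa> \<Longrightarrow> P s i (s i)"
  proof (rule well_order_choice[of \<kappa> P])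
    show "Well_order \<kappa>" by (rule wo)
  next
    fix f g :: "'l \<Rightarrow> 'm \<times> 'm" and i v
    assume fg: "\<And>z. z \<in> underS \<kappa> i \<Longrightarrow> f z = g z"
    have "V f k = V g k" if k: "k \<in> underS \<kappa> i" for k
    proof -
      have "\<forall>l. (l, k) \<in> \<kappa> \<or> l = k \<longrightarrow> f l = g l"
      proof (intro allI impI)
        fix l assume "(l, k) \<in> \<kappa> \<or> l = k"
        then have "l \<in> underS \<kappa> i" using underS_trans[OF wo, of l k i] k unfolding underS_def by blast
        then show "f l = g l" by (rule fg)
      qed
      then have "C f k = C g k" "Fs f k = Fs g k"
        by (auto intro!: C_cong Fs_cong simp: underS_def)
      then show ?thesis unfolding V_def by simp
    qed
    moreover have "Fs f i = Fs g i" by (rule Fs_cong) (use fg in blast)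
    ultimately show "P f i v = P g i v" unfolding P_def Let_def by simp
  next
    fix s i assume i: "i \<in> Field \<kappa>" and IH: "\<And>y. y \<in> underS \<kappa> i \<Longrightarrow> P s y (s y)"
    let ?F = "Fs s i"
    have "good ?F" by (rule good_Fs[OF i]) (use IH in blast)
    then have a: "\<forall>p\<in>Field m. A (?F, i) p \<in> K" using A i unfolding pool_def by (metis fst_conv snd_conv)
    let ?Pt = "\<rho> ` Field \<kappa> \<union> (\<lambda>k. e (V s k, k)) ` underS \<kappa> i"
    have infk: "infinite (Field |Field \<kappa>| )" using kappa by (simp add: cinfinite_def Field_card_of)
    have "|(\<lambda>k. e (V s k, k)) ` underS \<kappa> i| \<le>o |Field \<kappa>|"
      by (rule ordLeq_transitive[OF card_of_image card_of_mono1]) (use underS_in_Field in fast)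
    then have cPt: "|?Pt| \<le>o |Field \<kappa>|"
      by (rule card_of_Un_ordLeq_infinite_Field[OF infk card_of_image _ card_of_Card_order])
    have "\<rho> i \<in> ?Pt" using i by (intro UnI1 imageI)
    then have ne: "?Pt \<noteq> {}" by (metis empty_iff)
    obtain g where g: "g ` Field \<kappa> = ?Pt" using iffD2[OF card_of_ordLeq2[OF ne] cPt] by (elim exE)
    \<comment> \<open>Two indices with the same trace on the points to be missed have a difference that misses them;
      \<open>g\<close> enumerates these points along \<open>\<kappa>\<close>, and so there are at most \<open>2\<^sup>\<kappa>\<close> traces.\<close>
    define tr where "tr p = {k \<in> Field \<kappa>. g k \<in> A (?F, i) p}" for p
    have "\<not> inj_on tr (Field m)"
    proof
      assume "inj_on tr (Field m)"
      then have "|Field m| \<le>o |Pow (Field \<kappa>)|" by (rule card_of_ordLeqI) (auto simp: tr_def)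
      then have "|Field m| <o m" by (rule ordLeq_ordLess_trans[OF _ m(3)])
      then show False using card_of_Field_ordIso[OF com] not_ordLess_ordIso by blast
    qed
    then obtain p q where pq: "p \<in> Field m" "q \<in> Field m" "p \<noteq> q" "tr p = tr q" unfolding inj_on_def by blast
    have "\<exists>p q. q \<in> Field m \<and> p \<in> underS m q \<and> tr p = tr q"
      using underS_total[OF wm pq(1-3)] pq by metis
    then obtain p q where pq: "q \<in> Field m" "p \<in> underS m q" "tr p = tr q" by (elim exE conjE)
    have miss: "x \<notin> A (?F, i) p - A (?F, i) q" if "x \<in> ?Pt" for x
    proof -
      obtain k where k: "k \<in> Field \<kappa>" "g k = x" using \<open>x \<in> ?Pt\<close> unfolding g[symmetric] by blast
      have "k \<in> tr p \<longleftrightarrow> k \<in> tr q" using pq(3) by simp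
      then show ?thesis unfolding tr_def using k by simp
    qed
    have "P s i (p, q)" unfolding P_def Let_def fst_conv snd_conv
      using pq(1,2) miss by (intro conjI ballI) simp_all
    then show "\<exists>v. P s i v" by (rule exI)
  qed blast
  \<comment> \<open>The family of codes consists of functions that are \<open>undefined\<close> outside \<open>\<kappa>\<close>.\<close>
  define s' where "s' k = (if k \<in> Field \<kappa> then s k else undefined)" for k
  have s'Fam: "s' \<in> ?Fam" unfolding s'_def by (rule FamI) (use P_m s in blast)
  have kF: "k \<in> Field \<kappa>" if "(k, i) \<in> \<kappa>" for k i using that by (auto simp: Field_def)
  have Cs': "C s' i = C s i" if "i \<in> Field \<kappa>" for i
    by (rule C_cong) (use that kF in \<open>auto simp: s'_def\<close>)
  have Fs': "Fs s' i = Fs s i" for i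
    by (rule Fs_cong) (use kF in \<open>auto simp: s'_def underS_def\<close>)
  have goods: "good (Fs s i)" if "i \<in> Field \<kappa>" for i
    by (rule good_Fs[OF that]) (use s underS_in_Field in fast)
  have pl: "(\<forall>p\<in>Field m. A (Fs s i, i) p \<in> K) \<and>
      (\<forall>p'\<in>Field m. \<forall>p\<in>underS m p'. large (\<chi> i) (Fs s i \<inter> (A (Fs s i, i) p - A (Fs s i, i) p')))"
    if "i \<in> Field \<kappa>" for i
    using A goods[OF that] that unfolding pool_def by (metis fst_conv snd_conv)
  have C_K: "C s i \<in> K" if i: "i \<in> Field \<kappa>" for i
    unfolding C[of s i] using pl[OF i] P_m[OF s[OF i]] by (intro K_Diff) auto
  have V_large: "large (\<chi> i) (V s i)" if i: "i \<in> Field \<kappa>" for i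
    unfolding V_def C[of s i] using pl[OF i] s[OF i] unfolding P_def by blast
  have Z_large: "large (\<chi> i) (Z s i)" if i: "i \<in> Field \<kappa>" for i
  proof (rule ccontr)
    assume nl: "\<not> large (\<chi> i) (Z s i)"
    have Zs': "Z s' i = Z s i"
    proof -
      have "(\<Union>k\<in>{k. i \<in> underS \<kappa> k}. C s' k) = (\<Union>k\<in>{k. i \<in> underS \<kappa> k}. C s k)"
        by (rule SUP_cong) (use Cs' underS_in_Field in fast)+
      then show ?thesis unfolding Z_def V_def using Cs'[OF i] Fs'[of i] by simp
    qed
    have "gen (V s i, i) (e (V s i, i))" using e by blast
    then have ge: "e (V s i, i) \<in> V s i" "\<forall>t\<in>?Fam. \<not> large (\<chi> i) (Z t i) \<longrightarrow> e (V s i, i) \<notin> Z t i"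
      using V_large[OF i] i unfolding gen_def by simp_all
    have "e (V s i, i) \<notin> Z s i" using ge(2) s'Fam nl Zs' by metis
    then obtain k where k: "i \<in> underS \<kappa> k" "e (V s i, i) \<in> C s k" using ge(1) unfolding Z_def by blast
    then show False using P_C[OF s, of k] underS_in_Field[OF k(1)] by blast
  qed
  obtain Y where "cl Y \<subseteq> Y" "\<forall>j\<in>Field \<kappa>. thick (\<chi> j) Y"
  proof (rule thick_closed_if_separated_blocks[of "C s" "Z s"])
    show "C s i \<in> K" if "i \<in> Field \<kappa>" for i by (rule C_K[OF that])
    show "large (\<chi> i) (Z s i)" if "i \<in> Field \<kappa>" for i by (rule Z_large[OF that])
    show "Z s i \<subseteq> C s i" if "i \<in> Field \<kappa>" for i unfolding Z_def V_def by blast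
    show "Z s i \<inter> C s j = {}" if ij: "i \<in> Field \<kappa>" "j \<in> Field \<kappa>" "i \<noteq> j" for i j
      using underS_total[OF wo ij]
    proof
      assume "i \<in> underS \<kappa> j"
      then show ?thesis unfolding Z_def by blast
    next
      assume "j \<in> underS \<kappa> i"
      then show ?thesis unfolding Z_def V_def Fs_def by blast
    qed
  qed
  then show thesis by (rule that)
qed

theorem thick_closed_exists:
  fixes m :: "'m rel"
  assumes m: "Cinfinite m" "|Func (Field \<kappa>) (Field m \<times> Field m)| \<le>o m" "|Pow (Field \<kappa>)| <o m"
    and kap_m: "|Field \<kappa>| \<le>o m"
    and m_chi: "\<And>i. i \<in> Field \<kappa> \<Longrightarrow> m <o \<chi> i"
    and X: "\<And>j. j \<in> Field \<kappa> \<Longrightarrow> large (\<chi> j) X"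
  obtains Y where "cl Y \<subseteq> Y" "\<forall>j\<in>Field \<kappa>. thick (\<chi> j) Y"
proof (cases "\<exists>F i. good F \<and> i \<in> Field \<kappa> \<and>
      (\<forall>j\<in>Field \<kappa>. large (\<chi> j) (small_points i F))")
  case True
  then obtain F i where F: "good F" "i \<in> Field \<kappa>"
    "\<forall>j\<in>Field \<kappa>. large (\<chi> j) (small_points i F)" by (elim exE conjE)
  have FX: "F \<subseteq> X" using F(1) unfolding good_def by blast
  show thesis by (rule thick_closed_if_locally_small[OF F(2) FX bspec[OF F(3)] that])
next
  case False
  have neg: "\<exists>j\<in>Field \<kappa>. \<not> large (\<chi> j) (small_points i F)"
    if Fi: "good F" "i \<in> Field \<kappa>" for F i
  proof (rule ccontr)
    assume "\<not> ?thesis"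
    then have "\<forall>j\<in>Field \<kappa>. large (\<chi> j) (small_points i F)" by simp
    then have "\<exists>F i. good F \<and> i \<in> Field \<kappa> \<and> (\<forall>j\<in>Field \<kappa>. large (\<chi> j) (small_points i F))"
      using Fi by (intro exI[of _ F] exI[of _ i] conjI)
    then show False by (rule notE[OF False])
  qed
  show thesis by (rule thick_closed_if_not_locally_small[OF m kap_m m_chi X neg that])
qed

end

section \<open>The Stone space of a Boolean algebra\<close>

definition clopen :: "'a gorder \<Rightarrow> 'a \<Rightarrow> 'a set set" where
  "clopen B b = {F \<in> ultrafilters B. b \<in> F}"

locale boolean_gorder = boolean_lattice B for B :: "'a gorder" (structure)
begin

lemma meet_split:
  assumes "z \<in> carrier B" "x \<in> carrier B" "y \<in> carrier B" "x \<squnion> y = \<top>" "z \<sqinter> x = \<bottom>" "z \<sqinter> y = \<bottom>"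
  shows "z = \<bottom>"
proof -
  have "z = z \<sqinter> \<top>" using le_iff_join[OF assms(1) top_closed] top_higher assms(1) by blast
  also have "\<dots> = (z \<sqinter> x) \<squnion> (z \<sqinter> y)"
    using meet_join_distrib[OF assms(1-3)] assms(4) by simp
  also have "\<dots> = \<bottom>"
    using assms(5,6) le_iff_meet[OF bottom_closed bottom_closed] bottom_lower[OF bottom_closed] by simp
  finally show ?thesis .
qed

lemma le_bottom: "x \<in> carrier B \<Longrightarrow> x \<sqsubseteq> \<bottom> \<Longrightarrow> x = \<bottom>"
  using le_antisym[of x \<bottom>] bottom_lower by blast

text \<open>A maximal extension of \<open>S\<close> in which finite subsets have nonzero lower bounds is an ultrafilter. It contains
  every element above a finite subset of it; if \<open>x\<close> and a complement \<open>y\<close> were both missing, there would be finite subsets whose lower bounds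
  are disjoint from \<open>x\<close> and from \<open>y\<close>, and then \<open>meet_split\<close> makes a common lower bound zero.\<close>

lemma ultrafilter_exists:
  assumes S: "S \<subseteq> carrier B"
    and fip: "\<And>w. finite w \<Longrightarrow> w \<subseteq> S \<Longrightarrow> \<exists>x\<in>carrier B. x \<noteq> \<bottom> \<and> (\<forall>y\<in>w. x \<sqsubseteq> y)"
  shows "\<exists>F\<in>ultrafilters B. S \<subseteq> F"
proof -
  define fp where "fp M \<longleftrightarrow> (\<forall>w. finite w \<longrightarrow> w \<subseteq> M \<longrightarrow> (\<exists>x\<in>carrier B. x \<noteq> \<bottom> \<and> (\<forall>y\<in>w. x \<sqsubseteq> y)))" for M
  let ?A = "{M. S \<subseteq> M \<and> M \<subseteq> carrier B \<and> fp M}"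
  have "\<exists>M\<in>?A. \<forall>N\<in>?A. M \<subseteq> N \<longrightarrow> N = M"
  proof (rule subset_Zorn_nonempty)
    have "fp S" unfolding fp_def using fip by blast
    then show "?A \<noteq> {}" using S by blast
    fix C assume C: "C \<noteq> {}" "subset.chain ?A C"
    have CA: "C \<subseteq> ?A" using C(2) unfolding subset.chain_def by blast
    have "fp (\<Union>C)"
      unfolding fp_def
    proof (intro allI impI)
      fix w assume w: "finite w" "w \<subseteq> \<Union>C"
      obtain M where M: "M \<in> C" "w \<subseteq> M"
        by (rule finite_subset_Union_chain[OF w(1,2) C(1)]) (use C(2) in \<open>auto simp: subset.chain_def subset_chain_def\<close>)
      then have "fp M" using CA by blast
      then show "\<exists>x\<in>carrier B. x \<noteq> \<bottom> \<and> (\<forall>y\<in>w. x \<sqsubseteq> y)" using w(1) M(2) unfolding fp_def by blast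
    qed
    moreover have "S \<subseteq> \<Union>C" using CA C(1) by blast
    moreover have "\<Union>C \<subseteq> carrier B" using CA by blast
    ultimately show "\<Union>C \<in> ?A" by simp
  qed
  then obtain M where MA: "M \<in> ?A" and max': "\<forall>N\<in>?A. M \<subseteq> N \<longrightarrow> N = M" by (elim bexE)
  have M: "S \<subseteq> M" "M \<subseteq> carrier B" "fp M" using MA by simp_all
  note fpM = M(3)[unfolded fp_def, rule_format]
  have ext: "x \<in> M" if x: "x \<in> carrier B" "fp (insert x M)" for x
  proof -
    have "insert x M \<in> ?A" using M x by auto
    then have "insert x M = M" using bspec[OF max'] by (simp add: subset_insertI)
    then show ?thesis by blast
  qed
  have ext': "x \<in> M" if x: "x \<in> carrier B" and v: "finite v" "v \<subseteq> M"
    "\<And>z. z \<in> carrier B \<Longrightarrow> \<forall>y\<in>v. z \<sqsubseteq> y \<Longrightarrow> z \<sqsubseteq> x" for x v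
  proof (rule ext[OF x], unfold fp_def, intro allI impI)
    fix w assume w: "finite w" "w \<subseteq> insert x M"
    have fin: "finite ((w - {x}) \<union> v)" "(w - {x}) \<union> v \<subseteq> M" using w v by auto
    obtain z where z1: "z \<in> carrier B" and z2: "z \<noteq> \<bottom> \<and> (\<forall>y\<in>(w - {x}) \<union> v. z \<sqsubseteq> y)"
      by (rule bexE[OF fpM[OF fin]])
    note z = z1 conjunct1[OF z2] conjunct2[OF z2]
    have "z \<sqsubseteq> x" by (rule v(3)[OF z(1)]) (use z(3) in simp)
    then have "\<forall>y\<in>w. z \<sqsubseteq> y" using z(3) by blast
    then show "\<exists>x\<in>carrier B. x \<noteq> \<bottom> \<and> (\<forall>y\<in>w. x \<sqsubseteq> y)" using z by blast
  qed
  have "M \<in> ultrafilters B"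
    unfolding ultrafilters_def
  proof (intro CollectI conjI ballI impI)
    show "M \<subseteq> carrier B" by (rule M(2))
    show "\<top> \<in> M" by (rule ext'[of _ "{}"]) auto
    show "\<bottom> \<notin> M"
    proof
      assume "\<bottom> \<in> M"
      then obtain z where "z \<in> carrier B" "z \<noteq> \<bottom>" "z \<sqsubseteq> \<bottom>"
        using fpM[of "{\<bottom>}"] by auto
      then show False using le_bottom by blast
    qed
    show "x \<sqinter> y \<in> M" if xy: "x \<in> M" "y \<in> M" for x y
    proof -
      have "x \<in> carrier B" "y \<in> carrier B" using xy M(2) by blast+
      then show ?thesis by (intro ext'[of _ "{x, y}"]) (use xy in \<open>auto intro!: meet_le\<close>)
    qed
    show "y \<in> M" if "x \<in> M" "y \<in> carrier B" "x \<sqsubseteq> y" for x y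
      by (rule ext'[of _ "{x}"]) (use that M(2) in \<open>auto intro: le_trans\<close>)
    fix x y assume x: "x \<in> carrier B" and y: "y \<in> carrier B" and xy: "x \<squnion> y = \<top> \<and> x \<sqinter> y = \<bottom>"
    show "x \<in> M \<or> y \<in> M"
    proof (rule ccontr)
      assume neg: "\<not> (x \<in> M \<or> y \<in> M)"
      have "\<exists>w. finite w \<and> w \<subseteq> M \<and> (\<forall>z\<in>carrier B. (\<forall>y\<in>w. z \<sqsubseteq> y) \<longrightarrow> z \<sqinter> x = \<bottom>)"
        if x: "x \<in> carrier B" "x \<notin> M" for x
      proof -
        have "\<not> fp (insert x M)" using ext x by blast
        then obtain w where w: "finite w" "w \<subseteq> insert x M" "\<not> (\<exists>z\<in>carrier B. z \<noteq> \<bottom> \<and> (\<forall>y\<in>w. z \<sqsubseteq> y))"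
          unfolding fp_def by blast
        have "z \<sqinter> x = \<bottom>" if z: "z \<in> carrier B" "\<forall>y\<in>w - {x}. z \<sqsubseteq> y" for z
        proof (rule ccontr)
          assume nz: "z \<sqinter> x \<noteq> \<bottom>"
          have zx: "z \<sqinter> x \<in> carrier B" using z x by simp
          have "z \<sqinter> x \<sqsubseteq> y" if y: "y \<in> w" for y
          proof (cases "y = x")
            case True
            then show ?thesis using meet_right z x by simp
          next
            case False
            then have "z \<sqsubseteq> y" "y \<in> carrier B" using z(2) y w(2) M(2) by auto
            then show ?thesis using le_trans[OF meet_left[OF z(1) x(1)]] zx z(1) by blast
          qed
          then show False using w(3) nz zx by blast
        qed
        moreover have "finite (w - {x})" "w - {x} \<subseteq> M" using w by auto
        ultimately show ?thesis by blast
      qed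
      from this[OF x] this[OF y] neg obtain v w where v: "finite v" "v \<subseteq> M" "\<forall>z\<in>carrier B. (\<forall>y\<in>v. z \<sqsubseteq> y) \<longrightarrow> z \<sqinter> x = \<bottom>"
        and w: "finite w" "w \<subseteq> M" "\<forall>z\<in>carrier B. (\<forall>y\<in>w. z \<sqsubseteq> y) \<longrightarrow> z \<sqinter> y = \<bottom>" by blast
      have fin: "finite (v \<union> w)" "v \<union> w \<subseteq> M" using v w by auto
      obtain z where z1: "z \<in> carrier B" and z2: "z \<noteq> \<bottom> \<and> (\<forall>y\<in>v \<union> w. z \<sqsubseteq> y)"
        by (rule bexE[OF fpM[OF fin]])
      note z = z1 conjunct1[OF z2] conjunct2[OF z2]
      have "z \<sqinter> x = \<bottom>" "z \<sqinter> y = \<bottom>" using v(3) w(3) z by simp_all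
      then show False using meet_split[OF z(1) x y] xy z(2) by blast
    qed
  qed
  then show ?thesis using M(1) by blast
qed

lemma ultrafilterD:
  assumes "F \<in> ultrafilters B"
  shows "F \<subseteq> carrier B" "\<top> \<in> F" "\<bottom> \<notin> F"
    "\<And>x y. x \<in> F \<Longrightarrow> y \<in> F \<Longrightarrow> x \<sqinter> y \<in> F"
    "\<And>x y. x \<in> F \<Longrightarrow> y \<in> carrier B \<Longrightarrow> x \<sqsubseteq> y \<Longrightarrow> y \<in> F"
    "\<And>x y. x \<in> carrier B \<Longrightarrow> y \<in> carrier B \<Longrightarrow> x \<squnion> y = \<top> \<Longrightarrow> x \<sqinter> y = \<bottom> \<Longrightarrow> x \<in> F \<or> y \<in> F"
  using assms unfolding ultrafilters_def by auto

lemma clopen_meet: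
  assumes "x \<in> carrier B" "y \<in> carrier B"
  shows "clopen B (x \<sqinter> y) = clopen B x \<inter> clopen B y"
proof -
  have "x \<sqinter> y \<in> F \<longleftrightarrow> x \<in> F \<and> y \<in> F" if F: "F \<in> ultrafilters B" for F
    using ultrafilterD(4,5)[OF F] assms meet_left[OF assms] meet_right[OF assms] by blast
  then show ?thesis unfolding clopen_def by auto
qed

lemma clopen_complement:
  assumes "x \<in> carrier B" "y \<in> carrier B" "x \<squnion> y = \<top>" "x \<sqinter> y = \<bottom>"
  shows "clopen B y = ultrafilters B - clopen B x"
proof -
  have "y \<in> F \<longleftrightarrow> x \<notin> F" if F: "F \<in> ultrafilters B" for F
    using ultrafilterD(3,4,6)[OF F] assms by metis
  then show ?thesis unfolding clopen_def by auto
qed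

lemma clopen_join:
  assumes x: "x \<in> carrier B" and y: "y \<in> carrier B"
  shows "clopen B (x \<squnion> y) = clopen B x \<union> clopen B y"
proof -
  have "x \<squnion> y \<in> F \<longleftrightarrow> x \<in> F \<or> y \<in> F" if F: "F \<in> ultrafilters B" for F
  proof
    assume xy: "x \<squnion> y \<in> F"
    show "x \<in> F \<or> y \<in> F"
    proof (rule ccontr)
      assume neg: "\<not> (x \<in> F \<or> y \<in> F)"
      obtain x' where x': "x' \<in> carrier B" "x \<squnion> x' = \<top>" "x \<sqinter> x' = \<bottom>" using complement_exists[OF x] by blast
      obtain y' where y': "y' \<in> carrier B" "y \<squnion> y' = \<top>" "y \<sqinter> y' = \<bottom>" using complement_exists[OF y] by blast
      let ?z = "x' \<sqinter> y'"
      have zc: "?z \<in> carrier B" using x' y' by simp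
      have "?z \<in> F" using neg ultrafilterD(4,6)[OF F] x x' y y' by blast
      then have "?z \<sqinter> (x \<squnion> y) \<in> F" using xy ultrafilterD(4)[OF F] by blast
      then have "(?z \<sqinter> x) \<squnion> (?z \<sqinter> y) \<in> F" using meet_join_distrib[OF zc x y] by simp
      moreover have "?z \<sqinter> x = \<bottom>"
      proof (rule le_bottom)
        have "?z \<sqinter> x \<sqsubseteq> x \<sqinter> x'"
          by (intro meet_le) (use x x' y' zc meet_right[OF zc x] le_trans[OF meet_left[OF zc x] meet_left[OF x'(1) y'(1)]] in auto)
        then show "?z \<sqinter> x \<sqsubseteq> \<bottom>" using x'(3) by simp
      qed (use zc x in simp)
      moreover have "?z \<sqinter> y = \<bottom>"
      proof (rule le_bottom)
        have "?z \<sqinter> y \<sqsubseteq> y \<sqinter> y'"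
          by (intro meet_le) (use y x' y' zc meet_right[OF zc y] le_trans[OF meet_left[OF zc y] meet_right[OF x'(1) y'(1)]] in auto)
        then show "?z \<sqinter> y \<sqsubseteq> \<bottom>" using y'(3) by simp
      qed (use zc y in simp)
      ultimately have "\<bottom> \<in> F"
        using le_iff_meet[OF bottom_closed bottom_closed] bottom_lower[OF bottom_closed] by simp
      then show False using ultrafilterD(3)[OF F] by blast
    qed
  next
    assume "x \<in> F \<or> y \<in> F"
    then show "x \<squnion> y \<in> F" using ultrafilterD(5)[OF F] join_left[OF x y] join_right[OF x y] x y join_closed by blast
  qed
  then show ?thesis unfolding clopen_def by auto
qed

lemma clopen_top: "clopen B \<top> = ultrafilters B"
proof -
  have "\<top> \<in> F" if "F \<in> ultrafilters B" for F by (rule ultrafilterD(2)[OF that])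
  then show ?thesis unfolding clopen_def by blast
qed

lemma clopen_nonempty:
  assumes "b \<in> carrier B" "b \<noteq> \<bottom>" shows "clopen B b \<noteq> {}"
proof -
  have "\<exists>F\<in>ultrafilters B. {b} \<subseteq> F"
  proof (rule ultrafilter_exists)
    fix w assume "w \<subseteq> {b}"
    then have "\<forall>y\<in>w. b \<sqsubseteq> y" using le_refl[OF assms(1)] by blast
    then show "\<exists>x\<in>carrier B. x \<noteq> \<bottom> \<and> (\<forall>y\<in>w. x \<sqsubseteq> y)" using assms by blast
  qed (use assms in simp)
  then show ?thesis unfolding clopen_def by auto
qed

lemma clopen_bottom: "clopen B \<bottom> = {}"
proof -
  have "\<bottom> \<notin> F" if "F \<in> ultrafilters B" for F by (rule ultrafilterD(3)[OF that])
  then show ?thesis unfolding clopen_def by blast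
qed

lemma clopen_subset_iff:
  assumes b: "b \<in> carrier B" and c: "c \<in> carrier B"
  shows "clopen B b \<subseteq> clopen B c \<longleftrightarrow> b \<sqsubseteq> c"
proof
  assume "b \<sqsubseteq> c"
  then have "c \<in> F" if "F \<in> ultrafilters B" "b \<in> F" for F
    using ultrafilterD(5)[OF that(1,2) c] by simp
  then show "clopen B b \<subseteq> clopen B c" unfolding clopen_def by blast
next
  assume sub: "clopen B b \<subseteq> clopen B c"
  obtain c' where c': "c' \<in> carrier B" "c \<squnion> c' = \<top>" "c \<sqinter> c' = \<bottom>" using complement_exists[OF c] by blast
  have "clopen B (b \<sqinter> c') = {}"
    using sub clopen_meet[OF b c'(1)] clopen_complement[OF c c'] by blast
  then have bc': "b \<sqinter> c' = \<bottom>" using clopen_nonempty[OF meet_closed[OF b c'(1)]] by blast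
  have "b = b \<sqinter> \<top>" using le_iff_join[OF b top_closed] top_higher b by blast
  also have "\<dots> = (b \<sqinter> c) \<squnion> (b \<sqinter> c')" using meet_join_distrib[OF b c c'(1)] c'(2) by simp
  also have "\<dots> = b \<sqinter> c"
  proof -
    have "b \<sqinter> c \<in> carrier B" using b c by simp
    then show ?thesis
      using bc' le_iff_meet[of \<bottom> "b \<sqinter> c"] bottom_lower join_comm[of B "b \<sqinter> c" \<bottom>] by auto
  qed
  finally show "b \<sqsubseteq> c" using le_iff_join[OF b c] by blast
qed

lemma Sup_empty: "\<Squnion>{} = \<bottom>"
  unfolding sup_def bottom_def Upper_def by simp

lemma le_Sup_iff:
  assumes x: "x \<in> carrier B" and w: "finite w" "w \<subseteq> carrier B"
  shows "x \<sqsubseteq> \<Squnion>w \<longleftrightarrow> clopen B x \<subseteq> \<Union>(clopen B ` w)"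
proof -
  have "clopen B (\<Squnion>w) = \<Union>(clopen B ` w) \<and> \<Squnion>w \<in> carrier B"
  proof (cases "w = {}")
    case True
    then show ?thesis using Sup_empty clopen_bottom by simp
  next
    case False
    have least: "least B (\<Squnion>w) (Upper B w)" by (rule finite_sup_least[OF w False])
    have sc: "\<Squnion>w \<in> carrier B" by (rule finite_sup_closed[OF w False])
    have ub: "y \<sqsubseteq> \<Squnion>w" if "y \<in> w" for y
      using least_Upper_above[OF least that] w by blast
    obtain u where u: "u \<in> carrier B" "\<forall>y\<in>w. y \<sqsubseteq> u" "clopen B u \<subseteq> \<Union>(clopen B ` w)"
    proof -
      have "\<exists>u\<in>carrier B. (\<forall>y\<in>w. y \<sqsubseteq> u) \<and> clopen B u \<subseteq> \<Union>(clopen B ` w)"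
        using w
      proof (induction w rule: finite_induct)
        case empty
        then show ?case using clopen_bottom by auto
      next
        case (insert y w)
        then obtain u where u: "u \<in> carrier B" "\<forall>y\<in>w. y \<sqsubseteq> u" "clopen B u \<subseteq> \<Union>(clopen B ` w)" by auto
        have y: "y \<in> carrier B" using insert by simp
        have "z \<sqsubseteq> y \<squnion> u" if "z \<in> insert y w" for z
          using that join_left[OF y u(1)] le_trans[OF _ join_right[OF y u(1)], of z] u insert.prems join_closed[OF y u(1)] by auto
        moreover have "clopen B (y \<squnion> u) \<subseteq> \<Union>(clopen B ` insert y w)" using clopen_join[OF y u(1)] u(3) by auto
        ultimately show ?case using join_closed[OF y u(1)] by blast
      qed
      then show thesis using that by blast
    qed
    have "\<Squnion>w \<sqsubseteq> u" by (rule least_le[OF least]) (use u in \<open>auto simp: Upper_def\<close>)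
    then have "clopen B (\<Squnion>w) \<subseteq> \<Union>(clopen B ` w)" using clopen_subset_iff[OF sc u(1)] u(3) by blast
    moreover have "\<Union>(clopen B ` w) \<subseteq> clopen B (\<Squnion>w)"
      using clopen_subset_iff[OF _ sc] ub w(2) by blast
    ultimately show ?thesis using sc by blast
  qed
  then show ?thesis using clopen_subset_iff[OF x, of "\<Squnion>w"] by simp
qed

lemma ultrafilters_clopen: "ultrafilters B \<in> clopen B ` carrier B"
  by (rule subst[OF clopen_top, of "\<lambda>u. u \<in> clopen B ` carrier B"]) (rule imageI[OF top_closed])

lemma clopen_Diff:
  assumes x: "x \<in> carrier B" and y: "y \<in> carrier B"
  obtains z where "z \<in> carrier B" "clopen B z = clopen B x - clopen B y"
proof -
  obtain y' where y': "y' \<in> carrier B" "y \<squnion> y' = \<top>" "y \<sqinter> y' = \<bottom>" using complement_exists[OF y] by blast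
  have "clopen B x \<subseteq> ultrafilters B" unfolding clopen_def by blast
  then have "clopen B (x \<sqinter> y') = clopen B x - clopen B y"
    unfolding clopen_meet[OF x y'(1)] clopen_complement[OF y y'] by blast
  then show thesis by (rule that[OF meet_closed[OF x y'(1)]])
qed

lemma stone_compact:
  assumes S: "S \<subseteq> clopen B ` carrier B"
    and fip: "\<And>w. finite w \<Longrightarrow> w \<subseteq> S \<Longrightarrow> ultrafilters B \<inter> \<Inter>w \<noteq> {}"
  shows "ultrafilters B \<inter> \<Inter>S \<noteq> {}"
proof -
  obtain S0 where S0: "S0 \<subseteq> carrier B" "S = clopen B ` S0" using S by (rule subset_imageE)
  have "\<exists>F\<in>ultrafilters B. S0 \<subseteq> F"
  proof (rule ultrafilter_exists[OF S0(1)])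
    fix w assume w: "finite w" "w \<subseteq> S0"
    have "ultrafilters B \<inter> \<Inter>(clopen B ` w) \<noteq> {}" by (rule fip) (use w S0 in auto)
    then obtain F where F: "F \<in> ultrafilters B" "w \<subseteq> F" unfolding clopen_def by blast
    have "\<exists>x\<in>F. \<forall>y\<in>w. x \<sqsubseteq> y"
      using w(1) F(2)
    proof (induction w rule: finite_induct)
      case empty
      then show ?case using ultrafilterD(2)[OF F(1)] by blast
    next
      case (insert y w)
      then obtain x where x: "x \<in> F" "\<forall>y\<in>w. x \<sqsubseteq> y" by auto
      have yF: "y \<in> F" using insert by simp
      have c: "x \<in> carrier B" "y \<in> carrier B" using x yF ultrafilterD(1)[OF F(1)] by auto
      have "x \<sqinter> y \<sqsubseteq> z" if "z \<in> insert y w" for z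
      proof (cases "z = y")
        case True
        then show ?thesis using meet_right[OF c] by simp
      next
        case False
        then have "x \<sqsubseteq> z" "z \<in> carrier B" using that x(2) insert.prems ultrafilterD(1)[OF F(1)] by auto
        then show ?thesis using le_trans[OF meet_left[OF c]] c meet_closed by blast
      qed
      then show ?case using ultrafilterD(4)[OF F(1) x(1) yF] by blast
    qed
    then obtain x where "x \<in> F" "\<forall>y\<in>w. x \<sqsubseteq> y" by blast
    moreover have "x \<noteq> \<bottom>" using ultrafilterD(3)[OF F(1)] \<open>x \<in> F\<close> by blast
    ultimately show "\<exists>x\<in>carrier B. x \<noteq> \<bottom> \<and> (\<forall>y\<in>w. x \<sqsubseteq> y)" using ultrafilterD(1)[OF F(1)] by blast
  qed
  then obtain F where F: "F \<in> ultrafilters B" "S0 \<subseteq> F" by blast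
  then have "F \<in> ultrafilters B \<inter> \<Inter>S" unfolding S0(2) clopen_def by blast
  then show "ultrafilters B \<inter> \<Inter>S \<noteq> {}" by blast
qed

sublocale stone: compact_clopen_base "ultrafilters B" "clopen B ` carrier B"
proof (rule compact_clopen_base.intro)
  fix b assume "b \<in> clopen B ` carrier B"
  then show "b \<subseteq> ultrafilters B" unfolding clopen_def by blast
next
  fix b c assume "b \<in> clopen B ` carrier B" "c \<in> clopen B ` carrier B"
  then obtain x y where xy: "x \<in> carrier B" "b = clopen B x" "y \<in> carrier B" "c = clopen B y"
    by (elim imageE)
  obtain z where z: "z \<in> carrier B" "clopen B z = clopen B x - clopen B y"
    by (rule clopen_Diff[OF xy(1,3)])
  show "b - c \<in> clopen B ` carrier B" unfolding xy(2,4) z(2)[symmetric] by (rule imageI[OF z(1)])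
qed (rule ultrafilters_clopen, rule stone_compact)

end

section \<open>Left-separated sequences as sequences of ultrafilters\<close>

context boolean_gorder
begin

text \<open>Together with the converse \<open>left_separated_points\<close>, which is compactness, this turns a left-separated
  sequence of elements into ultrafilters \<open>pt i\<close> that contain \<open>a i\<close> and no later entry.\<close>

lemma left_separatedI:
  assumes a: "a \<in> Field r \<rightarrow> carrier B"
    and pt: "\<And>i. i \<in> Field r \<Longrightarrow> pt i \<in> clopen B (a i)"
      "\<And>i j. i \<in> Field r \<Longrightarrow> j \<in> aboveS r i \<Longrightarrow> pt i \<notin> clopen B (a j)"
  shows "left_separated B r a"
  unfolding left_separated_def
proof (intro conjI ballI allI impI)
  show "a \<in> Field r \<rightarrow> carrier B" by (rule a)
  fix i w assume i: "i \<in> Field r" and w: "finite w \<and> w \<subseteq> aboveS r i"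
  have wF: "w \<subseteq> Field r" using w by (auto simp: aboveS_def Field_def)
  have ac: "a i \<in> carrier B" using a i by auto
  have aw: "finite (a ` w)" "a ` w \<subseteq> carrier B" using w wF a by auto
  have "\<not> clopen B (a i) \<subseteq> \<Union>(clopen B ` a ` w)"
  proof
    assume "clopen B (a i) \<subseteq> \<Union>(clopen B ` a ` w)"
    then obtain j where "j \<in> w" "pt i \<in> clopen B (a j)" using pt(1)[OF i] by blast
    then show False using pt(2)[OF i] w by blast
  qed
  then show "\<not> a i \<sqsubseteq> \<Squnion>(a ` w)" using le_Sup_iff[OF ac aw] by simp
qed

lemma left_separated_points:
  assumes "left_separated B r a"
  obtains pt where "\<And>i. i \<in> Field r \<Longrightarrow> pt i \<in> clopen B (a i)"
    "\<And>i j. i \<in> Field r \<Longrightarrow> j \<in> aboveS r i \<Longrightarrow> pt i \<notin> clopen B (a j)"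
proof -
  have a: "a i \<in> carrier B" if "i \<in> Field r" for i
    using assms that unfolding left_separated_def by auto
  have sep: "\<not> a i \<sqsubseteq> \<Squnion>(a ` w)" if "i \<in> Field r" "finite w" "w \<subseteq> aboveS r i" for i w
    using assms that unfolding left_separated_def by blast
  have aF: "aboveS r i \<subseteq> Field r" for i by (auto simp: aboveS_def Field_def)
  have "\<forall>i\<in>Field r. \<exists>F. F \<in> clopen B (a i) \<and> (\<forall>j\<in>aboveS r i. F \<notin> clopen B (a j))"
  proof
    fix i assume i: "i \<in> Field r"
    let ?c = "\<lambda>j. ultrafilters B - clopen B (a j)"
    let ?S = "insert (clopen B (a i)) (?c ` aboveS r i)"
    have "ultrafilters B \<inter> \<Inter>?S \<noteq> {}"
    proof (rule stone_compact)
      have "?c j \<in> clopen B ` carrier B" if "j \<in> aboveS r i" for j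
        by (rule stone.K_Diff[OF ultrafilters_clopen]) (use a aF that in blast)
      then show "?S \<subseteq> clopen B ` carrier B" using a[OF i] by blast
      fix w assume w: "finite w" "w \<subseteq> ?S"
      have "w - {clopen B (a i)} \<subseteq> ?c ` aboveS r i" using w(2) by blast
      then obtain v where v: "v \<subseteq> aboveS r i" "finite v" "w - {clopen B (a i)} = ?c ` v"
        using finite_subset_image[of "w - {clopen B (a i)}" ?c "aboveS r i"] w(1) by auto
      have av: "a ` v \<subseteq> carrier B" using a aF v(1) by blast
      have "\<not> clopen B (a i) \<subseteq> \<Union>(clopen B ` a ` v)"
        using le_Sup_iff[OF a[OF i] finite_imageI[OF v(2)] av] sep[OF i v(2,1)] by simp
      then obtain F where F: "F \<in> clopen B (a i)" "\<forall>j\<in>v. F \<notin> clopen B (a j)" by blast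
      have FU: "F \<in> ultrafilters B" using F(1) unfolding clopen_def by blast
      have "F \<in> c" if "c \<in> w" for c
      proof (cases "c = clopen B (a i)")
        case False
        then have "c \<in> ?c ` v" using v(3) that by blast
        then show ?thesis using F(2) FU by blast
      qed (use F(1) in simp)
      then show "ultrafilters B \<inter> \<Inter>w \<noteq> {}" using FU by blast
    qed
    then obtain F where F: "F \<in> \<Inter>?S" by blast
    have "F \<notin> clopen B (a j)" if "j \<in> aboveS r i" for j
    proof -
      have "?c j \<in> ?S" using that by (intro insertI2 imageI)
      then show ?thesis using F by blast
    qed
    moreover have "F \<in> clopen B (a i)" using F by blast
    ultimately have "F \<in> clopen B (a i) \<and> (\<forall>j\<in>aboveS r i. F \<notin> clopen B (a j))" by simp
    then show "\<exists>F. F \<in> clopen B (a i) \<and> (\<forall>j\<in>aboveS r i. F \<notin> clopen B (a j))" by (rule exI)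
  qed
  from bchoice[OF this] obtain pt where pt: "\<forall>i\<in>Field r. pt i \<in> clopen B (a i) \<and> (\<forall>j\<in>aboveS r i. pt i \<notin> clopen B (a j))"
    by (elim exE)
  show thesis by (rule that[of pt]) (use pt in blast)+
qed

text \<open>Reindexing along an order embedding keeps a sequence left-separated; thus the length may be replaced by any
  shorter one, and by an isomorphic one on another type.\<close>

lemma left_separated_initial:
  fixes p :: "'p rel" and r :: "'r rel"
  assumes a: "left_separated B r a" and wo: "Well_order p" and le: "p \<le>o r"
  obtains a' where "left_separated B p a'"
proof -
  obtain f where f: "embed p r f" using le unfolding ordLeq_def by auto
  have wr: "wo_rel p" using wo by (simp add: wo_rel_def)
  have comp: "compat p r f" using embed_compat[OF f] .
  have inj: "inj_on f (Field p)" using embed_inj_on[OF wo f] .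
  have fF: "f i \<in> Field r" if "i \<in> Field p" for i using embed_Field[OF f] that by blast
  have fa: "f j \<in> aboveS r (f i)" if "j \<in> aboveS p i" for i j
  proof -
    have ij: "(i, j) \<in> p" "i \<noteq> j" "i \<in> Field p" "j \<in> Field p" using that by (auto simp: aboveS_def Field_def)
    have "(f i, f j) \<in> r" using comp ij(1) unfolding compat_def by blast
    moreover have "f i \<noteq> f j" using inj ij unfolding inj_on_def by blast
    ultimately show ?thesis unfolding aboveS_def by auto
  qed
  obtain pt where pt: "\<And>i. i \<in> Field r \<Longrightarrow> pt i \<in> clopen B (a i)"
    "\<And>i j. i \<in> Field r \<Longrightarrow> j \<in> aboveS r i \<Longrightarrow> pt i \<notin> clopen B (a j)"
    using left_separated_points[OF a] by metis
  have "left_separated B p (\<lambda>i. a (f i))"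
  proof (rule left_separatedI[of _ _ "\<lambda>i. pt (f i)"])
    show "(\<lambda>i. a (f i)) \<in> Field p \<rightarrow> carrier B" using a fF unfolding left_separated_def by auto
    show "pt (f i) \<in> clopen B (a (f i))" if "i \<in> Field p" for i by (rule pt(1)[OF fF[OF that]])
    show "pt (f i) \<notin> clopen B (a (f j))" if "i \<in> Field p" "j \<in> aboveS p i" for i j
      by (rule pt(2)[OF fF[OF that(1)] fa[OF that(2)]])
  qed
  then show thesis by (rule that)
qed

text \<open>By regularity, fewer than \<open>c\<close> of the points have indices bounded by some \<open>k\<close>, and \<open>a k\<close> separates the
  \<open>k\<close>-th point from all of them.\<close>

lemma left_separated_imp_large:
  assumes c: "Cinfinite c" "regularCard c" and a: "left_separated B c a"
  shows "stone.large c (ultrafilters B)"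
proof -
  have wo: "Well_order c" using c card_order_on_well_order_on by blast
  obtain pt where pt: "\<And>i. i \<in> Field c \<Longrightarrow> pt i \<in> clopen B (a i)"
    "\<And>i j. i \<in> Field c \<Longrightarrow> j \<in> aboveS c i \<Longrightarrow> pt i \<notin> clopen B (a j)"
    using left_separated_points[OF a] by metis
  let ?T = "pt ` Field c"
  have TX: "?T \<subseteq> ultrafilters B" using pt(1) unfolding clopen_def by blast
  have "stone.thick c ?T"
    unfolding stone.thick_def
  proof (intro conjI allI impI notI)
    show "?T \<subseteq> ultrafilters B" by (rule TX)
    fix E assume E: "E \<subseteq> ?T" "|E| <o c" "?T \<subseteq> stone.cl E"
    obtain U where U: "U \<subseteq> Field c" "inj_on pt U" "E = pt ` U"
      using E(1) unfolding subset_image_inj by (elim exE conjE)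
    have "|U| =o |E|" by (rule card_of_ordIsoI[of pt]) (use U in \<open>simp add: bij_betw_def\<close>)
    then have "|U| <o c" using E(2) by (rule ordIso_ordLess_trans)
    then have "\<not> |U| =o c" by (rule not_ordLess_ordIso)
    then have "\<not> cofinal U c" using c(2) U(1) unfolding regularCard_def by blast
    then obtain i where i: "i \<in> Field c" "\<forall>b\<in>U. \<not> (i \<noteq> b \<and> (i, b) \<in> c)" unfolding cofinal_def by blast
    obtain k where k: "k \<in> Field c" "i \<noteq> k" "(i, k) \<in> c"
      using infinite_Card_order_limit[OF _ _ i(1)] c(1) unfolding cinfinite_def by blast
    have ik: "i \<in> underS c k" using k unfolding underS_def by blast
    have "k \<in> aboveS c b" if b: "b \<in> U" for b
    proof (cases "b = i")
      case True
      then show ?thesis using k unfolding aboveS_def by blast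
    next
      case False
      have "i \<notin> underS c b" using i(2) b unfolding underS_def by blast
      then have "b \<in> underS c i" using underS_total[OF wo, of b i] U(1) b i(1) False by blast
      then have "b \<in> underS c k" by (rule underS_trans[OF wo _ k(3)])
      then show ?thesis unfolding underS_def aboveS_def by blast
    qed
    then have miss: "pt b \<notin> clopen B (a k)" if "b \<in> U" for b using pt(2) that U(1) by blast
    have ak: "clopen B (a k) \<in> clopen B ` carrier B" using a k(1) unfolding left_separated_def by auto
    have "pt k \<in> stone.cl E" using E(3) k(1) by blast
    then have "clopen B (a k) \<inter> E \<noteq> {}" using ak pt(1)[OF k(1)] unfolding stone.cl_def by blast
    then show False using miss U(3) by blast
  qed
  then show ?thesis unfolding stone.large_def using TX by blast
qed

lemma thick_imp_left_separated:
  assumes r: "Card_order r" and T: "stone.thick r T"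
  obtains a where "left_separated B r a"
proof -
  obtain x b where xb: "\<And>i. i \<in> Field r \<Longrightarrow> x i \<in> T" "\<And>i. i \<in> Field r \<Longrightarrow> b i \<in> clopen B ` carrier B"
    "\<And>i. i \<in> Field r \<Longrightarrow> x i \<in> b i" "\<And>i j. i \<in> Field r \<Longrightarrow> j \<in> underS r i \<Longrightarrow> x j \<notin> b i"
    by (rule stone.thick_sequence[OF r T]) blast
  have "\<forall>i\<in>Field r. \<exists>y. y \<in> carrier B \<and> b i = clopen B y"
  proof
    fix i assume i: "i \<in> Field r"
    obtain y where "b i = clopen B y" "y \<in> carrier B" using xb(2)[OF i] by (elim imageE)
    then show "\<exists>y. y \<in> carrier B \<and> b i = clopen B y" by blast
  qed
  from bchoice[OF this] obtain a where a: "\<forall>i\<in>Field r. a i \<in> carrier B \<and> b i = clopen B (a i)" by (elim exE)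
  have "left_separated B r a"
  proof (rule left_separatedI[of _ _ x])
    show "a \<in> Field r \<rightarrow> carrier B" using a by blast
    show "x i \<in> clopen B (a i)" if "i \<in> Field r" for i using xb(3)[OF that] a that by simp
    show "x i \<notin> clopen B (a j)" if ij: "i \<in> Field r" "j \<in> aboveS r i" for i j
    proof -
      have "j \<in> Field r" "i \<in> underS r j" using ij(2) by (auto simp: aboveS_def underS_def Field_def)
      then show ?thesis using xb(4) a by metis
    qed
  qed
  then show thesis by (rule that)
qed

text \<open>The supremum ranges over cardinals on the type of the elements of \<open>B\<close>. Entries of a left-separated
  sequence are distinct, so its length is isomorphic to the cardinality of its range, a cardinal on that type.\<close>

lemma left_separated_ordLeq_hereditary_density:
  fixes r :: "'r rel"
  assumes r: "Card_order r" and a: "left_separated B r a"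
  shows "r \<le>o hereditary_density B"
proof -
  have wo: "Well_order r" using r by (rule card_order_on_well_order_on)
  obtain pt where pt: "\<And>i. i \<in> Field r \<Longrightarrow> pt i \<in> clopen B (a i)"
    "\<And>i j. i \<in> Field r \<Longrightarrow> j \<in> aboveS r i \<Longrightarrow> pt i \<notin> clopen B (a j)"
    using left_separated_points[OF a] by metis
  have "inj_on a (Field r)"
  proof (rule inj_onI, rule ccontr)
    fix i j assume ij: "i \<in> Field r" "j \<in> Field r" "a i = a j" "i \<noteq> j"
    then consider "j \<in> aboveS r i" | "i \<in> aboveS r j"
      using underS_total[OF wo ij(1,2,4)] unfolding underS_def aboveS_def by blast
    then show False
    proof cases
      case 1
      then show ?thesis using pt(1)[OF ij(1)] pt(2)[OF ij(1)] ij(3) by metis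
    next
      case 2
      then show ?thesis using pt(1)[OF ij(2)] pt(2)[OF ij(2)] ij(3) by metis
    qed
  qed
  then have "|Field r| =o |a ` Field r|" by (intro card_of_ordIsoI[of a]) (simp add: bij_betw_def)
  then have ri: "r =o |a ` Field r|"
    by (rule ordIso_transitive[OF ordIso_symmetric[OF card_of_Field_ordIso[OF r]]])
  let ?p = "|a ` Field r| :: 'a rel"
  have "?p \<le>o r" by (rule ordIso_imp_ordLeq[OF ordIso_symmetric[OF ri]])
  then obtain a' where "left_separated B ?p a'" by (rule left_separated_initial[OF a card_of_Well_order])
  then have "?p \<in> {\<kappa> :: 'a rel. Card_order \<kappa> \<and> (\<exists>a. left_separated B \<kappa> a)}"
    using card_of_Card_order by blast
  then have "?p \<le>o hereditary_density B" unfolding hereditary_density_def by (intro card_Sup_upper) auto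
  then show ?thesis by (rule ordIso_ordLeq_trans[OF ri])
qed

lemma left_separated_of_large_length:
  fixes c :: "'c rel"
  assumes c: "Card_order c" and less: "c <o hereditary_density B"
  obtains a where "left_separated B c a"
proof -
  let ?C = "{\<kappa> :: 'a rel. Card_order \<kappa> \<and> (\<exists>a. left_separated B \<kappa> a)}"
  have "\<exists>r\<in>?C. \<not> r \<le>o c"
  proof (rule ccontr)
    assume "\<not> ?thesis"
    then have all: "\<forall>r\<in>?C. r \<le>o c" by blast
    have "hereditary_density B \<le>o c" unfolding hereditary_density_def
    proof (rule card_Sup_least[OF _ c])
      show "Card_order r" if "r \<in> ?C" for r using that by blast
      show "r \<le>o c" if "r \<in> ?C" for r using all that by (rule bspec)
    qed
    then show False using less not_ordLess_ordLeq by blast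
  qed
  then obtain r where r0: "r \<in> ?C" "\<not> r \<le>o c" by blast
  then have "\<exists>a. left_separated B r a" by blast
  then obtain a where a: "left_separated B r a" by (rule exE)
  have r: "Card_order r" using r0(1) by blast
  have "c \<le>o r"
    using r0(2) ordLeq_total[OF card_order_on_well_order_on[OF c] card_order_on_well_order_on[OF r]] by blast
  then show thesis by (rule left_separated_initial[OF a card_order_on_well_order_on[OF c] _ that])
qed

section \<open>The Stone topology and the density invariants\<close>

lemma topspace_Ult: "topspace (Ult B) = ultrafilters B"
proof -
  have "\<Union>{{F \<in> ultrafilters B. b \<in> F} |b. b \<in> carrier B} = ultrafilters B"
    using ultrafilterD(2) top_closed by blast
  then show ?thesis unfolding Ult_def topology_generated_by_topspace .
qed

lemma openin_clopen: "b \<in> carrier B \<Longrightarrow> openin (Ult B) (clopen B b)"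
  unfolding Ult_def clopen_def by (rule topology_generated_by_Basis) blast

lemma Ult_base:
  assumes "openin (Ult B) U" "x \<in> U"
  shows "\<exists>b\<in>carrier B. x \<in> clopen B b \<and> clopen B b \<subseteq> U"
proof -
  have "generate_topology_on {{F \<in> ultrafilters B. b \<in> F} |b. b \<in> carrier B} U"
    using assms(1) unfolding Ult_def openin_topology_generated_by_iff .
  then show ?thesis using assms(2)
  proof (induction U rule: generate_topology_on.induct)
    case Empty
    then show ?case by simp
  next
    case (Int U V)
    then obtain b c where b: "b \<in> carrier B" "x \<in> clopen B b" "clopen B b \<subseteq> U"
      and c: "c \<in> carrier B" "x \<in> clopen B c" "clopen B c \<subseteq> V" by auto
    have "x \<in> clopen B (b \<sqinter> c) \<and> clopen B (b \<sqinter> c) \<subseteq> U \<inter> V"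
      unfolding clopen_meet[OF b(1) c(1)] using b c by blast
    then show ?case using meet_closed[OF b(1) c(1)] by (intro bexI)
  next
    case (UN W)
    then obtain U where U: "U \<in> W" "x \<in> U" by blast
    then obtain b where "b \<in> carrier B" "x \<in> clopen B b" "clopen B b \<subseteq> U" using UN.IH[OF U(1)] by blast
    then show ?case using U(1) by blast
  next
    case (Basis U)
    then obtain b where "b \<in> carrier B" "U = clopen B b" unfolding clopen_def by auto
    then show ?case using Basis.prems by blast
  qed
qed

text \<open>Connects the density of subspaces in the Stone topology with the closure operator of the clopen base.\<close>

lemma dense_iff:
  assumes Y: "Y \<subseteq> ultrafilters B" and D: "D \<subseteq> Y"
  shows "subtopology (Ult B) Y closure_of D = topspace (subtopology (Ult B) Y) \<longleftrightarrow> Y \<subseteq> stone.cl D"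
proof -
  have tY: "topspace (subtopology (Ult B) Y) = Y" unfolding topspace_subtopology topspace_Ult using Y by blast
  have "y \<in> subtopology (Ult B) Y closure_of D \<longleftrightarrow> y \<in> stone.cl D" if y: "y \<in> Y" for y
  proof
    assume *: "y \<in> subtopology (Ult B) Y closure_of D"
    show "y \<in> stone.cl D"
      unfolding stone.cl_def
    proof (rule CollectI, intro conjI ballI impI)
      show "y \<in> ultrafilters B" using y Y by blast
      fix b assume b: "b \<in> clopen B ` carrier B" "y \<in> b"
      then have "openin (Ult B) b" using openin_clopen by blast
      then have "openin (subtopology (Ult B) Y) (Y \<inter> b)" by (rule openin_subtopology_Int2)
      then show "b \<inter> D \<noteq> {}" using * b(2) y unfolding in_closure_of by blast
    qed
  next
    assume *: "y \<in> stone.cl D"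
    show "y \<in> subtopology (Ult B) Y closure_of D"
      unfolding in_closure_of tY
    proof (intro conjI allI impI)
      show "y \<in> Y" by (rule y)
      fix T assume T: "y \<in> T \<and> openin (subtopology (Ult B) Y) T"
      then obtain U where U: "openin (Ult B) U" "T = U \<inter> Y" unfolding openin_subtopology by blast
      then obtain b where b: "b \<in> carrier B" "y \<in> clopen B b" "clopen B b \<subseteq> U" using Ult_base[OF U(1)] T by blast
      have "clopen B b \<inter> D \<noteq> {}" using * b(1,2) unfolding stone.cl_def by blast
      then show "\<exists>z. z \<in> D \<and> z \<in> T" using U(2) b(3) D by blast
    qed
  qed
  moreover have "subtopology (Ult B) Y closure_of D \<subseteq> Y" using closure_of_subset_topspace[of "subtopology (Ult B) Y" D] tY by simp
  ultimately show ?thesis unfolding tY by blast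
qed

lemma density_subspace:
  assumes Y: "Y \<subseteq> ultrafilters B"
  shows density_Card_order: "Card_order (density (subtopology (Ult B) Y))"
    and thick_density: "stone.thick (density (subtopology (Ult B) Y)) Y"
    and density_attained: "\<exists>D\<subseteq>Y. Y \<subseteq> stone.cl D \<and> density (subtopology (Ult B) Y) = |D|"
    and density_le: "\<And>D. D \<subseteq> Y \<Longrightarrow> Y \<subseteq> stone.cl D \<Longrightarrow> density (subtopology (Ult B) Y) \<le>o |D|"
proof -
  let ?d = "density (subtopology (Ult B) Y)"
  let ?C = "{|D| |D. D \<subseteq> Y \<and> Y \<subseteq> stone.cl D}"
  have tY: "topspace (subtopology (Ult B) Y) = Y" unfolding topspace_subtopology topspace_Ult using Y by blast
  have "{|D| |D. D \<subseteq> topspace (subtopology (Ult B) Y) \<and>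
      subtopology (Ult B) Y closure_of D = topspace (subtopology (Ult B) Y)} = ?C"
  proof (rule Collect_cong)
    fix r :: "'a set rel"
    show "(\<exists>D. r = |D| \<and> D \<subseteq> topspace (subtopology (Ult B) Y) \<and>
        subtopology (Ult B) Y closure_of D = topspace (subtopology (Ult B) Y)) \<longleftrightarrow>
      (\<exists>D. r = |D| \<and> D \<subseteq> Y \<and> Y \<subseteq> stone.cl D)"
      using dense_iff[OF Y] unfolding tY by metis
  qed
  then have d: "?d = card_Min ?C" unfolding density_def by simp
  have ne: "?C \<noteq> {}" using stone.subset_cl[OF Y] by blast
  have co: "\<And>r. r \<in> ?C \<Longrightarrow> Card_order r" using card_of_Card_order by blast
  have "?d \<in> ?C" unfolding d by (rule card_Min(1)[OF ne co])
  then show att: "\<exists>D\<subseteq>Y. Y \<subseteq> stone.cl D \<and> ?d = |D|" by blast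
  then show cod: "Card_order ?d" using card_of_Card_order by metis
  show le: "?d \<le>o |D|" if "D \<subseteq> Y" "Y \<subseteq> stone.cl D" for D
  proof -
    have "|D| \<in> ?C" by (rule CollectI, rule exI[of _ D]) (simp add: that)
    show ?thesis unfolding d by (rule card_Min(2)[OF ne co], assumption, fact)
  qed
  show "stone.thick ?d Y"
    unfolding stone.thick_def
  proof (intro conjI allI impI notI)
    show "Y \<subseteq> ultrafilters B" by (rule Y)
    fix E assume E: "E \<subseteq> Y" "|E| <o ?d" "Y \<subseteq> stone.cl E"
    show False using le[OF E(1,3)] E(2) not_ordLess_ordLeq by blast
  qed
qed

lemma thick_ordLeq_density:
  assumes c: "Card_order c" and Y: "stone.thick c Y"
  shows "c \<le>o density (subtopology (Ult B) Y)"
proof -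
  have YX: "Y \<subseteq> ultrafilters B" using Y unfolding stone.thick_def by blast
  obtain D where D: "D \<subseteq> Y" "Y \<subseteq> stone.cl D" "density (subtopology (Ult B) Y) = |D|"
    using density_attained[OF YX] by blast
  have "\<not> |D| <o c" using Y D(1,2) unfolding stone.thick_def by blast
  then show ?thesis unfolding D(3) using not_ordLess_card_of[OF c] by blast
qed

lemma density_ordLeq_hereditary_density:
  assumes Y: "Y \<subseteq> ultrafilters B"
  shows "density (subtopology (Ult B) Y) \<le>o hereditary_density B"
proof -
  obtain a where "left_separated B (density (subtopology (Ult B) Y)) a"
    by (rule thick_imp_left_separated[OF density_Card_order[OF Y] thick_density[OF Y]])
  then show ?thesis by (rule left_separated_ordLeq_hereditary_density[OF density_Card_order[OF Y]])
qed

lemma topological_density_eq: "topological_density B = density (subtopology (Ult B) (ultrafilters B))"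
  unfolding topological_density_def topspace_Ult[symmetric] subtopology_topspace ..

lemma algebraic_density:
  shows algebraic_density_Card_order: "Card_order (algebraic_density B)"
    and algebraic_density_attained: "\<exists>A\<subseteq>carrier B - {\<bottom>}. (\<forall>b\<in>carrier B - {\<bottom>}. \<exists>a\<in>A. a \<sqsubseteq> b) \<and> algebraic_density B = |A|"
    and algebraic_density_le: "\<And>A. A \<subseteq> carrier B - {\<bottom>} \<Longrightarrow> \<forall>b\<in>carrier B - {\<bottom>}. \<exists>a\<in>A. a \<sqsubseteq> b \<Longrightarrow>
      algebraic_density B \<le>o |A|"
proof -
  let ?C = "{|A| |A. A \<subseteq> carrier B - {\<bottom>} \<and> (\<forall>b\<in>carrier B - {\<bottom>}. \<exists>a\<in>A. a \<sqsubseteq> b)}"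
  have "\<forall>b\<in>carrier B - {\<bottom>}. \<exists>a\<in>carrier B - {\<bottom>}. a \<sqsubseteq> b" using le_refl by blast
  then have ne: "?C \<noteq> {}" by blast
  have co: "\<And>r. r \<in> ?C \<Longrightarrow> Card_order r" using card_of_Card_order by blast
  have "algebraic_density B \<in> ?C" unfolding algebraic_density_def by (rule card_Min(1)[OF ne co])
  then show att: "\<exists>A\<subseteq>carrier B - {\<bottom>}. (\<forall>b\<in>carrier B - {\<bottom>}. \<exists>a\<in>A. a \<sqsubseteq> b) \<and> algebraic_density B = |A|" by blast
  then show "Card_order (algebraic_density B)" using card_of_Card_order by metis
  show "algebraic_density B \<le>o |A|" if "A \<subseteq> carrier B - {\<bottom>}" "\<forall>b\<in>carrier B - {\<bottom>}. \<exists>a\<in>A. a \<sqsubseteq> b" for A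
  proof -
    have "|A| \<in> ?C" by (rule CollectI, rule exI[of _ A]) (simp add: that)
    show ?thesis unfolding algebraic_density_def by (rule card_Min(2)[OF ne co], assumption, fact)
  qed
qed

lemma topological_density_ordLeq_algebraic_density: "topological_density B \<le>o algebraic_density B"
proof -
  obtain A where A: "A \<subseteq> carrier B - {\<bottom>}" "\<forall>b\<in>carrier B - {\<bottom>}. \<exists>a\<in>A. a \<sqsubseteq> b" "algebraic_density B = |A|"
    using algebraic_density_attained by blast
  have "\<forall>a\<in>A. \<exists>F. F \<in> clopen B a" using clopen_nonempty A(1) by blast
  from bchoice[OF this] obtain p where p: "\<forall>a\<in>A. p a \<in> clopen B a" by (elim exE)
  have pU: "p ` A \<subseteq> ultrafilters B" using p unfolding clopen_def by blast
  have "ultrafilters B \<subseteq> stone.cl (p ` A)"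
  proof
    fix F assume F: "F \<in> ultrafilters B"
    show "F \<in> stone.cl (p ` A)"
      unfolding stone.cl_def
    proof (rule CollectI, intro conjI ballI impI)
      show "F \<in> ultrafilters B" by (rule F)
      fix c assume "c \<in> clopen B ` carrier B" "F \<in> c"
      then obtain b where b: "b \<in> carrier B" "c = clopen B b" "F \<in> clopen B b" by blast
      have "b \<noteq> \<bottom>" using b(3) clopen_bottom by blast
      then obtain a where a: "a \<in> A" "a \<sqsubseteq> b" using A(2) b(1) by blast
      have "clopen B a \<subseteq> clopen B b" using clopen_subset_iff[of a b] a A(1) b(1) by blast
      then show "c \<inter> p ` A \<noteq> {}" using p a(1) b(2) by blast
    qed
  qed
  then have "topological_density B \<le>o |p ` A|" unfolding topological_density_eq
    by (intro density_le pU subset_refl)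
  then show ?thesis unfolding A(3) by (rule ordLeq_transitive[OF _ card_of_image])
qed

text \<open>By definition of \<open>\<pi>\<close>, fewer than \<open>\<pi>(B)\<close> nonzero elements do not suffice to have one below every nonzero element. So
  \<open>independent_sequence\<close> applies, with singletons for \<open>v\<close>.\<close>

lemma algebraic_density_left_separated:
  assumes r: "Cinfinite (algebraic_density B)"
  obtains a where "left_separated B (algebraic_density B) a"
proof -
  let ?r = "algebraic_density B" and ?Q = "clopen B ` (carrier B - {\<bottom>})" and ?X = "ultrafilters B"
  have QK: "?Q \<subseteq> clopen B ` carrier B" by blast
  have "stone.no_small_pi_base ?r ?X ?Q"
    unfolding stone.no_small_pi_base_def
  proof (intro allI impI)
    fix P assume P: "P \<subseteq> clopen B ` carrier B" "|P| <o ?r" "\<forall>u\<in>P. u \<inter> ?X \<noteq> {}"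
    obtain A where A: "A \<subseteq> carrier B" "inj_on (clopen B) A" "P = clopen B ` A"
      using P(1) unfolding subset_image_inj by (elim exE conjE)
    have "\<bottom> \<notin> A" using P(3) A(3) clopen_bottom by blast
    then have A': "A \<subseteq> carrier B - {\<bottom>}" using A(1) by blast
    have "|A| =o |P|" by (rule card_of_ordIsoI[of "clopen B"]) (use A in \<open>simp add: bij_betw_def\<close>)
    then have "|A| <o ?r" using P(2) by (rule ordIso_ordLess_trans)
    then have "\<not> ?r \<le>o |A|" by (rule not_ordLess_ordLeq)
    then have "\<not> (\<forall>b\<in>carrier B - {\<bottom>}. \<exists>a\<in>A. a \<sqsubseteq> b)" using algebraic_density_le[OF A'] by blast
    then obtain b where b: "b \<in> carrier B - {\<bottom>}" "\<forall>a\<in>A. \<not> a \<sqsubseteq> b" by blast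
    have "\<not> u \<inter> ?X \<subseteq> clopen B b" if "u \<in> P" for u
    proof -
      obtain a where a: "a \<in> A" "u = clopen B a" using \<open>u \<in> P\<close> A(3) by blast
      have "\<not> clopen B a \<subseteq> clopen B b" using clopen_subset_iff[of a b] a(1) A(1) b by blast
      moreover have "clopen B a \<subseteq> ?X" unfolding clopen_def by blast
      ultimately show ?thesis using a(2) by blast
    qed
    then show "\<exists>b\<in>?Q. \<forall>u\<in>P. \<not> u \<inter> ?X \<subseteq> b" using b(1) by blast
  qed
  then obtain b where b: "\<forall>i\<in>Field ?r. b i \<in> ?Q"
    and ind: "\<forall>v w. finite v \<longrightarrow> finite w \<longrightarrow> v \<subseteq> Field ?r \<longrightarrow> w \<subseteq> Field ?r \<longrightarrow>
      (\<forall>i\<in>v. \<forall>j\<in>w. i \<in> underS ?r j) \<longrightarrow> ?X \<inter> ?X \<inter> \<Inter>(b ` v) \<noteq> {} \<longrightarrow>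
      ?X \<inter> ?X \<inter> \<Inter>(b ` v) - \<Union>(b ` w) \<noteq> {}"
    by (rule stone.independent_sequence[OF r QK])
  have "\<forall>i\<in>Field ?r. \<exists>y. y \<in> carrier B - {\<bottom>} \<and> b i = clopen B y"
  proof
    fix i assume i: "i \<in> Field ?r"
    obtain y where "b i = clopen B y" "y \<in> carrier B - {\<bottom>}" using bspec[OF b i] by (elim imageE)
    then show "\<exists>y. y \<in> carrier B - {\<bottom>} \<and> b i = clopen B y" by blast
  qed
  from bchoice[OF this] obtain a where a: "\<forall>i\<in>Field ?r. a i \<in> carrier B - {\<bottom>} \<and> b i = clopen B (a i)" by (elim exE)
  have "left_separated B ?r a"
    unfolding left_separated_def
  proof (intro conjI ballI allI impI)
    show "a \<in> Field ?r \<rightarrow> carrier B" using a by blast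
    fix i w assume i: "i \<in> Field ?r" and w: "finite w \<and> w \<subseteq> aboveS ?r i"
    have wF: "w \<subseteq> Field ?r" using w by (auto simp: aboveS_def Field_def)
    have ai: "a i \<in> carrier B" "a i \<noteq> \<bottom>" "b i = clopen B (a i)" using a i by auto
    have "?X \<inter> ?X \<inter> \<Inter>(b ` {i}) - \<Union>(b ` w) \<noteq> {}"
    proof (rule ind[THEN spec[of _ "{i}"], THEN spec[of _ w], THEN mp, THEN mp, THEN mp, THEN mp, THEN mp, THEN mp])
      show "\<forall>i'\<in>{i}. \<forall>j\<in>w. i' \<in> underS ?r j" using w unfolding aboveS_def underS_def by blast
      have "clopen B (a i) \<subseteq> ?X" "clopen B (a i) \<noteq> {}" using clopen_nonempty ai(1,2) unfolding clopen_def by blast+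
      then show "?X \<inter> ?X \<inter> \<Inter>(b ` {i}) \<noteq> {}" using ai(3) by auto
    qed (use i w wF in auto)
    then have "\<not> clopen B (a i) \<subseteq> \<Union>(b ` w)" using ai(3) by auto
    moreover have "b ` w = (\<lambda>j. clopen B (a j)) ` w"
      by (rule image_cong[OF HOL.refl]) (use a wF in blast)
    then have "b ` w = clopen B ` a ` w" by (simp only: image_image)
    ultimately have "\<not> clopen B (a i) \<subseteq> \<Union>(clopen B ` a ` w)" by simp
    moreover have "finite (a ` w)" "a ` w \<subseteq> carrier B" using w wF a by auto
    ultimately show "\<not> a i \<sqsubseteq> \<Squnion>(a ` w)" using le_Sup_iff[OF ai(1), of "a ` w"] by simp
  qed
  then show thesis by (rule that)
qed

section \<open>Homomorphic images and closed subspaces\<close>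

lemma hom_vimage_ultrafilter:
  assumes C: "boolean_lattice C" and h: "h \<in> boolean_hom B C" and G: "G \<in> ultrafilters C"
  shows "{x \<in> carrier B. h x \<in> G} \<in> ultrafilters B"
proof -
  interpret C: boolean_gorder C using C by (rule boolean_gorder.intro)
  note G = C.ultrafilterD[OF G]
  have hc: "h x \<in> carrier C" if "x \<in> carrier B" for x using h that unfolding boolean_hom_def by auto
  have hj: "h (x \<squnion> y) = h x \<squnion>\<^bsub>C\<^esub> h y" if "x \<in> carrier B" "y \<in> carrier B" for x y
    using h that unfolding boolean_hom_def join_pres_def by blast
  have hm: "h (x \<sqinter> y) = h x \<sqinter>\<^bsub>C\<^esub> h y" if "x \<in> carrier B" "y \<in> carrier B" for x y
    using h that unfolding boolean_hom_def meet_pres_def by blast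
  have hb: "h \<bottom> = \<bottom>\<^bsub>C\<^esub>" "h \<top> = \<top>\<^bsub>C\<^esub>" using h unfolding boolean_hom_def by blast+
  show ?thesis
    unfolding ultrafilters_def
  proof (intro CollectI conjI ballI impI)
    show "{x \<in> carrier B. h x \<in> G} \<subseteq> carrier B" by blast
    show "\<top> \<in> carrier B" by (rule top_closed)
    show "h \<top> \<in> G" unfolding hb by (rule G(2))
    show "\<bottom> \<notin> {x \<in> carrier B. h x \<in> G}" using G(3) hb(1) by simp
  next
    fix x y assume xy: "x \<in> {x \<in> carrier B. h x \<in> G}" "y \<in> {x \<in> carrier B. h x \<in> G}"
    then show "x \<sqinter> y \<in> carrier B" using meet_closed by blast
    show "h (x \<sqinter> y) \<in> G" using xy hm[of x y] G(4)[of "h x" "h y"] by simp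
  next
    fix x y assume x: "x \<in> {x \<in> carrier B. h x \<in> G}" and y: "y \<in> carrier B" and le: "x \<sqsubseteq> y"
    then show "y \<in> carrier B" by blast
    have xc: "x \<in> carrier B" using x by blast
    have "x = x \<sqinter> y" using le_iff_join[OF xc y] le by blast
    then have "h x = h x \<sqinter>\<^bsub>C\<^esub> h y" using hm[OF xc y] by metis
    then have "h x \<sqsubseteq>\<^bsub>C\<^esub> h y" using C.le_iff_join[OF hc[OF xc] hc[OF y]] by blast
    then show "h y \<in> G" using G(5)[of "h x" "h y"] x hc[OF y] by blast
  next
    fix x y assume x: "x \<in> carrier B" and y: "y \<in> carrier B" and xy: "x \<squnion> y = \<top> \<and> x \<sqinter> y = \<bottom>"
    have "h x \<squnion>\<^bsub>C\<^esub> h y = \<top>\<^bsub>C\<^esub>" "h x \<sqinter>\<^bsub>C\<^esub> h y = \<bottom>\<^bsub>C\<^esub>"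
      using hj[OF x y] hm[OF x y] hb xy by simp_all
    then have "h x \<in> G \<or> h y \<in> G" by (rule G(6)[OF hc[OF x] hc[OF y]])
    then show "x \<in> {x \<in> carrier B. h x \<in> G} \<or> y \<in> {x \<in> carrier B. h x \<in> G}" using x y by blast
  qed
qed

text \<open>Choose preimages of the entries; the inverse images of the ultrafilters that witness left-separation in \<open>C\<close>
  witness it in \<open>B\<close>.\<close>

lemma left_separated_homomorphic_image:
  assumes C: "homomorphic_image B C" and b: "left_separated C r b"
  obtains a where "left_separated B r a"
proof -
  obtain h where BC: "boolean_lattice C" and h: "h \<in> boolean_hom B C" "h ` carrier B = carrier C"
    using C unfolding homomorphic_image_def by blast
  interpret C: boolean_gorder C using BC by (rule boolean_gorder.intro)
  obtain pt where pt: "\<And>i. i \<in> Field r \<Longrightarrow> pt i \<in> clopen C (b i)"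
    "\<And>i j. i \<in> Field r \<Longrightarrow> j \<in> aboveS r i \<Longrightarrow> pt i \<notin> clopen C (b j)"
    using C.left_separated_points[OF b] by metis
  have "\<forall>i\<in>Field r. \<exists>x. x \<in> carrier B \<and> h x = b i"
  proof
    fix i assume i: "i \<in> Field r"
    have "b \<in> Field r \<rightarrow> carrier C" using b unfolding left_separated_def by (rule conjunct1)
    then have "b i \<in> carrier C" using i by (rule funcset_mem)
    then obtain x where "b i = h x" "x \<in> carrier B" unfolding h(2)[symmetric] by (elim imageE)
    then have "x \<in> carrier B \<and> h x = b i" by simp
    then show "\<exists>x. x \<in> carrier B \<and> h x = b i" by (rule exI)
  qed
  from bchoice[OF this] obtain a where a: "\<forall>i\<in>Field r. a i \<in> carrier B \<and> h (a i) = b i" by (elim exE)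
  let ?p = "\<lambda>i. {x \<in> carrier B. h x \<in> pt i}"
  have p: "?p i \<in> clopen B (a j) \<longleftrightarrow> pt i \<in> clopen C (b j)" if ij: "i \<in> Field r" "j \<in> Field r" for i j
  proof -
    have "pt i \<in> ultrafilters C" using pt(1)[OF ij(1)] unfolding clopen_def by blast
    then show ?thesis using hom_vimage_ultrafilter[OF BC h(1)] a ij(2) unfolding clopen_def by auto
  qed
  have "left_separated B r a"
  proof (rule left_separatedI[of _ _ ?p])
    show "a \<in> Field r \<rightarrow> carrier B" using a by blast
    show "?p i \<in> clopen B (a i)" if "i \<in> Field r" for i using p[OF that that] pt(1)[OF that] by blast
    show "?p i \<notin> clopen B (a j)" if ij: "i \<in> Field r" "j \<in> aboveS r i" for i j
    proof -
      have "j \<in> Field r" using ij(2) by (auto simp: aboveS_def Field_def)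
      then show ?thesis using p[OF ij(1)] pt(2)[OF ij] by blast
    qed
  qed
  then show thesis by (rule that)
qed

lemma homomorphic_image_densities:
  assumes C: "homomorphic_image B C"
  shows homomorphic_image_topological_density: "topological_density C \<le>o hereditary_density B"
    and homomorphic_image_algebraic_density: "Cinfinite (hereditary_density B) \<Longrightarrow> algebraic_density C \<le>o hereditary_density B"
proof -
  have BC: "boolean_lattice C" using C unfolding homomorphic_image_def by blast
  interpret C: boolean_gorder C using BC by (rule boolean_gorder.intro)
  note td = C.density_Card_order[OF subset_refl] C.thick_density[OF subset_refl]
  obtain b where b: "left_separated C (density (subtopology (Ult C) (ultrafilters C))) b"
    by (rule C.thick_imp_left_separated[OF td])
  obtain a where a: "left_separated B (density (subtopology (Ult C) (ultrafilters C))) a"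
    by (rule left_separated_homomorphic_image[OF C b])
  show "topological_density C \<le>o hereditary_density B"
    unfolding C.topological_density_eq by (rule left_separated_ordLeq_hereditary_density[OF td(1) a])
  assume inf: "Cinfinite (hereditary_density B)"
  show "algebraic_density C \<le>o hereditary_density B"
  proof (cases "Cinfinite (algebraic_density C)")
    case True
    obtain b where b: "left_separated C (algebraic_density C) b"
      by (rule C.algebraic_density_left_separated[OF True])
    obtain a where "left_separated B (algebraic_density C) a"
      by (rule left_separated_homomorphic_image[OF C b])
    then show ?thesis by (rule left_separated_ordLeq_hereditary_density[OF C.algebraic_density_Card_order])
  next
    case False
    then have "finite (Field (algebraic_density C))"
      using C.algebraic_density_Card_order unfolding cinfinite_def by blast
    then have "|Field (algebraic_density C)| <o hereditary_density B" by (rule finite_ordLess_Cinfinite[OF inf])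
    then show ?thesis
      by (rule ordLess_imp_ordLeq[OF ordIso_ordLess_trans[OF ordIso_symmetric[OF card_of_Field_ordIso[OF C.algebraic_density_Card_order]]]])
  qed
qed

end

text \<open>An order that represents a field of sets on \<open>Y\<close> is a Boolean algebra with the set operations. The
  elements are names for the sets, so that the algebra may live on a type other than that of sets.\<close>

lemma boolean_lattice_of_sets:
  fixes \<phi> :: "'a \<Rightarrow> 'p set" and M :: "'a set" and C :: "'a gorder"
  assumes C: "C = \<lparr>carrier = M, eq = (=), le = (\<lambda>x y. \<phi> x \<subseteq> \<phi> y)\<rparr>"
    and inj: "inj_on \<phi> M" and top: "Y \<in> \<phi> ` M" and sub': "\<forall>x\<in>M. \<phi> x \<subseteq> Y"
    and Int': "\<forall>x\<in>M. \<forall>y\<in>M. \<phi> x \<inter> \<phi> y \<in> \<phi> ` M"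
    and Compl': "\<forall>x\<in>M. Y - \<phi> x \<in> \<phi> ` M"
  shows "boolean_lattice C"
    and "\<And>x y. x \<in> M \<Longrightarrow> y \<in> M \<Longrightarrow> \<phi> (x \<sqinter>\<^bsub>C\<^esub> y) = \<phi> x \<inter> \<phi> y"
    and "\<And>x y. x \<in> M \<Longrightarrow> y \<in> M \<Longrightarrow> \<phi> (x \<squnion>\<^bsub>C\<^esub> y) = \<phi> x \<union> \<phi> y"
    and "\<phi> \<bottom>\<^bsub>C\<^esub> = {}" and "\<phi> \<top>\<^bsub>C\<^esub> = Y"
proof -
  note sub = sub'[rule_format] and Int = Int'[rule_format] and Compl = Compl'[rule_format]
  have img: "\<exists>s\<in>M. \<phi> s = A" if "A \<in> \<phi> ` M" for A
  proof -
    obtain s where "A = \<phi> s" "s \<in> M" using \<open>A \<in> \<phi> ` M\<close> by (elim imageE)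
    then show ?thesis by (intro bexI[of _ s]) simp_all
  qed
  have Un: "\<exists>s\<in>M. \<phi> s = \<phi> x \<union> \<phi> y" if xy: "x \<in> M" "y \<in> M" for x y
  proof -
    obtain x' where x': "x' \<in> M" "\<phi> x' = Y - \<phi> x" using img[OF Compl[OF xy(1)]] by (elim bexE)
    obtain y' where y': "y' \<in> M" "\<phi> y' = Y - \<phi> y" using img[OF Compl[OF xy(2)]] by (elim bexE)
    obtain z where z: "z \<in> M" "\<phi> z = \<phi> x' \<inter> \<phi> y'" using img[OF Int[OF x'(1) y'(1)]] by (elim bexE)
    obtain s where s: "s \<in> M" "\<phi> s = Y - \<phi> z" using img[OF Compl[OF z(1)]] by (elim bexE)
    have "\<phi> s = \<phi> x \<union> \<phi> y" using s(2) z(2) x'(2) y'(2) sub[OF xy(1)] sub[OF xy(2)] by blast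
    then show ?thesis using s(1) by blast
  qed
  have In: "\<exists>s\<in>M. \<phi> s = \<phi> x \<inter> \<phi> y" if xy: "x \<in> M" "y \<in> M" for x y by (rule img[OF Int[OF xy]])
  have Co: "\<exists>s\<in>M. \<phi> s = Y - \<phi> x" if x: "x \<in> M" for x by (rule img[OF Compl[OF x]])
  obtain t where t: "t \<in> M" "\<phi> t = Y" using img[OF top] by (elim bexE)
  obtain b where b: "b \<in> M" "\<phi> b = {}" using Co[OF t(1)] unfolding t(2) Diff_cancel by (elim bexE)
  interpret C: bounded_lattice C
  proof
    show "\<exists>s. least C s (Upper C {x, y})" if "x \<in> carrier C" "y \<in> carrier C" for x y
    proof -
      have xy: "x \<in> M" "y \<in> M" using that C by simp_all
      obtain s where "s \<in> M" "\<phi> s = \<phi> x \<union> \<phi> y" using Un[OF xy] by (elim bexE)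
      then have "least C s (Upper C {x, y})" using xy unfolding least_def Upper_def C by auto
      then show ?thesis by (rule exI)
    qed
    show "\<exists>s. greatest C s (Lower C {x, y})" if "x \<in> carrier C" "y \<in> carrier C" for x y
    proof -
      have xy: "x \<in> M" "y \<in> M" using that C by simp_all
      obtain s where "s \<in> M" "\<phi> s = \<phi> x \<inter> \<phi> y" using In[OF xy] by (elim bexE)
      then have "greatest C s (Lower C {x, y})" using xy unfolding greatest_def Lower_def C by auto
      then show ?thesis by (rule exI)
    qed
    show "\<exists>x. least C x (carrier C)" by (rule exI[of _ b]) (use b C in \<open>auto simp: least_def\<close>)
    show "\<exists>x. greatest C x (carrier C)" by (rule exI[of _ t]) (use t sub C in \<open>auto simp: greatest_def\<close>)
  qed (use C inj_onD[OF inj] in auto)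
  have cM: "carrier C = M" and le: "\<And>x y. x \<sqsubseteq>\<^bsub>C\<^esub> y \<longleftrightarrow> \<phi> x \<subseteq> \<phi> y" using C by simp_all
  show meet: "\<phi> (x \<sqinter>\<^bsub>C\<^esub> y) = \<phi> x \<inter> \<phi> y" if xy: "x \<in> M" "y \<in> M" for x y
  proof
    have c: "x \<in> carrier C" "y \<in> carrier C" using xy cM by simp_all
    show "\<phi> (x \<sqinter>\<^bsub>C\<^esub> y) \<subseteq> \<phi> x \<inter> \<phi> y" using C.meet_left[OF c] C.meet_right[OF c] unfolding le by blast
    obtain s where s: "s \<in> M" "\<phi> s = \<phi> x \<inter> \<phi> y" using In[OF xy] by blast
    have "s \<sqsubseteq>\<^bsub>C\<^esub> x \<sqinter>\<^bsub>C\<^esub> y" by (rule C.meet_le) (use s c cM le in auto)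
    then show "\<phi> x \<inter> \<phi> y \<subseteq> \<phi> (x \<sqinter>\<^bsub>C\<^esub> y)" unfolding le s(2) .
  qed
  show join: "\<phi> (x \<squnion>\<^bsub>C\<^esub> y) = \<phi> x \<union> \<phi> y" if xy: "x \<in> M" "y \<in> M" for x y
  proof
    have c: "x \<in> carrier C" "y \<in> carrier C" using xy cM by simp_all
    show "\<phi> x \<union> \<phi> y \<subseteq> \<phi> (x \<squnion>\<^bsub>C\<^esub> y)" using C.join_left[OF c] C.join_right[OF c] unfolding le by blast
    obtain s where s: "s \<in> M" "\<phi> s = \<phi> x \<union> \<phi> y" using Un[OF xy] by blast
    have "x \<squnion>\<^bsub>C\<^esub> y \<sqsubseteq>\<^bsub>C\<^esub> s" by (rule C.join_le) (use s c cM le in auto)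
    then show "\<phi> (x \<squnion>\<^bsub>C\<^esub> y) \<subseteq> \<phi> x \<union> \<phi> y" unfolding le s(2) .
  qed
  have "\<bottom>\<^bsub>C\<^esub> \<sqsubseteq>\<^bsub>C\<^esub> b" using C.bottom_lower b(1) cM by blast
  then show bot: "\<phi> \<bottom>\<^bsub>C\<^esub> = {}" unfolding le b(2) by blast
  have "t \<sqsubseteq>\<^bsub>C\<^esub> \<top>\<^bsub>C\<^esub>" using C.top_higher t(1) cM by blast
  moreover have tM: "\<top>\<^bsub>C\<^esub> \<in> M" "\<bottom>\<^bsub>C\<^esub> \<in> M" using C.top_closed C.bottom_closed cM by blast+
  ultimately show topY: "\<phi> \<top>\<^bsub>C\<^esub> = Y" unfolding le t(2) using sub by blast
  have mM: "x \<sqinter>\<^bsub>C\<^esub> y \<in> M" "x \<squnion>\<^bsub>C\<^esub> y \<in> M" if "x \<in> M" "y \<in> M" for x y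
    using C.meet_closed C.join_closed that unfolding cM by blast+
  show "boolean_lattice C"
  proof
    fix x y z assume "x \<in> carrier C" "y \<in> carrier C" "z \<in> carrier C"
    then have xyz: "x \<in> M" "y \<in> M" "z \<in> M" unfolding cM .
    have "\<phi> (x \<sqinter>\<^bsub>C\<^esub> (y \<squnion>\<^bsub>C\<^esub> z)) = \<phi> ((x \<sqinter>\<^bsub>C\<^esub> y) \<squnion>\<^bsub>C\<^esub> (x \<sqinter>\<^bsub>C\<^esub> z))"
      using xyz by (simp add: meet join mM Int_Un_distrib)
    then show "x \<sqinter>\<^bsub>C\<^esub> (y \<squnion>\<^bsub>C\<^esub> z) = (x \<sqinter>\<^bsub>C\<^esub> y) \<squnion>\<^bsub>C\<^esub> (x \<sqinter>\<^bsub>C\<^esub> z)"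
      by (rule inj_onD[OF inj]) (use xyz mM in simp_all)
  next
    fix x assume "x \<in> carrier C"
    then have x: "x \<in> M" unfolding cM .
    obtain y where y: "y \<in> M" "\<phi> y = Y - \<phi> x" using Co[OF x] by blast
    have "\<phi> (x \<squnion>\<^bsub>C\<^esub> y) = \<phi> \<top>\<^bsub>C\<^esub>" unfolding join[OF x y(1)] y(2) topY using sub[OF x] by blast
    then have 1: "x \<squnion>\<^bsub>C\<^esub> y = \<top>\<^bsub>C\<^esub>" by (rule inj_onD[OF inj]) (use x y mM tM in simp_all)
    have "\<phi> (x \<sqinter>\<^bsub>C\<^esub> y) = \<phi> \<bottom>\<^bsub>C\<^esub>" unfolding meet[OF x y(1)] y(2) bot by blast
    then have 2: "x \<sqinter>\<^bsub>C\<^esub> y = \<bottom>\<^bsub>C\<^esub>" by (rule inj_onD[OF inj]) (use x y mM tM in simp_all)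
    show "\<exists>y\<in>carrier C. x \<squnion>\<^bsub>C\<^esub> y = \<top>\<^bsub>C\<^esub> \<and> x \<sqinter>\<^bsub>C\<^esub> y = \<bottom>\<^bsub>C\<^esub>" using 1 2 y(1) cM by blast
  qed
qed

text \<open>The algebra \<open>C\<close> of traces of clopen sets on \<open>Y\<close>, each trace being named by a representative \<open>q b\<close> in \<open>B\<close>.
  The inverse image under \<open>q\<close> of an ultrafilter of \<open>C\<close> is in \<open>Y\<close> because each of its members has a nonempty trace and \<open>Y\<close> is closed. The inverse
  images of a dense set of ultrafilters are dense in \<open>Y\<close>.\<close>

lemma (in boolean_gorder) closed_subspace_homomorphic_image:
  assumes Y: "Y \<subseteq> ultrafilters B" "stone.cl Y \<subseteq> Y"
  obtains C :: "'a gorder" where "homomorphic_image B C"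
    "density (subtopology (Ult B) Y) \<le>o topological_density C"
proof -
  let ?tr = "\<lambda>b. clopen B b \<inter> Y"
  define q where "q b = (SOME b'. b' \<in> carrier B \<and> ?tr b' = ?tr b)" for b
  have q: "q b \<in> carrier B" "?tr (q b) = ?tr b" if "b \<in> carrier B" for b
    using someI[of "\<lambda>b'. b' \<in> carrier B \<and> ?tr b' = ?tr b" b] that unfolding q_def by auto
  have qeq: "q b = q b'" if "?tr b = ?tr b'" for b b' unfolding q_def that ..
  let ?M = "q ` carrier B"
  define C :: "'a gorder" where "C = \<lparr>carrier = ?M, eq = (=), le = (\<lambda>x y. ?tr x \<subseteq> ?tr y)\<rparr>"
  have MB: "?M \<subseteq> carrier B" using q(1) by blast
  have inj: "inj_on ?tr ?M"
  proof (rule inj_onI)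
    fix x y assume "x \<in> ?M" "y \<in> ?M" and eq: "?tr x = ?tr y"
    then obtain b b' where b: "b \<in> carrier B" "x = q b" "b' \<in> carrier B" "y = q b'" by (elim imageE)
    have "?tr b = ?tr b'" using q(2)[OF b(1)] q(2)[OF b(3)] eq b(2,4) by simp
    then show "x = y" unfolding b(2,4) by (rule qeq)
  qed
  have im: "?tr b \<in> ?tr ` ?M" if "b \<in> carrier B" for b
    using imageI[of "q b" ?M ?tr] q(2)[OF that] that by simp
  have "?tr \<top> = Y" using clopen_top Y(1) by blast
  then have trY: "Y \<in> ?tr ` ?M" using im[OF top_closed] by simp
  have trsub: "\<forall>x\<in>?M. ?tr x \<subseteq> Y" by blast
  have trI: "\<forall>x\<in>?M. \<forall>y\<in>?M. ?tr x \<inter> ?tr y \<in> ?tr ` ?M"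
  proof (intro ballI)
    fix x y assume "x \<in> ?M" "y \<in> ?M"
    then have xy: "x \<in> carrier B" "y \<in> carrier B" using MB by blast+
    have "?tr (x \<sqinter> y) = ?tr x \<inter> ?tr y" unfolding clopen_meet[OF xy] by blast
    then show "?tr x \<inter> ?tr y \<in> ?tr ` ?M" using im[OF meet_closed[OF xy]] by simp
  qed
  have trD: "\<forall>x\<in>?M. Y - ?tr x \<in> ?tr ` ?M"
  proof
    fix x assume "x \<in> ?M"
    then have x: "x \<in> carrier B" using MB by blast
    obtain z where z: "z \<in> carrier B" "clopen B z = clopen B \<top> - clopen B x" by (rule clopen_Diff[OF top_closed x])
    have "?tr z = Y - ?tr x" unfolding z(2) clopen_top using Y(1) by blast
    then show "Y - ?tr x \<in> ?tr ` ?M" using im[OF z(1)] by simp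
  qed
  note C_facts = boolean_lattice_of_sets[OF C_def inj trY trsub trI trD]
  interpret C: boolean_gorder C using C_facts(1) by (rule boolean_gorder.intro)
  have cC: "carrier C = ?M" unfolding C_def by simp
  have qM: "q x \<in> ?M" if "x \<in> carrier B" for x using that by (rule imageI)
  have eqI: "x = y" if "x \<in> ?M" "y \<in> ?M" "?tr x = ?tr y" for x y by (rule inj_onD[OF inj that(3,1,2)])
  have CM: "\<top>\<^bsub>C\<^esub> \<in> ?M" "\<bottom>\<^bsub>C\<^esub> \<in> ?M" "\<And>x y. x \<in> ?M \<Longrightarrow> y \<in> ?M \<Longrightarrow> x \<sqinter>\<^bsub>C\<^esub> y \<in> ?M"
    "\<And>x y. x \<in> ?M \<Longrightarrow> y \<in> ?M \<Longrightarrow> x \<squnion>\<^bsub>C\<^esub> y \<in> ?M"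
    using C.top_closed C.bottom_closed C.meet_closed C.join_closed unfolding cC by blast+
  have qhom: "q \<in> boolean_hom B C"
    unfolding boolean_hom_def join_pres_def meet_pres_def
  proof (intro CollectI conjI ballI)
    show "q \<in> carrier B \<rightarrow> carrier C" unfolding cC by (rule funcsetI) (rule qM)
    show "lattice B" "lattice B" by (rule lattice_axioms)+
    show "lattice C" "lattice C" by (rule C.lattice_axioms)+
    show "q (x \<squnion> y) = q x \<squnion>\<^bsub>C\<^esub> q y" if xy: "x \<in> carrier B" "y \<in> carrier B" for x y
    proof (rule eqI[OF qM[OF join_closed[OF xy]] CM(4)[OF qM[OF xy(1)] qM[OF xy(2)]]])
      show "?tr (q (x \<squnion> y)) = ?tr (q x \<squnion>\<^bsub>C\<^esub> q y)"
        unfolding C_facts(3)[OF qM[OF xy(1)] qM[OF xy(2)]] q(2)[OF xy(1)] q(2)[OF xy(2)] q(2)[OF join_closed[OF xy]]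
          clopen_join[OF xy] by blast
    qed
    show "q (x \<sqinter> y) = q x \<sqinter>\<^bsub>C\<^esub> q y" if xy: "x \<in> carrier B" "y \<in> carrier B" for x y
    proof (rule eqI[OF qM[OF meet_closed[OF xy]] CM(3)[OF qM[OF xy(1)] qM[OF xy(2)]]])
      show "?tr (q (x \<sqinter> y)) = ?tr (q x \<sqinter>\<^bsub>C\<^esub> q y)"
        unfolding C_facts(2)[OF qM[OF xy(1)] qM[OF xy(2)]] q(2)[OF xy(1)] q(2)[OF xy(2)] q(2)[OF meet_closed[OF xy]]
          clopen_meet[OF xy] by blast
    qed
    show "q \<bottom> = \<bottom>\<^bsub>C\<^esub>"
      by (rule eqI[OF qM[OF bottom_closed] CM(2)]) (unfold C_facts(4) q(2)[OF bottom_closed] clopen_bottom, simp)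
    show "q \<top> = \<top>\<^bsub>C\<^esub>"
      by (rule eqI[OF qM[OF top_closed] CM(1)]) (unfold C_facts(5) q(2)[OF top_closed], fact)
  qed
  have nonbot: "q b \<noteq> \<bottom>\<^bsub>C\<^esub> \<longleftrightarrow> ?tr b \<noteq> {}" if b: "b \<in> carrier B" for b
    using eqI[OF qM[OF b] CM(2)] C_facts(4) q(2)[OF b] by metis
  let ?v = "\<lambda>G. {x \<in> carrier B. q x \<in> G}"
  have vU: "?v G \<in> ultrafilters B" if "G \<in> ultrafilters C" for G
    by (rule hom_vimage_ultrafilter[OF C_facts(1) qhom that])
  have vY: "?v G \<in> Y" if G: "G \<in> ultrafilters C" for G
  proof -
    have "?v G \<in> stone.cl Y"
      unfolding stone.cl_def
    proof (rule CollectI, intro conjI ballI impI)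
      show "?v G \<in> ultrafilters B" by (rule vU[OF G])
      fix c assume "c \<in> clopen B ` carrier B" and c: "?v G \<in> c"
      then obtain b where b: "c = clopen B b" "b \<in> carrier B" by (elim imageE)
      have "q b \<in> G" using c unfolding b(1) clopen_def by blast
      then have "q b \<noteq> \<bottom>\<^bsub>C\<^esub>" using C.ultrafilterD(3)[OF G] by metis
      then show "c \<inter> Y \<noteq> {}" using nonbot[OF b(2)] unfolding b(1) by blast
    qed
    then show ?thesis using Y(2) by blast
  qed
  obtain D where D: "D \<subseteq> ultrafilters C" "ultrafilters C \<subseteq> C.stone.cl D" "topological_density C = |D|"
    using C.density_attained[OF subset_refl] unfolding C.topological_density_eq[symmetric] by (elim exE conjE)
  have "density (subtopology (Ult B) Y) \<le>o |?v ` D|"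
  proof (rule density_le[OF Y(1)])
    show "?v ` D \<subseteq> Y" using vY D(1) by blast
    show "Y \<subseteq> stone.cl (?v ` D)"
    proof
      fix y assume y: "y \<in> Y"
      show "y \<in> stone.cl (?v ` D)"
        unfolding stone.cl_def
      proof (rule CollectI, intro conjI ballI impI)
        show "y \<in> ultrafilters B" using y Y(1) by blast
        fix c assume "c \<in> clopen B ` carrier B" and c: "y \<in> c"
        then obtain b where b: "c = clopen B b" "b \<in> carrier B" by (elim imageE)
        have "q b \<noteq> \<bottom>\<^bsub>C\<^esub>" using nonbot[OF b(2)] y c b(1) by blast
        moreover have qc: "q b \<in> carrier C" using qM[OF b(2)] unfolding cC .
        ultimately obtain G0 where G0: "G0 \<in> clopen C (q b)" using C.clopen_nonempty by blast
        then have "G0 \<in> C.stone.cl D" using D(2) unfolding clopen_def by blast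
        then have "clopen C (q b) \<inter> D \<noteq> {}" using G0 qc unfolding C.stone.cl_def by blast
        then obtain G where G: "G \<in> D" "q b \<in> G" unfolding clopen_def by blast
        have "G \<in> ultrafilters C" using G(1) D(1) by blast
        then have "?v G \<in> clopen B b" using vU[of G] G(2) b(2) unfolding clopen_def by simp
        then show "c \<inter> ?v ` D \<noteq> {}" using G(1) unfolding b(1) by blast
      qed
    qed
  qed
  then have "density (subtopology (Ult B) Y) \<le>o topological_density C"
    unfolding D(3) by (rule ordLeq_transitive[OF _ card_of_image])
  moreover have "homomorphic_image B C"
    unfolding homomorphic_image_def using C_facts(1) qhom cC by (intro conjI bexI[of _ q]) simp_all
  ultimately show thesis using that by blast
qed

section \<open>The four suprema\<close>

lemma card_Sup_ordIso:
  fixes S :: "'x rel set" and c :: "'y rel"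
  assumes c: "Card_order c" and S: "\<And>r. r \<in> S \<Longrightarrow> Card_order r" "\<And>r. r \<in> S \<Longrightarrow> r \<le>o c"
    and r0: "r0 \<in> S" "c \<le>o r0"
  shows "card_Sup S =o c"
proof -
  have "card_Sup S \<le>o c" by (rule card_Sup_least[OF S(1) c S(2)])
  moreover have "r0 \<le>o card_Sup S" by (rule card_Sup_upper[OF S(1) r0(1)])
  then have "c \<le>o card_Sup S" by (rule ordLeq_transitive[OF r0(2)])
  ultimately show ?thesis unfolding ordIso_iff_ordLeq by (rule conjI)
qed

lemma cardSuc_ordLeq_cardSuc:
  assumes "Card_order r" "Card_order s" "r \<le>o t" "t \<le>o s"
  shows "cardSuc r \<le>o cardSuc s"
  using cardSuc_mono_ordLeq[OF assms(1,2)] ordLeq_transitive[OF assms(3,4)] by blast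

text \<open>A finite cofinal set would have a greatest element, with nothing of the set beyond it.\<close>

lemma cofinality_Cinfinite:
  assumes r: "Cinfinite r"
  shows "Cinfinite (cofinality r)"
proof -
  have wo: "Well_order r" using r card_order_on_well_order_on by blast
  let ?C = "{|K| |K. K \<subseteq> Field r \<and> cofinal K r}"
  have "cofinal (Field r) r"
    unfolding cofinal_def using infinite_Card_order_limit[of r] r unfolding cinfinite_def by blast
  then have ne: "?C \<noteq> {}" by blast
  have co: "\<And>s. s \<in> ?C \<Longrightarrow> Card_order s" using card_of_Card_order by blast
  have "cofinality r \<in> ?C" unfolding cofinality_def by (rule card_Min(1)[OF ne co])
  then obtain K where K: "cofinality r = |K|" "K \<subseteq> Field r" "cofinal K r" by blast
  have "infinite K"
  proof
    assume fin: "finite K"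
    have "Field r \<noteq> {}" using r unfolding cinfinite_def by auto
    then have "K \<noteq> {}" using K(3) unfolding cofinal_def by blast
    then obtain j where j: "j \<in> K" "\<forall>k\<in>K. (k, j) \<in> r" using finite_greatest[OF wo fin _ K(2)] by blast
    then obtain b where b: "b \<in> K" "j \<noteq> b" "(j, b) \<in> r" using K(2,3) unfolding cofinal_def by blast
    have "j \<in> underS r b" "b \<in> underS r j" using b j(2) unfolding underS_def by auto
    then show False using underS_asym[OF wo] by blast
  qed
  then have "cinfinite |K|" unfolding cinfinite_def Field_card_of .
  then show ?thesis unfolding K(1) using card_of_Card_order by (rule conjI)
qed

lemma cexp_absorb:
  assumes k: "Cinfinite k"
  shows "Cinfinite (ctwo ^c k)" "k \<le>o ctwo ^c k" "(ctwo ^c k) ^c k \<le>o ctwo ^c k"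
    "|Pow (Field k)| =o ctwo ^c k"
proof -
  have ck: "Card_order k" using k by blast
  have P: "|Pow (Field k)| =o |Func (Field k) (UNIV :: bool set)|" by (rule card_of_Pow_Func)
  then show Pk: "|Pow (Field k)| =o ctwo ^c k" unfolding cexp_def ctwo_def Field_card_of .
  have "|Field k| <o |Pow (Field k)|" by (rule card_of_Pow)
  then have less: "|Field k| <o ctwo ^c k" by (rule ordLess_ordIso_trans[OF _ Pk])
  then show le: "k \<le>o ctwo ^c k"
    by (intro ordLess_imp_ordLeq ordIso_ordLess_trans[OF ordIso_symmetric[OF card_of_Field_ordIso[OF ck]]])
  show "Cinfinite (ctwo ^c k)" using cinfinite_mono[OF le conjunct1[OF k]] Card_order_cexp by (rule conjI)
  have "(ctwo ^c k) ^c k =o ctwo ^c (k *c k)" by (rule cexp_cprod[OF Card_order_ctwo])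
  moreover have "k *c k =o k" by (rule cprod_infinite[OF k])
  then have "ctwo ^c (k *c k) =o ctwo ^c k" by (rule cexp_cong2[OF _ Card_order_ctwo Card_order_cprod])
  ultimately have "(ctwo ^c k) ^c k =o ctwo ^c k" by (rule ordIso_transitive)
  then show "(ctwo ^c k) ^c k \<le>o ctwo ^c k" by (rule ordIso_imp_ordLeq)
qed

lemma card_Func_prod_cardSuc_le:
  assumes k: "Cinfinite k" and m: "m = cardSuc (ctwo ^c k)"
  shows "|Func (Field k) (Field m \<times> Field m)| \<le>o m"
proof -
  note l = cexp_absorb[OF k]
  have ck: "Card_order k" using k by blast
  have Cm: "Cinfinite m" unfolding m by (rule Cinfinite_cardSuc[OF l(1)])
  have infm: "infinite (Field m)" and com: "Card_order m" using Cm unfolding cinfinite_def by blast+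
  have "|Field m \<times> Field m| \<le>o m"
    by (rule card_of_Times_ordLeq_infinite_Field[OF infm Field_ordLeq[OF com] Field_ordLeq[OF com] com])
  then have "|Field m \<times> Field m| ^c k \<le>o m ^c k" by (rule cexp_mono1[OF _ ck])
  moreover have "m ^c k \<le>o m" unfolding m using card_Func_cardSuc_le[OF ck l(1-3)] by (subst (1) cexp_def)
  ultimately have "|Field m \<times> Field m| ^c k \<le>o m" by (rule ordLeq_transitive)
  then show ?thesis unfolding cexp_def Field_card_of .
qed

text \<open>Each \<open>\<chi> j\<close> is below some \<open>\<chi> j'\<close> and hence strictly below \<open>\<lambda> = hd(B)\<close>, so that some left-separated sequence has
  length at least \<open>\<chi> j\<close>; thus the Stone space is large at every \<open>\<chi> j\<close>.\<close>

lemma (in boolean_gorder) closed_subspace_of_full_density: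
  fixes \<mu> :: "'m rel" and lam :: "'l rel" and \<chi> :: "'l \<Rightarrow> 'c rel" and i0 :: 'l
  assumes lam: "Cinfinite lam"
    and chi: "\<And>i. i \<in> Field (cofinality lam) \<Longrightarrow> Cinfinite (\<chi> i) \<and> regularCard (\<chi> i)"
    and mono: "\<And>i j. (i, j) \<in> cofinality lam \<Longrightarrow> i \<noteq> j \<Longrightarrow> \<chi> i <o \<chi> j"
    and mu: "\<mu> =o cardSuc (ctwo ^c (cofinality lam))"
    and sup: "lam =o card_Sup {\<chi> i | i. i \<in> Field (cofinality lam)}"
    and i0: "i0 \<in> Field (cofinality lam)" "\<And>i. i \<in> Field (cofinality lam) \<Longrightarrow> (i0, i) \<in> cofinality lam"
    and mu_chi: "\<mu> <o \<chi> i0"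
    and hd: "hereditary_density B =o lam"
  obtains Y where "Y \<subseteq> ultrafilters B" "stone.cl Y \<subseteq> Y" "lam \<le>o density (subtopology (Ult B) Y)"
proof -
  let ?k = "cofinality lam"
  have k: "Cinfinite ?k" by (rule cofinality_Cinfinite[OF lam])
  have ck: "Card_order ?k" using k by blast
  define m where "m = cardSuc (ctwo ^c ?k)"
  note l = cexp_absorb[OF k]
  have col: "Card_order (ctwo ^c ?k)" by (rule Card_order_cexp)
  have Cm: "Cinfinite m" unfolding m_def by (rule Cinfinite_cardSuc[OF l(1)])
  have lm: "ctwo ^c ?k <o m" unfolding m_def by (rule cardSuc_greater[OF col])
  have Pm: "|Pow (Field ?k)| <o m" by (rule ordIso_ordLess_trans[OF l(4) lm])
  have km: "|Field ?k| <o m" by (rule ordLess_transitive[OF card_of_Pow Pm])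
  have m0: "m <o \<chi> i0" unfolding m_def by (rule ordIso_ordLess_trans[OF ordIso_symmetric[OF mu] mu_chi])
  have m_chi: "m <o \<chi> i" if i: "i \<in> Field ?k" for i
  proof (cases "i = i0")
    case True
    then show ?thesis using m0 by simp
  next
    case False
    then have "\<chi> i0 <o \<chi> i" by (intro mono[OF i0(2)[OF i]]) simp
    then show ?thesis by (rule ordLess_transitive[OF m0])
  qed
  have coS: "\<And>r. r \<in> {\<chi> i | i. i \<in> Field ?k} \<Longrightarrow> Card_order r" using chi by blast
  interpret T: compact_clopen_tower "ultrafilters B" "clopen B ` carrier B" ?k \<chi>
  proof
    show "Cinfinite ?k" by (rule k)
    show "Cinfinite (\<chi> i)" "regularCard (\<chi> i)" if "i \<in> Field ?k" for i using chi[OF that] by blast+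
    show "\<chi> i <o \<chi> j" if "i \<in> underS ?k j" for i j by (rule mono) (use that in \<open>auto simp: underS_def\<close>)
    show "|Field ?k| <o \<chi> i" if "i \<in> Field ?k" for i by (rule ordLess_transitive[OF km m_chi[OF that]])
  qed
  have large: "stone.large (\<chi> j) (ultrafilters B)" if j: "j \<in> Field ?k" for j
  proof -
    obtain j' where j': "j' \<in> Field ?k" "j \<noteq> j'" "(j, j') \<in> ?k"
      using infinite_Card_order_limit[OF ck _ j] k unfolding cinfinite_def by blast
    have "\<chi> j' \<le>o card_Sup {\<chi> i | i. i \<in> Field ?k}" by (rule card_Sup_upper[OF coS]) (use j'(1) in blast)+
    then have "\<chi> j <o card_Sup {\<chi> i | i. i \<in> Field ?k}" by (rule ordLess_ordLeq_trans[OF mono[OF j'(3,2)]])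
    then have "\<chi> j <o lam" by (rule ordLess_ordIso_trans[OF _ ordIso_symmetric[OF sup]])
    then have less: "\<chi> j <o hereditary_density B" by (rule ordLess_ordIso_trans[OF _ ordIso_symmetric[OF hd]])
    have cj: "Cinfinite (\<chi> j)" "regularCard (\<chi> j)" "Card_order (\<chi> j)" using chi[OF j] by blast+
    obtain a where "left_separated B (\<chi> j) a" by (rule left_separated_of_large_length[OF cj(3) less])
    then show ?thesis by (rule left_separated_imp_large[OF cj(1,2)])
  qed
  obtain Y where Y: "stone.cl Y \<subseteq> Y" "\<forall>j\<in>Field ?k. stone.thick (\<chi> j) Y"
    by (rule T.thick_closed_exists[OF Cm card_Func_prod_cardSuc_le[OF k m_def] Pm ordLess_imp_ordLeq[OF km] m_chi large])
  have YX: "Y \<subseteq> ultrafilters B" using Y(2) i0(1) unfolding stone.thick_def by blast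
  have "card_Sup {\<chi> i | i. i \<in> Field ?k} \<le>o density (subtopology (Ult B) Y)"
  proof (rule card_Sup_least[OF coS density_Card_order[OF YX]])
    fix r assume "r \<in> {\<chi> i | i. i \<in> Field ?k}"
    then obtain i where i: "r = \<chi> i" "i \<in> Field ?k" by blast
    show "r \<le>o density (subtopology (Ult B) Y)" unfolding i(1)
      by (rule thick_ordLeq_density) (use chi[OF i(2)] Y(2) i(2) in blast)+
  qed
  then have "lam \<le>o density (subtopology (Ult B) Y)" by (rule ordIso_ordLeq_trans[OF sup])
  then show thesis by (rule that[OF YX Y(1)])
qed

theorem theorem2p5:
  fixes \<mu> :: "'m rel" and lam :: "'l rel" and \<chi> :: "'l \<Rightarrow> 'c rel" and i0 :: 'l
    and B :: "'a gorder"
  assumes "Cinfinite \<mu>" and "Cinfinite lam"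
    and "\<And>i. i \<in> Field (cofinality lam) \<Longrightarrow> Cinfinite (\<chi> i) \<and> regularCard (\<chi> i)"
    and "\<And>i j. (i, j) \<in> cofinality lam \<Longrightarrow> i \<noteq> j \<Longrightarrow> \<chi> i <o \<chi> j"
    and "cofinality lam <o \<mu>"
    and "\<mu> =o cardSuc (ctwo ^c (cofinality lam))"
    and "\<mu> <o lam"
    and "lam =o card_Sup {\<chi> i | i. i \<in> Field (cofinality lam)}"
    and "i0 \<in> Field (cofinality lam)" and "\<And>i. i \<in> Field (cofinality lam) \<Longrightarrow> (i0, i) \<in> cofinality lam"
    and "\<mu> <o \<chi> i0"
    and "boolean_lattice B" and "infinite (carrier B)"
    and "hereditary_density B =o lam"
  shows "hd8_plus B =o cardSuc lam \<and>
    hd0_plus B =o cardSuc lam \<and> hd7_plus B =o cardSuc lam \<and> hd5_plus B =o cardSuc lam"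
proof -
  interpret boolean_gorder B using assms(12) by (rule boolean_gorder.intro)
  have clam: "Card_order lam" using assms(2) by blast
  have csuc: "Card_order (cardSuc lam)" by (rule cardSuc_Card_order[OF clam])
  have hd: "hereditary_density B \<le>o lam" by (rule ordIso_imp_ordLeq[OF assms(14)])
  have Chd: "Cinfinite (hereditary_density B)"
  proof
    show "cinfinite (hereditary_density B)"
      by (rule cinfinite_mono[OF ordIso_imp_ordLeq[OF ordIso_symmetric[OF assms(14)]] conjunct1[OF assms(2)]])
    show "Card_order (hereditary_density B)" unfolding hereditary_density_def by (rule Card_order_card_Sup) blast
  qed
  obtain Y where Y: "Y \<subseteq> ultrafilters B" "stone.cl Y \<subseteq> Y" "lam \<le>o density (subtopology (Ult B) Y)"
    by (rule closed_subspace_of_full_density[OF assms(2,3,4,6,8,9,10,11,14)])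
  obtain C :: "'a gorder" where C: "homomorphic_image B C" "density (subtopology (Ult B) Y) \<le>o topological_density C"
    by (rule closed_subspace_homomorphic_image[OF Y(1,2)])
  have lamC: "lam \<le>o topological_density C" by (rule ordLeq_transitive[OF Y(3) C(2)])
  have co_top: "Card_order (topological_density D)" and co_alg: "Card_order (algebraic_density D)"
    and top_alg: "topological_density D \<le>o algebraic_density D" if "homomorphic_image B D" for D :: "'a gorder"
  proof -
    have "boolean_gorder D" using that unfolding homomorphic_image_def boolean_gorder_def by blast
    then interpret D: boolean_gorder D .
    show "Card_order (topological_density D)"
      unfolding D.topological_density_eq by (rule D.density_Card_order[OF subset_refl])
    show "Card_order (algebraic_density D)" by (rule D.algebraic_density_Card_order)
    show "topological_density D \<le>o algebraic_density D" by (rule D.topological_density_ordLeq_algebraic_density)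
  qed
  note suc_mono = cardSuc_ordLeq_cardSuc[OF _ clam _ hd]
  have hd8: "hd8_plus B =o cardSuc lam"
    unfolding hd8_plus_def
  proof (rule card_Sup_ordIso[OF csuc])
    fix r assume "r \<in> {cardSuc (topological_density D) | D :: 'a gorder. homomorphic_image B D}"
    then obtain D :: "'a gorder" where D: "r = cardSuc (topological_density D)" "homomorphic_image B D" by blast
    show "Card_order r" unfolding D(1) by (rule cardSuc_Card_order[OF co_top[OF D(2)]])
    show "r \<le>o cardSuc lam" unfolding D(1)
      by (rule suc_mono[OF co_top[OF D(2)] homomorphic_image_topological_density[OF D(2)]])
  next
    show "cardSuc (topological_density C) \<in> {cardSuc (topological_density D) | D :: 'a gorder. homomorphic_image B D}"
      using C(1) by blast
    show "cardSuc lam \<le>o cardSuc (topological_density C)"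
      using cardSuc_mono_ordLeq[OF clam co_top[OF C(1)]] lamC by blast
  qed
  have hd7: "hd7_plus B =o cardSuc lam"
    unfolding hd7_plus_def
  proof (rule card_Sup_ordIso[OF csuc])
    fix r assume "r \<in> {cardSuc (algebraic_density D) | D :: 'a gorder. homomorphic_image B D}"
    then obtain D :: "'a gorder" where D: "r = cardSuc (algebraic_density D)" "homomorphic_image B D" by blast
    show "Card_order r" unfolding D(1) by (rule cardSuc_Card_order[OF co_alg[OF D(2)]])
    show "r \<le>o cardSuc lam" unfolding D(1)
      by (rule suc_mono[OF co_alg[OF D(2)] homomorphic_image_algebraic_density[OF D(2) Chd]])
  next
    show "cardSuc (algebraic_density C) \<in> {cardSuc (algebraic_density D) | D :: 'a gorder. homomorphic_image B D}"
      using C(1) by blast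
    have "lam \<le>o algebraic_density C" by (rule ordLeq_transitive[OF lamC top_alg[OF C(1)]])
    then show "cardSuc lam \<le>o cardSuc (algebraic_density C)"
      using cardSuc_mono_ordLeq[OF clam co_alg[OF C(1)]] by blast
  qed
  have hd0: "hd0_plus B =o cardSuc lam"
    unfolding hd0_plus_def topspace_Ult
  proof (rule card_Sup_ordIso[OF csuc])
    fix r assume "r \<in> {cardSuc (density (subtopology (Ult B) Z)) | Z. Z \<subseteq> ultrafilters B}"
    then obtain Z where Z: "r = cardSuc (density (subtopology (Ult B) Z))" "Z \<subseteq> ultrafilters B" by blast
    show "Card_order r" unfolding Z(1) by (rule cardSuc_Card_order[OF density_Card_order[OF Z(2)]])
    show "r \<le>o cardSuc lam" unfolding Z(1)
      by (rule suc_mono[OF density_Card_order[OF Z(2)] density_ordLeq_hereditary_density[OF Z(2)]])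
  next
    show "cardSuc (density (subtopology (Ult B) Y)) \<in> {cardSuc (density (subtopology (Ult B) Z)) | Z. Z \<subseteq> ultrafilters B}"
      using Y(1) by blast
    show "cardSuc lam \<le>o cardSuc (density (subtopology (Ult B) Y))"
      using cardSuc_mono_ordLeq[OF clam density_Card_order[OF Y(1)]] Y(3) by blast
  qed
  have hd5: "hd5_plus B =o cardSuc lam"
    unfolding hd5_plus_def
  proof -
    let ?d = "density (subtopology (Ult B) Y)"
    obtain a where a: "left_separated B ?d a"
      by (rule thick_imp_left_separated[OF density_Card_order[OF Y(1)] thick_density[OF Y(1)]])
    \<comment> \<open>The supremum admits only cardinals on the type of the elements of \<open>B\<close>; \<open>p\<close> is \<open>\<lambda>\<close> there.\<close>
    obtain p :: "'a rel" where p: "lam =o p"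
      using internalize_ordLeq[of lam "hereditary_density B"] ordIso_imp_ordLeq[OF ordIso_symmetric[OF assms(14)]] by blast
    have cp: "Card_order p" by (rule Card_order_ordIso2[OF clam p])
    have "p \<le>o ?d" by (rule ordIso_ordLeq_trans[OF ordIso_symmetric[OF p] Y(3)])
    then obtain a' where a': "left_separated B p a'"
      by (rule left_separated_initial[OF a card_order_on_well_order_on[OF cp]])
    show "card_Sup {cardSuc \<kappa> |\<kappa> :: 'a rel. Card_order \<kappa> \<and> (\<exists>a. left_separated B \<kappa> a)} =o cardSuc lam"
    proof (rule card_Sup_ordIso[OF csuc])
      fix r assume "r \<in> {cardSuc \<kappa> |\<kappa> :: 'a rel. Card_order \<kappa> \<and> (\<exists>a. left_separated B \<kappa> a)}"
      then obtain \<kappa> :: "'a rel" where kk: "r = cardSuc \<kappa>" "Card_order \<kappa>" "\<exists>a. left_separated B \<kappa> a" by blast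
      then obtain b where b: "left_separated B \<kappa> b" by blast
      show "Card_order r" unfolding kk(1) by (rule cardSuc_Card_order[OF kk(2)])
      show "r \<le>o cardSuc lam" unfolding kk(1)
        by (rule suc_mono[OF kk(2) left_separated_ordLeq_hereditary_density[OF kk(2) b]])
    next
      show "cardSuc p \<in> {cardSuc \<kappa> |\<kappa> :: 'a rel. Card_order \<kappa> \<and> (\<exists>a. left_separated B \<kappa> a)}"
        using cp a' by blast
      show "cardSuc lam \<le>o cardSuc p"
        using cardSuc_mono_ordLeq[OF clam cp] ordIso_imp_ordLeq[OF p] by blast
    qed
  qed
  show ?thesis using hd8 hd0 hd7 hd5 by (intro conjI)
qed

end
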